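(* There exists a well-defined category of left fractions $[FDR]\backslash\mathrm{hM}$, isomorphic to the fine shape category $\mathrm{fSh(M)}$.
   Context: All spaces are metrizable topological spaces and all maps are continuous. $\mathrm{hM}$ is the category of metrizable spaces and homotopy classes $[f]$ of continuous maps. A closed subset $X$ of a space $M$ is homotopy negligible in $M$ if there is a homotopy $H\colon M\times[0,1]\to M$ with $H_0=id_M$ and $H(M\times(0,1])\subseteq M\setminus X$. Given closed homotopy negligible subsets $X\subseteq M$ and $Y\subseteq N$, an ($X-Y$-)approaching map $\phi\colon M\setminus X\to N\setminus Y$ is a continuous map such that for every sequence in $M\setminus X$ converging in $M$ to a point of $X$, its $\phi$-image has a subsequence converging in $N$ to a point of $Y$. An approaching homotopy between approaching maps $\phi,\psi\colon M\setminus X\to N\setminus Y$ is an $(X\times[0,1])-Y$-approaching map $\Phi\colon (M\times[0,1])\setminus(X\times[0,1])\to N\setminus Y$ with $\Phi_0=\phi$, $\Phi_1=\psi$. An AR is a space $M$ such that for every space $W$ and closed subset $B\subseteq W$, every map $B\to M$ extends to a map $W\to M$. Every space is a closed homotopy negligible subset of some AR. Fine shape classes: let $M,M'$ be ARs each containing $X$, and $N,N'$ ARs each containing $Y$, as closed homotopy negligible subsets. Approaching maps $\phi\colon M\setminus X\to N\setminus Y$ and $\psi\colon M'\setminus X\to N'\setminus Y$ are of the same fine shape class (from $X$ to $Y$) if there are maps $a\colon M\to M'$ and $b\colon N\to N'$ extending $id_X$ and $id_Y$, with $a^{-1}(X)=X$, $b^{-1}(Y)=Y$, and an approaching homotopy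 between $b\circ\phi$ and $\psi\circ a$ (restricted to $M\setminus X$). The class of $\phi$ is denoted $[\phi]$; the set of all classes is $[X,Y]_{fSh}$. Every class has a representative for any given choice of such ARs $M,N$; classes are composed by choosing representatives with a common middle AR and composing them. A map $f\colon X\to Y$ induces the class $[f]_{fSh}$ of $\bar f|_{M\setminus X}$, where $\bar f\colon M\to N$ is any extension of $f$ with $\bar f^{-1}(Y)=X$. The fine shape category $\mathrm{fSh(M)}$ has all metrizable spaces as objects, fine shape classes as morphisms, and $[id_X]_{fSh}$ as identities. FDR-embeddings: for a closed subset $A$ of a space $X$, the inclusion $A\subseteq X$ is an FDR-embedding if there exist an AR $M$ containing $X$ as a closed homotopy negligible subset, a closed subset $L\subseteq M$ which is an AR with $L\cap X=A$ and $A$ homotopy negligible in $L$, and an $(X\times[0,1])-X$-approaching map $\Phi\colon(M\setminus X)\times[0,1]\to M\setminus X$ with $\Phi_0=id_{M\setminus X}$, $\Phi_1(M\setminus X)=L\setminus A$, and $\Phi_t|_{L\setminus A}=id_{L\setminus A}$ for all $t\in[0,1]$. A closed embedding is an FDR-embedding if the inclusion of its image is. $[FDR]$ is the class of morphisms of $\mathrm{hM}$ consisting of all homotopy classes that can be represented by FDR-embeddings. Left invertibility conditions: a class $\Sigma$ of morphisms of a category $\mathrm{C}$ satisfies them if (1) $\Sigma$ contains all isomorphisms and is closed under composition; (2) for any morphisms $i\colon A\to X$ and $u\colon A\to Y$ with $i\in\Sigma$ there exist an object $Z$ and morphisms $j\colon Y\to Z$, $v\colon X\to Z$ with $ju=vi$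 and $j\in\Sigma$; (3) for any morphisms $u,v\colon X\to Y$ with $ui=vi$ for some $i\colon A\to X$ in $\Sigma$, there exist an object $Z$ and a morphism $j\colon Y\to Z$ in $\Sigma$ with $ju=jv$. Left fractions: given a category $\mathrm{C}$ and a class $\Sigma$ of its morphisms satisfying the left invertibility conditions, the category of left fractions $\Sigma\backslash\mathrm{C}$ has the objects of $\mathrm{C}$; a morphism from $X$ to $Y$ is an equivalence class of cospans $X\xrightarrow{u}P\xleftarrow{i}Y$ (written $i\backslash u$) of morphisms of $\mathrm{C}$ with $i\in\Sigma$, where $X\xrightarrow{u}P\xleftarrow{i}Y$ and $X\xrightarrow{v}Q\xleftarrow{j}Y$ are equivalent precisely when there is a cospan $P\xrightarrow{f}R\xleftarrow{g}Q$ with $fu=gv$, $fi=gj$ and the latter morphism in $\Sigma$. The composition of the classes of $X\xrightarrow{u}P\xleftarrow{i}Y$ and $Y\xrightarrow{v}Q\xleftarrow{j}Z$ is the class of $X\xrightarrow{wu}R\xleftarrow{kj}Z$ for any cospan $P\xrightarrow{w}R\xleftarrow{k}Q$ with $wi=kv$ and $k\in\Sigma$ (one exists by condition (2)). The identity of $X$ is the class of $id_X\backslash id_X$. Here $\mathrm{C}=\mathrm{hM}$ and $\Sigma=[FDR]$.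
   Formalization: Condition (1) asks only for identities and composition, plus isomorphisms that are classes of closed embeddings: [FDR] cannot contain all isomorphisms (e.g. [0,1] → point). "All metrizable spaces" means those on subsets of an arbitrary universe of at least continuum size. *)

theory Defs
  imports "HOL-Analysis.Analysis"
begin

section \<open>Categories and left fractions\<close>

text \<open>
  Hom-sets are indexed by their end points, so distinct hom-sets need not be disjoint.
  For \<open>f : X \<rightarrow> Y\<close> and \<open>g : Y \<rightarrow> Z\<close> the composite \<open>g f\<close> is \<open>Compose C X Y Z g f\<close>.
\<close>

record ('o, 'm) cat =
  Obj :: "'o set"
  Hom :: "'o \<Rightarrow> 'o \<Rightarrow> 'm set"
  Compose :: "'o \<Rightarrow> 'o \<Rightarrow> 'o \<Rightarrow> 'm \<Rightarrow> 'm \<Rightarrow> 'm"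
  Ident :: "'o \<Rightarrow> 'm"

locale category =
  fixes C :: "('o, 'm) cat"
  assumes Ident_in_Hom: "X \<in> Obj C \<Longrightarrow> Ident C X \<in> Hom C X X"
    and Compose_in_Hom:
      "\<lbrakk>X \<in> Obj C; Y \<in> Obj C; Z \<in> Obj C; f \<in> Hom C X Y; g \<in> Hom C Y Z\<rbrakk>
        \<Longrightarrow> Compose C X Y Z g f \<in> Hom C X Z"
    and Compose_Ident_right:
      "\<lbrakk>X \<in> Obj C; Y \<in> Obj C; f \<in> Hom C X Y\<rbrakk> \<Longrightarrow> Compose C X X Y f (Ident C X) = f"
    and Compose_Ident_left:
      "\<lbrakk>X \<in> Obj C; Y \<in> Obj C; f \<in> Hom C X Y\<rbrakk> \<Longrightarrow> Compose C X Y Y (Ident C Y) f = f"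
    and Compose_assoc:
      "\<lbrakk>W \<in> Obj C; X \<in> Obj C; Y \<in> Obj C; Z \<in> Obj C;
        f \<in> Hom C W X; g \<in> Hom C X Y; h \<in> Hom C Y Z\<rbrakk>
        \<Longrightarrow> Compose C W Y Z h (Compose C W X Y g f) = Compose C W X Z (Compose C X Y Z h g) f"

definition isomorphic_categories :: "('o, 'm) cat \<Rightarrow> ('p, 'n) cat \<Rightarrow> bool" where
  "isomorphic_categories C D \<longleftrightarrow>
    (\<exists>(F :: 'o \<Rightarrow> 'p) (G :: 'o \<Rightarrow> 'o \<Rightarrow> 'm \<Rightarrow> 'n).
      bij_betw F (Obj C) (Obj D) \<and>
      (\<forall>X\<in>Obj C. \<forall>Y\<in>Obj C. bij_betw (G X Y) (Hom C X Y) (Hom D (F X) (F Y))) \<and>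
      (\<forall>X\<in>Obj C. G X X (Ident C X) = Ident D (F X)) \<and>
      (\<forall>X\<in>Obj C. \<forall>Y\<in>Obj C. \<forall>Z\<in>Obj C. \<forall>f\<in>Hom C X Y. \<forall>g\<in>Hom C Y Z.
        G X Z (Compose C X Y Z g f) = Compose D (F X) (F Y) (F Z) (G Y Z g) (G X Y f)))"

definition isomorphism_in :: "('o, 'm) cat \<Rightarrow> 'o \<Rightarrow> 'o \<Rightarrow> 'm \<Rightarrow> bool" where
  "isomorphism_in C X Y f \<longleftrightarrow>
    f \<in> Hom C X Y \<and>
    (\<exists>g\<in>Hom C Y X. Compose C X Y X g f = Ident C X \<and> Compose C Y X Y f g = Ident C Y)"

text \<open>
  A class of morphisms is given by a family of subsets \<open>\<Sigma> X Y\<close> of the hom-sets.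
  The first condition is stated with identities, as in Gabriel and Zisman, and not with all
  isomorphisms: an isomorphism of the homotopy category, such as the class of the map from
  \<open>[0,1]\<close> to a point, need not contain any embedding.
\<close>

definition left_invertibility ::
    "('o, 'm) cat \<Rightarrow> ('o \<Rightarrow> 'o \<Rightarrow> 'm set) \<Rightarrow> bool" where
  "left_invertibility C \<Sigma> \<longleftrightarrow>
    (\<forall>X\<in>Obj C. \<forall>Y\<in>Obj C. \<Sigma> X Y \<subseteq> Hom C X Y) \<and>
    (\<forall>X\<in>Obj C. Ident C X \<in> \<Sigma> X X) \<and>
    (\<forall>X\<in>Obj C. \<forall>Y\<in>Obj C. \<forall>Z\<in>Obj C. \<forall>i\<in>\<Sigma> X Y. \<forall>j\<in>\<Sigma> Y Z. Compose C X Y Z j i \<in> \<Sigma> X Z) \<and>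
    (\<forall>A\<in>Obj C. \<forall>X\<in>Obj C. \<forall>Y\<in>Obj C. \<forall>i\<in>\<Sigma> A X. \<forall>u\<in>Hom C A Y.
      \<exists>Z\<in>Obj C. \<exists>j\<in>\<Sigma> Y Z. \<exists>v\<in>Hom C X Z. Compose C A Y Z j u = Compose C A X Z v i) \<and>
    (\<forall>A\<in>Obj C. \<forall>X\<in>Obj C. \<forall>Y\<in>Obj C. \<forall>i\<in>\<Sigma> A X. \<forall>u\<in>Hom C X Y. \<forall>v\<in>Hom C X Y.
      Compose C A X Y u i = Compose C A X Y v i \<longrightarrow>
      (\<exists>Z\<in>Obj C. \<exists>j\<in>\<Sigma> Y Z. Compose C X Y Z j u = Compose C X Y Z j v))"

text \<open>The triple \<open>(P, u, i)\<close> stands for the cospan \<open>u : X \<rightarrow> P\<close>, \<open>i : Y \<rightarrow> P\<close>.\<close>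

definition cospans ::
    "('o, 'm) cat \<Rightarrow> ('o \<Rightarrow> 'o \<Rightarrow> 'm set) \<Rightarrow> 'o \<Rightarrow> 'o \<Rightarrow> ('o \<times> 'm \<times> 'm) set" where
  "cospans C \<Sigma> X Y = {(P, u, i). P \<in> Obj C \<and> u \<in> Hom C X P \<and> i \<in> \<Sigma> Y P}"

definition cospan_rel ::
    "('o, 'm) cat \<Rightarrow> ('o \<Rightarrow> 'o \<Rightarrow> 'm set) \<Rightarrow> 'o \<Rightarrow> 'o \<Rightarrow>
      (('o \<times> 'm \<times> 'm) \<times> ('o \<times> 'm \<times> 'm)) set" where
  "cospan_rel C \<Sigma> X Y =
    {((P, u, i), (Q, v, j)).
      (P, u, i) \<in> cospans C \<Sigma> X Y \<and> (Q, v, j) \<in> cospans C \<Sigma> X Y \<and>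
      (\<exists>R\<in>Obj C. \<exists>f\<in>Hom C P R. \<exists>g\<in>Hom C Q R.
        Compose C X P R f u = Compose C X Q R g v \<and>
        Compose C Y P R f i = Compose C Y Q R g j \<and>
        Compose C Y Q R g j \<in> \<Sigma> Y R)}"

fun composite_cospan ::
    "('o, 'm) cat \<Rightarrow> ('o \<Rightarrow> 'o \<Rightarrow> 'm set) \<Rightarrow> 'o \<Rightarrow> 'o \<Rightarrow> 'o \<Rightarrow>
      ('o \<times> 'm \<times> 'm) \<Rightarrow> ('o \<times> 'm \<times> 'm) \<Rightarrow> ('o \<times> 'm \<times> 'm) \<Rightarrow> bool" where
  "composite_cospan C \<Sigma> X Y Z (P, u, i) (Q, v, j) (R, s, l) \<longleftrightarrow>
    R \<in> Obj C \<and>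
    (\<exists>w\<in>Hom C P R. \<exists>k\<in>\<Sigma> Q R.
      Compose C Y P R w i = Compose C Y Q R k v \<and>
      s = Compose C X P R w u \<and> l = Compose C Z Q R k j)"

text \<open>
  The composite of two classes is the union of the classes of all their composite cospans, over
  all choices of representatives and of \<open>w\<close>, \<open>k\<close>; it is a single class exactly if these
  choices do not matter.
\<close>

definition left_fractions ::
    "('o, 'm) cat \<Rightarrow> ('o \<Rightarrow> 'o \<Rightarrow> 'm set) \<Rightarrow> ('o, ('o \<times> 'm \<times> 'm) set) cat" where
  "left_fractions C \<Sigma> =
    \<lparr>Obj = Obj C,
     Hom = (\<lambda>X Y. cospans C \<Sigma> X Y // cospan_rel C \<Sigma> X Y),
     Compose = (\<lambda>X Y Z b a.
       {d. \<exists>p\<in>a. \<exists>q\<in>b. \<exists>c. composite_cospan C \<Sigma> X Y Z p q c \<and> (c, d) \<in> cospan_rel C \<Sigma> X Z}),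
     Ident = (\<lambda>X. cospan_rel C \<Sigma> X X `` {(X, Ident C X, Ident C X)})\<rparr>"

definition left_fractions_well_defined ::
    "('o, 'm) cat \<Rightarrow> ('o \<Rightarrow> 'o \<Rightarrow> 'm set) \<Rightarrow> bool" where
  "left_fractions_well_defined C \<Sigma> \<longleftrightarrow>
    (\<forall>X\<in>Obj C. \<forall>Y\<in>Obj C. equiv (cospans C \<Sigma> X Y) (cospan_rel C \<Sigma> X Y)) \<and>
    (\<forall>X\<in>Obj C. \<forall>Y\<in>Obj C. \<forall>Z\<in>Obj C. \<forall>p\<in>cospans C \<Sigma> X Y. \<forall>q\<in>cospans C \<Sigma> Y Z.
      \<exists>c. composite_cospan C \<Sigma> X Y Z p q c) \<and>
    (\<forall>X\<in>Obj C. \<forall>Y\<in>Obj C. \<forall>Z\<in>Obj C. \<forall>p p' q q' c c'.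
      (p, p') \<in> cospan_rel C \<Sigma> X Y \<and> (q, q') \<in> cospan_rel C \<Sigma> Y Z \<and>
      composite_cospan C \<Sigma> X Y Z p q c \<and> composite_cospan C \<Sigma> X Y Z p' q' c' \<longrightarrow>
      (c, c') \<in> cospan_rel C \<Sigma> X Z) \<and>
    category (left_fractions C \<Sigma>)"


section \<open>The homotopy category of metrizable spaces\<close>

text \<open>
  Spaces are topologies with carrier contained in a type \<open>'u\<close>, which plays the role of a
  universe.
\<close>

definition homotopy_class :: "'u topology \<Rightarrow> 'u topology \<Rightarrow> ('u \<Rightarrow> 'u) \<Rightarrow> ('u \<Rightarrow> 'u) set" where
  "homotopy_class X Y f = {g. homotopic_with (\<lambda>_. True) X Y f g}"

definition hM :: "('u topology, ('u \<Rightarrow> 'u) set) cat" where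
  "hM =
    \<lparr>Obj = {X. metrizable_space X},
     Hom = (\<lambda>X Y. {homotopy_class X Y f |f. continuous_map X Y f}),
     Compose = (\<lambda>X Y Z b a. \<Union>f\<in>a. \<Union>g\<in>b. homotopy_class X Z (g \<circ> f)),
     Ident = (\<lambda>X. homotopy_class X X id)\<rparr>"


section \<open>Absolute retracts and approaching maps\<close>

abbreviation unit_interval :: "real topology" where
  "unit_interval \<equiv> top_of_set {0..1}"

definition homotopy_negligible :: "'a topology \<Rightarrow> 'a set \<Rightarrow> bool" where
  "homotopy_negligible M X \<longleftrightarrow>
    closedin M X \<and>
    (\<exists>H. continuous_map (prod_topology M unit_interval) M H \<and>
      (\<forall>x\<in>topspace M. H (x, 0) = x) \<and>
      (\<forall>x\<in>topspace M. \<forall>t\<in>{0<..1}. H (x, t) \<in> topspace M - X))"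

text \<open>
  The test spaces \<open>W\<close> live in the same type as \<open>M\<close>. If this type has at least the cardinality of
  the continuum, \<open>M\<close> has a copy on it that is closed in a convex subset of a normed space on
  it, hence is a retract of that subset; so the extension property for such \<open>W\<close> implies
  the one for all metrizable \<open>W\<close>, by Dugundji's theorem.
\<close>

definition AR_space :: "'u topology \<Rightarrow> bool" where
  "AR_space M \<longleftrightarrow>
    metrizable_space M \<and>
    (\<forall>(W :: 'u topology) B f.
      metrizable_space W \<and> closedin W B \<and> continuous_map (subtopology W B) M f \<longrightarrow>
      (\<exists>g. continuous_map W M g \<and> (\<forall>x\<in>B. g x = f x)))"

definition approaching_map ::
    "'a topology \<Rightarrow> 'a set \<Rightarrow> 'b topology \<Rightarrow> 'b set \<Rightarrow> ('a \<Rightarrow> 'b) \<Rightarrow> bool" where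
  "approaching_map M X N Y \<phi> \<longleftrightarrow>
    continuous_map (subtopology M (topspace M - X)) (subtopology N (topspace N - Y)) \<phi> \<and>
    (\<forall>s x. range s \<subseteq> topspace M - X \<and> x \<in> X \<and> limitin M s x sequentially \<longrightarrow>
      (\<exists>(r :: nat \<Rightarrow> nat) y. strict_mono r \<and> y \<in> Y \<and> limitin N (\<phi> \<circ> s \<circ> r) y sequentially))"

definition approaching_homotopic ::
    "'a topology \<Rightarrow> 'a set \<Rightarrow> 'b topology \<Rightarrow> 'b set \<Rightarrow> ('a \<Rightarrow> 'b) \<Rightarrow> ('a \<Rightarrow> 'b) \<Rightarrow> bool" where
  "approaching_homotopic M X N Y \<phi> \<psi> \<longleftrightarrow>
    (\<exists>\<Phi>. approaching_map (prod_topology M unit_interval) (X \<times> {0..1}) N Y \<Phi> \<and>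
      (\<forall>x\<in>topspace M - X. \<Phi> (x, 0) = \<phi> x \<and> \<Phi> (x, 1) = \<psi> x))"


section \<open>The fine shape category\<close>

text \<open>
  As the carrier of a space may exhaust the universe, a space \<open>M\<close> containing \<open>X\<close> as a closed
  subset is rendered as a space together with a closed embedding \<open>e\<close> of \<open>X\<close>, whose image is
  identified with \<open>X\<close>. In particular maps extending the identity of \<open>X\<close> become maps commuting
  with the embeddings.
\<close>

definition AR_hull :: "'u topology \<Rightarrow> 'u topology \<times> ('u \<Rightarrow> 'u) \<Rightarrow> bool" where
  "AR_hull X = (\<lambda>(M, e). AR_space M \<and> embedding_map X M e \<and> homotopy_negligible M (e ` topspace X))"

type_synonym 'u fsh_rep =
  "('u topology \<times> ('u \<Rightarrow> 'u)) \<times> ('u topology \<times> ('u \<Rightarrow> 'u)) \<times> ('u \<Rightarrow> 'u)"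

definition fsh_reps :: "'u topology \<Rightarrow> 'u topology \<Rightarrow> 'u fsh_rep set" where
  "fsh_reps X Y =
    {((M, e), (N, d), \<phi>). AR_hull X (M, e) \<and> AR_hull Y (N, d) \<and>
      approaching_map M (e ` topspace X) N (d ` topspace Y) \<phi>}"

definition hull_map ::
    "'u topology \<Rightarrow> 'u topology \<times> ('u \<Rightarrow> 'u) \<Rightarrow> 'u topology \<Rightarrow> 'u topology \<times> ('u \<Rightarrow> 'u) \<Rightarrow>
      ('u \<Rightarrow> 'u) \<Rightarrow> ('u \<Rightarrow> 'u) \<Rightarrow> bool"
    \<comment> \<open>\<open>g : M \<rightarrow> N\<close> extends \<open>f : X \<rightarrow> Y\<close> and the preimage of \<open>Y\<close> under \<open>g\<close> is \<open>X\<close>\<close> where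
  "hull_map X = (\<lambda>(M, e) Y (N, d) f g.
    continuous_map M N g \<and> (\<forall>x\<in>topspace X. g (e x) = d (f x)) \<and>
    {x \<in> topspace M. g x \<in> d ` topspace Y} = e ` topspace X)"

definition fsh_rel :: "'u topology \<Rightarrow> 'u topology \<Rightarrow> ('u fsh_rep \<times> 'u fsh_rep) set" where
  "fsh_rel X Y =
    {(((M, e), (N, d), \<phi>), ((M', e'), (N', d'), \<psi>)).
      ((M, e), (N, d), \<phi>) \<in> fsh_reps X Y \<and> ((M', e'), (N', d'), \<psi>) \<in> fsh_reps X Y \<and>
      (\<exists>a b. hull_map X (M, e) X (M', e') id a \<and> hull_map Y (N, d) Y (N', d') id b \<and>
        approaching_homotopic M (e ` topspace X) N' (d' ` topspace Y) (b \<circ> \<phi>) (\<psi> \<circ> a))}"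

definition induced_fsh_class ::
    "'u topology \<Rightarrow> 'u topology \<Rightarrow> ('u \<Rightarrow> 'u) \<Rightarrow> 'u fsh_rep set" where
  "induced_fsh_class X Y f =
    {\<rho>. \<exists>m n g. AR_hull X m \<and> AR_hull Y n \<and> hull_map X m Y n f g \<and> ((m, n, g), \<rho>) \<in> fsh_rel X Y}"

definition fSh :: "('u topology, 'u fsh_rep set) cat" where
  "fSh =
    \<lparr>Obj = {X. metrizable_space X},
     Hom = (\<lambda>X Y. fsh_reps X Y // fsh_rel X Y),
     Compose = (\<lambda>X Y Z \<beta> \<alpha>.
       {\<rho>. \<exists>m n p \<phi> \<psi>. (m, n, \<phi>) \<in> \<alpha> \<and> (n, p, \<psi>) \<in> \<beta> \<and> ((m, p, \<psi> \<circ> \<phi>), \<rho>) \<in> fsh_rel X Z}),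
     Ident = (\<lambda>X. induced_fsh_class X X id)\<rparr>"


section \<open>FDR-embeddings\<close>

definition closed_embedding :: "'a topology \<Rightarrow> 'b topology \<Rightarrow> ('a \<Rightarrow> 'b) \<Rightarrow> bool" where
  "closed_embedding X Y f \<longleftrightarrow> embedding_map X Y f \<and> closedin Y (f ` topspace X)"

definition FDR_inclusion :: "'u topology \<Rightarrow> 'u set \<Rightarrow> bool" where
  "FDR_inclusion X A \<longleftrightarrow>
    closedin X A \<and>
    (\<exists>M e L \<Phi>.
      AR_hull X (M, e) \<and>
      closedin M L \<and> AR_space (subtopology M L) \<and>
      L \<inter> e ` topspace X = e ` A \<and>
      homotopy_negligible (subtopology M L) (e ` A) \<and>
      approaching_map (prod_topology M unit_interval) (e ` topspace X \<times> {0..1})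
        M (e ` topspace X) \<Phi> \<and>
      (\<forall>x\<in>topspace M - e ` topspace X. \<Phi> (x, 0) = x) \<and>
      (\<lambda>x. \<Phi> (x, 1)) ` (topspace M - e ` topspace X) = L - e ` A \<and>
      (\<forall>x\<in>L - e ` A. \<forall>t\<in>{0..1}. \<Phi> (x, t) = x))"

definition FDR_embedding :: "'u topology \<Rightarrow> 'u topology \<Rightarrow> ('u \<Rightarrow> 'u) \<Rightarrow> bool" where
  "FDR_embedding X Y i \<longleftrightarrow> closed_embedding X Y i \<and> FDR_inclusion Y (i ` topspace X)"

definition FDR :: "'u topology \<Rightarrow> 'u topology \<Rightarrow> ('u \<Rightarrow> 'u) set set" where
  "FDR X Y = {homotopy_class X Y i |i. FDR_embedding X Y i}"

end

theory Submission
  imports Defs "HOL-Probability.Discrete_Topology"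
begin

text \<open>
  Let \<open>Q\<close> be the functor from the homotopy category to the fine shape category that sends \<open>[f]\<close> to
  the class induced by \<open>f\<close>. The FDR-embeddings are exactly the closed embeddings \<open>i\<close> for which \<open>Q[i]\<close>
  is an isomorphism: a fine shape inverse provides a deformation of pairs, which can be made strong.
  An approaching map \<open>\<phi> : M \<setminus> X \<rightarrow> N \<setminus> Y\<close> has a mapping cylinder containing \<open>X\<close> and \<open>Y\<close>, in which
  \<open>Y\<close> is a closed subset with \<open>Q[Y \<rightarrow> Z]\<close> invertible; hence every fine shape class is a left fraction
  of maps. The same construction applied to an approaching homotopy shows that two maps with equal
  images under \<open>Q\<close> become homotopic after composition with an FDR-embedding. A functor that inverts
  a class of morphisms, is bijective on objects, and is full and faithful up to fractions in this
  sense is a localization by left fractions.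
\<close>

section \<open>Sequences in metrizable spaces\<close>

lemma closedin_sequentially:
  assumes "metrizable_space X"
  shows "closedin X S \<longleftrightarrow>
    S \<subseteq> topspace X \<and> (\<forall>s x. range s \<subseteq> S \<and> limitin X s x sequentially \<longrightarrow> x \<in> S)"
proof -
  from assms obtain M d where "Metric_space M d" and X: "X = Metric_space.mtopology M d"
    by (auto simp: metrizable_space_def)
  then interpret Metric_space M d by simp
  show ?thesis
    by (simp add: X metric_closedin_iff_sequentially_closed)
qed

lemma limitin_unique_metrizable:
  assumes "metrizable_space X" "limitin X s x sequentially" "limitin X s y sequentially"
  shows "x = y"
  by (rule limitin_Hausdorff_unique[OF assms(2,3)])
    (use assms(1) metrizable_imp_Hausdorff_space in auto)

lemma continuous_map_sequentiallyI:
  assumes X: "metrizable_space X" and im: "\<And>x. x \<in> topspace X \<Longrightarrow> f x \<in> topspace Y"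
    and f: "\<And>s x. \<lbrakk>range s \<subseteq> topspace X; limitin X s x sequentially\<rbrakk> \<Longrightarrow>
      \<exists>r. strict_mono (r :: nat \<Rightarrow> nat) \<and> limitin Y (f \<circ> s \<circ> r) (f x) sequentially"
  shows "continuous_map X Y f"
  unfolding continuous_map_closedin
proof (intro conjI ballI allI impI)
  show "f \<in> topspace X \<rightarrow> topspace Y" using im by auto
  fix C assume C: "closedin Y C"
  show "closedin X {x \<in> topspace X. f x \<in> C}"
    unfolding closedin_sequentially[OF X]
  proof (intro conjI allI impI)
    fix s x assume s: "range s \<subseteq> {x \<in> topspace X. f x \<in> C} \<and> limitin X s x sequentially"
    then have x: "x \<in> topspace X" using limitin_topspace by metis
    from s f[of s x] obtain r where r: "strict_mono (r :: nat \<Rightarrow> nat)"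
      and l: "limitin Y (f \<circ> s \<circ> r) (f x) sequentially"
      by blast
    have "f x \<in> C"
      by (rule limitin_closedin[OF l C]) (use s in \<open>auto intro!: always_eventually\<close>)
    with x show "x \<in> {x \<in> topspace X. f x \<in> C}" by simp
  qed auto
qed

lemma continuous_map_sequentiallyD:
  assumes "continuous_map X Y f" "limitin X s x sequentially"
  shows "limitin Y (\<lambda>n. f (s n)) (f x) sequentially"
  using continuous_map_limit[OF assms] by (simp add: o_def)

lemma subsequence_cases:
  fixes P :: "nat \<Rightarrow> bool"
  obtains r where "strict_mono (r :: nat \<Rightarrow> nat)" "\<And>n. P (r n)"
  | r where "strict_mono (r :: nat \<Rightarrow> nat)" "\<And>n. \<not> P (r n)"
proof (cases "infinite {n. P n}")
  case True
  then show thesis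
    using that(1)[of "enumerate {n. P n}"] strict_mono_enumerate enumerate_in_set by blast
next
  case False
  then have "infinite {n. \<not> P n}"
    by (metis (mono_tags, lifting) Collect_neg_eq finite_Collect_not infinite_UNIV_nat)
  then show thesis
    using that(2)[of "enumerate {n. \<not> P n}"] strict_mono_enumerate enumerate_in_set by blast
qed

lemma unit_interval_subsequence:
  fixes t :: "nat \<Rightarrow> real"
  assumes "range t \<subseteq> {0..1}"
  obtains r l where "strict_mono (r :: nat \<Rightarrow> nat)" "l \<in> {0..1}" "(t \<circ> r) \<longlonglongrightarrow> l"
  using assms compact_Icc[of 0 "1::real"] unfolding compact_def by (metis range_subsetD)

lemma limitin_unit_interval:
  "limitin unit_interval t l sequentially \<longleftrightarrow>
    l \<in> {0..1} \<and> (\<forall>\<^sub>F n in sequentially. t n \<in> {0..1}) \<and> t \<longlonglongrightarrow> l"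
  by (simp add: limitin_subtopology)

lemma limitin_Pair:
  "limitin (prod_topology X Y) s (x, y) F \<longleftrightarrow>
    limitin X (\<lambda>n. fst (s n)) x F \<and> limitin Y (\<lambda>n. snd (s n)) y F"
  by (simp add: limitin_pairwise o_def)

lemma metrizable_unit_interval: "metrizable_space unit_interval"
  by (simp add: metrizable_space_euclidean metrizable_space_subtopology)

lemma metrizable_prod_unit_interval:
  "metrizable_space X \<Longrightarrow> metrizable_space (prod_topology X unit_interval)"
  by (simp add: metrizable_space_prod_topology metrizable_unit_interval)

lemma (in Metric_space) distance_function:
  assumes C: "closedin mtopology C" and ne: "C \<noteq> {}"
  obtains g :: "'a \<Rightarrow> real" where "\<And>x. g x \<ge> 0" "\<And>x c. c \<in> C \<Longrightarrow> g x \<le> d x c"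
    "\<And>x y. \<lbrakk>x \<in> M; y \<in> M\<rbrakk> \<Longrightarrow> \<bar>g x - g y\<bar> \<le> d x y"
    "\<And>x. x \<in> M \<Longrightarrow> g x = 0 \<longleftrightarrow> x \<in> C" "\<And>x r. g x < r \<Longrightarrow> \<exists>c\<in>C. d x c < r"
proof
  have CM: "C \<subseteq> M" using C closedin_subset by fastforce
  define g where "g x = (INF c\<in>C. d x c)" for x
  have bdd: "bdd_below (d x ` C)" for x by (rule bdd_belowI2[of _ 0]) simp
  show g0: "g x \<ge> 0" for x unfolding g_def using ne by (intro cINF_greatest) auto
  show le: "g x \<le> d x c" if "c \<in> C" for x c unfolding g_def by (rule cINF_lower[OF bdd that])
  show ex: "\<exists>c\<in>C. d x c < r" if "g x < r" for x r
    using that cINF_less_iff[OF ne bdd] by (simp add: g_def)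
  have lip: "g x \<le> d x y + g y" if "x \<in> M" "y \<in> M" for x y
  proof -
    have "g x - d x y \<le> g y"
      unfolding g_def[of y]
    proof (rule cINF_greatest[OF ne])
      fix c assume c: "c \<in> C"
      have "g x \<le> d x c" by (rule le[OF c])
      also have "\<dots> \<le> d x y + d y c" using c CM that triangle by blast
      finally show "g x - d x y \<le> d y c" by simp
    qed
    then show ?thesis by simp
  qed
  show "\<bar>g x - g y\<bar> \<le> d x y" if "x \<in> M" "y \<in> M" for x y
    using lip[OF that] lip[OF that(2,1)] by (simp add: commute abs_le_iff)
  show "g x = 0 \<longleftrightarrow> x \<in> C" if x: "x \<in> M" for x
  proof
    assume "x \<in> C"
    from le[OF this, of x] x g0[of x] show "g x = 0" by simp
  next
    assume g: "g x = 0"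
    show "x \<in> C"
    proof (rule ccontr)
      assume "x \<notin> C"
      with x C obtain e where e: "e > 0" "disjnt C (mball x e)"
        by (auto simp: closedin_metric)
      with g ex[of x e] obtain c where "c \<in> C" "d x c < e" by auto
      with e CM x show False by (force simp: disjnt_iff in_mball)
    qed
  qed
qed

lemma (in Metric_space) continuous_map_Lipschitz:
  assumes "\<And>x y. \<lbrakk>x \<in> M; y \<in> M\<rbrakk> \<Longrightarrow> \<bar>g x - g y\<bar> \<le> d x y"
  shows "continuous_map mtopology euclideanreal g"
proof (rule continuous_map_sequentiallyI[OF metrizable_space_mtopology])
  fix s x assume s: "range s \<subseteq> topspace mtopology" "limitin mtopology s x sequentially"
  then have x: "x \<in> M" using limitin_topspace by fastforce
  have "(\<lambda>n. d (s n) x) \<longlonglongrightarrow> 0"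
    using s(2) x by (simp add: limit_metric_sequentially lim_sequentially) (meson less_imp_le_nat)
  then have "(\<lambda>n. g (s n) - g x) \<longlonglongrightarrow> 0"
    by (rule Lim_null_comparison[rotated]) (use s x assms in \<open>auto intro!: always_eventually\<close>)
  then have "(\<lambda>n. g (s n)) \<longlonglongrightarrow> g x" by (simp add: LIM_zero_iff)
  then show "\<exists>r. strict_mono (r :: nat \<Rightarrow> nat) \<and> limitin euclidean (g \<circ> s \<circ> r) (g x) sequentially"
    by (intro exI[of _ id]) (simp add: o_def strict_mono_id)
qed auto

lemma closed_zero_set:
  assumes "metrizable_space X" "closedin X C"
  obtains f where "continuous_map X unit_interval f"
    "\<And>x. x \<in> topspace X \<Longrightarrow> f x = 0 \<longleftrightarrow> x \<in> C"
proof (cases "C = {}")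
  case True
  then show thesis by (intro that[of "\<lambda>_. 1"]) auto
next
  case False
  from assms(1) obtain M d where "Metric_space M d" and X: "X = Metric_space.mtopology M d"
    by (auto simp: metrizable_space_def)
  then interpret Metric_space M d by simp
  from distance_function[OF assms(2)[unfolded X] False] obtain g :: "'a \<Rightarrow> real"
    where g: "\<And>x. g x \<ge> 0" "\<And>x y. \<lbrakk>x \<in> M; y \<in> M\<rbrakk> \<Longrightarrow> \<bar>g x - g y\<bar> \<le> d x y"
      "\<And>x. x \<in> M \<Longrightarrow> g x = 0 \<longleftrightarrow> x \<in> C"
    by metis
  have cont: "continuous_map X euclideanreal g"
    unfolding X by (rule continuous_map_Lipschitz[OF g(2)])
  show thesis
  proof (rule that[of "\<lambda>x. min 1 (g x)"])
    show "continuous_map X unit_interval (\<lambda>x. min 1 (g x))"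
      using cont g(1) by (auto simp: continuous_map_in_subtopology intro!: continuous_map_real_min)
    fix x assume "x \<in> topspace X"
    with g(3)[of x] g(1)[of x] show "min 1 (g x) = 0 \<longleftrightarrow> x \<in> C"
      by (auto simp: X min_def)
  qed
qed

lemma continuous_map_Un_closed:
  assumes "closedin X C" "closedin X D" "continuous_map (subtopology X C) Y f"
    "continuous_map (subtopology X D) Y f"
  shows "continuous_map (subtopology X (C \<union> D)) Y f"
proof (rule pasting_lemma_closed[where I = "{True, False}" and T = "\<lambda>b. if b then C else D" and f = "\<lambda>_. f"])
  have "closedin (subtopology X (C \<union> D)) C" "closedin (subtopology X (C \<union> D)) D"
    using assms by (auto intro!: closedin_subset_topspace)
  then show "closedin (subtopology X (C \<union> D)) (if i then C else D)" for i by simp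
  show "continuous_map (subtopology (subtopology X (C \<union> D)) (if i then C else D)) Y f" for i
    using assms by (simp add: subtopology_subtopology Int_absorb1)
qed auto

lemma closedin_continuous_le:
  assumes "continuous_map X euclideanreal f" "continuous_map X euclideanreal g"
  shows "closedin X {x \<in> topspace X. f x \<le> g x}"
proof -
  have "continuous_map X euclideanreal (\<lambda>x. f x - g x)"
    using assms by (intro continuous_map_diff)
  from closedin_continuous_map_preimage[OF this, of "{..0}"] show ?thesis by auto
qed

section \<open>Absolute extensors for spaces of bounded cardinality\<close>

lemma copy_topology:
  fixes W :: "'w topology" and c :: "'w \<Rightarrow> 'u"
  assumes "inj_on c (topspace W)"
  obtains W' where "homeomorphic_map W W' c"
proof -
  define W' where "W' = pullback_topology (c ` topspace W) (inv_into (topspace W) c) W"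
  have top: "topspace W' = c ` topspace W"
    using assms by (auto simp: W'_def topspace_pullback_topology)
  have "homeomorphic_map W W' c"
  proof (rule bijective_open_imp_homeomorphic_map)
    show "continuous_map W W' c"
      unfolding W'_def
    proof (rule continuous_map_pullback')
      show "continuous_map W W (inv_into (topspace W) c \<circ> c)"
        by (rule continuous_map_eq[OF continuous_map_id]) (use assms in auto)
    qed auto
    show "open_map W W' c"
      unfolding open_map_def
    proof (intro allI impI)
      fix U assume U: "openin W U"
      then have "U \<subseteq> topspace W" by (rule openin_subset)
      then have "c ` U = inv_into (topspace W) c -` U \<inter> c ` topspace W"
        using assms by (auto simp: subset_iff)
      with U show "openin W' (c ` U)" by (auto simp: W'_def openin_pullback_topology)
    qed
  qed (use assms top in auto)
  then show thesis by (rule that)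
qed

definition abs_extensor :: "'u itself \<Rightarrow> 'a topology \<Rightarrow> bool" where
  "abs_extensor _ N \<longleftrightarrow>
    metrizable_space N \<and>
    (\<forall>(W :: 'u topology) B f.
      metrizable_space W \<and> closedin W B \<and> continuous_map (subtopology W B) N f \<longrightarrow>
      (\<exists>g. continuous_map W N g \<and> (\<forall>x\<in>B. g x = f x)))"

lemma AR_space_iff_abs_extensor: "AR_space (N :: 'u topology) \<longleftrightarrow> abs_extensor TYPE('u) N"
  by (simp add: AR_space_def abs_extensor_def)

lemma abs_extensor_metrizable: "abs_extensor T N \<Longrightarrow> metrizable_space N"
  by (simp add: abs_extensor_def)

lemma homeomorphic_metrizable:
  "homeomorphic_map X Y f \<Longrightarrow> metrizable_space X \<longleftrightarrow> metrizable_space Y"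
  using homeomorphic_map_imp_homeomorphic_space homeomorphic_metrizable_space by blast

lemma abs_extensor_extend:
  fixes W :: "'w topology" and N :: "'a topology"
  assumes N: "abs_extensor TYPE('u) N" and card: "topspace W \<lesssim> (UNIV :: 'u set)"
    and W: "metrizable_space W" and B: "closedin W B"
    and f: "continuous_map (subtopology W B) N f"
  obtains g where "continuous_map W N g" "\<And>x. x \<in> B \<Longrightarrow> g x = f x"
proof -
  from card obtain c :: "'w \<Rightarrow> 'u" where c: "inj_on c (topspace W)" by (auto simp: lepoll_def)
  from copy_topology[OF c] obtain W' where h: "homeomorphic_map W W' c" .
  from h obtain c' where cc': "homeomorphic_maps W W' c c'"
    using homeomorphic_map_maps by blast
  have BW: "B \<subseteq> topspace W" using B by (rule closedin_subset)
  have W': "metrizable_space W'" using h W homeomorphic_metrizable by blast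
  have cB: "closedin W' (c ` B)"
    using h B BW homeomorphic_map_closedness by blast
  have c'c: "c' (c x) = x" if "x \<in> topspace W" for x
    using cc' that by (simp add: homeomorphic_maps_def)
  have cc: "continuous_map W W' c" and cc'': "continuous_map W' W c'"
    using cc' by (auto simp: homeomorphic_maps_def)
  have "c' \<in> topspace (subtopology W' (c ` B)) \<rightarrow> B"
    using BW c'c by auto
  then have "continuous_map (subtopology W' (c ` B)) (subtopology W B) c'"
    using cc'' by (auto simp: continuous_map_in_subtopology continuous_map_from_subtopology)
  then have "continuous_map (subtopology W' (c ` B)) N (f \<circ> c')"
    using f continuous_map_compose by blast
  with N W' cB obtain g where g: "continuous_map W' N g" "\<forall>x\<in>c ` B. g x = (f \<circ> c') x"
    unfolding abs_extensor_def by blast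
  show thesis
  proof (rule that[of "g \<circ> c"])
    show "continuous_map W N (g \<circ> c)" using cc g(1) continuous_map_compose by blast
    show "(g \<circ> c) x = f x" if "x \<in> B" for x using that g(2) c'c BW by auto
  qed
qed

lemma abs_extensor_homeomorphic:
  assumes N: "abs_extensor T N" and h: "homeomorphic_map N N' c"
  shows "abs_extensor T N'"
  unfolding abs_extensor_def
proof (intro conjI allI impI)
  show "metrizable_space N'" using N h homeomorphic_metrizable abs_extensor_metrizable by blast
  from h obtain c' where cc': "homeomorphic_maps N N' c c'"
    using homeomorphic_map_maps by blast
  fix W :: "'a topology" and B f
  assume W: "metrizable_space W \<and> closedin W B \<and> continuous_map (subtopology W B) N' f"
  then have "continuous_map (subtopology W B) N (c' \<circ> f)"
    using cc' continuous_map_compose homeomorphic_maps_def by blast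
  with N W obtain g where g: "continuous_map W N g" "\<forall>x\<in>B. g x = (c' \<circ> f) x"
    unfolding abs_extensor_def by metis
  have "c (g x) = f x" if "x \<in> B" for x
  proof -
    have "f x \<in> topspace N'"
      using W that closedin_subset[of W B] by (auto simp: continuous_map_def Pi_iff)
    then show ?thesis using that g(2) cc' by (simp add: homeomorphic_maps_def)
  qed
  then show "\<exists>g. continuous_map W N' g \<and> (\<forall>x\<in>B. g x = f x)"
    using g(1) cc' by (intro exI[of _ "c \<circ> g"])
      (auto simp: homeomorphic_maps_def intro: continuous_map_compose)
qed

lemma abs_extensor_prod:
  assumes M: "abs_extensor TYPE('u) M" and N: "abs_extensor TYPE('u) N"
  shows "abs_extensor TYPE('u) (prod_topology M N)"
  unfolding abs_extensor_def
proof (intro conjI allI impI)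
  show "metrizable_space (prod_topology M N)"
    using abs_extensor_metrizable[OF M] abs_extensor_metrizable[OF N]
    by (simp add: metrizable_space_prod_topology)
  fix W :: "'u topology" and B f
  assume W: "metrizable_space W \<and> closedin W B \<and>
    continuous_map (subtopology W B) (prod_topology M N) f"
  then have "continuous_map (subtopology W B) M (fst \<circ> f)" "continuous_map (subtopology W B) N (snd \<circ> f)"
    by (auto simp: continuous_map_pairwise)
  with W M N obtain g1 g2 where "continuous_map W M g1" "\<forall>x\<in>B. g1 x = (fst \<circ> f) x"
    "continuous_map W N g2" "\<forall>x\<in>B. g2 x = (snd \<circ> f) x"
    unfolding abs_extensor_def by metis
  then show "\<exists>g. continuous_map W (prod_topology M N) g \<and> (\<forall>x\<in>B. g x = f x)"
    by (intro exI[of _ "\<lambda>x. (g1 x, g2 x)"]) (auto simp: continuous_map_paired)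
qed

lemma abs_extensor_unit_interval: "abs_extensor T unit_interval"
  unfolding abs_extensor_def
proof (intro conjI allI impI)
  show "metrizable_space unit_interval" by (rule metrizable_unit_interval)
  fix W :: "'a topology" and B f
  assume W: "metrizable_space W \<and> closedin W B \<and> continuous_map (subtopology W B) unit_interval f"
  then have "continuous_map (subtopology W B) euclideanreal f" "f ` B \<subseteq> {0..1}"
    using closedin_subset[of W B] by (auto simp: continuous_map_in_subtopology)
  from Tietze_extension_closed_real_interval[OF _ _ this zero_le_one] W
  obtain g where "continuous_map W euclideanreal g" "\<And>x. x \<in> B \<Longrightarrow> g x = f x"
    "g ` topspace W \<subseteq> {0..1}"
    using metrizable_imp_normal_space by blast
  then show "\<exists>g. continuous_map W unit_interval g \<and> (\<forall>x\<in>B. g x = f x)"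
    by (intro exI[of _ g]) (auto simp: continuous_map_in_subtopology)
qed

lemma abs_extensor_nonempty: "abs_extensor TYPE('u) N \<Longrightarrow> topspace N \<noteq> {}"
proof
  assume N: "abs_extensor TYPE('u) N" "topspace N = {}"
  have "continuous_map (subtopology (discrete_topology (UNIV :: 'u set)) {}) N f" for f
    by (simp add: continuous_map_def)
  moreover have "metrizable_space (discrete_topology (UNIV :: 'u set))"
    "closedin (discrete_topology (UNIV :: 'u set)) {}"
    by (simp_all add: metrizable_space_discrete_topology)
  ultimately obtain g where "continuous_map (discrete_topology (UNIV :: 'u set)) N g"
    using N(1) unfolding abs_extensor_def by blast
  with N(2) show False by (auto simp: continuous_map_def)
qed

text \<open>
  An extension is pushed off \<open>Y\<close> by the homotopy witnessing negligibility, run for a time that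
  vanishes exactly on \<open>C\<close>.
\<close>

lemma pushoff_extension:
  fixes W :: "'w topology" and N :: "'a topology"
  assumes N: "abs_extensor TYPE('u) N" and Y: "homotopy_negligible N Y"
    and card: "topspace W \<lesssim> (UNIV :: 'u set)"
    and W: "metrizable_space W" and C: "closedin W C"
    and f: "continuous_map (subtopology W C) N f"
  obtains g where "continuous_map W N g" "\<And>x. x \<in> C \<Longrightarrow> g x = f x"
    "\<And>x. x \<in> topspace W - C \<Longrightarrow> g x \<in> topspace N - Y"
proof -
  from abs_extensor_extend[OF N card W C f] obtain g0 where g0: "continuous_map W N g0"
    "\<And>x. x \<in> C \<Longrightarrow> g0 x = f x" by metis
  from closed_zero_set[OF W C] obtain \<tau> where t: "continuous_map W unit_interval \<tau>"
    "\<And>x. x \<in> topspace W \<Longrightarrow> \<tau> x = 0 \<longleftrightarrow> x \<in> C" by metis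
  from Y obtain H where H: "continuous_map (prod_topology N unit_interval) N H"
    "\<And>x. x \<in> topspace N \<Longrightarrow> H (x, 0) = x"
    "\<And>x t. x \<in> topspace N \<Longrightarrow> t \<in> {0<..1} \<Longrightarrow> H (x, t) \<in> topspace N - Y"
    unfolding homotopy_negligible_def by metis
  have CW: "C \<subseteq> topspace W" using C by (rule closedin_subset)
  have g0N: "g0 x \<in> topspace N" if "x \<in> topspace W" for x
    using g0(1) that by (auto simp: continuous_map_def)
  show thesis
  proof (rule that[of "\<lambda>x. H (g0 x, \<tau> x)"])
    have "continuous_map W (prod_topology N unit_interval) (\<lambda>x. (g0 x, \<tau> x))"
      using g0(1) t(1) by (simp add: continuous_map_paired)
    from continuous_map_compose[OF this H(1)]
    show "continuous_map W N (\<lambda>x. H (g0 x, \<tau> x))" by (simp add: o_def)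
    show "H (g0 x, \<tau> x) = f x" if "x \<in> C" for x
    proof -
      have "\<tau> x = 0" using t(2) that CW by blast
      then show ?thesis using H(2)[OF g0N[of x]] g0(2)[OF that] that CW by auto
    qed
    show "H (g0 x, \<tau> x) \<in> topspace N - Y" if "x \<in> topspace W - C" for x
    proof (rule H(3))
      show "g0 x \<in> topspace N" using that g0N by simp
      have "\<tau> x \<in> {0..1}" using t(1) that by (auto simp: continuous_map_in_subtopology)
      then show "\<tau> x \<in> {0<..1}" using t(2)[of x] that by force
    qed
  qed
qed

section \<open>Approaching maps\<close>

lemma approaching_map_into:
  "approaching_map M X N Y \<phi> \<Longrightarrow> x \<in> topspace M - X \<Longrightarrow> \<phi> x \<in> topspace N - Y"
  by (auto simp: approaching_map_def continuous_map_def Pi_iff)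

lemma approaching_map_sequence:
  assumes "approaching_map M X N Y \<phi>" "range s \<subseteq> topspace M - X" "limitin M s x sequentially"
  obtains r y where "strict_mono (r :: nat \<Rightarrow> nat)" "limitin N (\<lambda>n. \<phi> (s (r n))) y sequentially"
    "x \<in> X \<Longrightarrow> y \<in> Y" "x \<notin> X \<Longrightarrow> y = \<phi> x"
proof (cases "x \<in> X")
  case True
  with assms obtain r y where "strict_mono (r :: nat \<Rightarrow> nat)" "y \<in> Y"
    "limitin N (\<phi> \<circ> s \<circ> r) y sequentially"
    unfolding approaching_map_def by blast
  with True show thesis by (intro that[of r y]) (auto simp: o_def)
next
  case False
  have "x \<in> topspace M" using assms(3) limitin_topspace by metis
  with False assms have "limitin (subtopology M (topspace M - X)) s x sequentially"
    by (auto simp: limitin_subtopology intro!: always_eventually)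
  moreover have "continuous_map (subtopology M (topspace M - X)) (subtopology N (topspace N - Y)) \<phi>"
    using assms(1) by (simp add: approaching_map_def)
  ultimately have "limitin (subtopology N (topspace N - Y)) (\<lambda>n. \<phi> (s n)) (\<phi> x) sequentially"
    by (rule continuous_map_sequentiallyD[rotated])
  with False show thesis
    by (intro that[of id "\<phi> x"]) (auto simp: strict_mono_id limitin_subtopology)
qed

lemma approaching_mapI:
  assumes M: "metrizable_space M"
    and im: "\<And>x. x \<in> topspace M - X \<Longrightarrow> \<phi> x \<in> topspace N - Y"
    and seq: "\<And>s x. \<lbrakk>range s \<subseteq> topspace M - X; limitin M s x sequentially\<rbrakk> \<Longrightarrow>
      \<exists>r y. strict_mono (r :: nat \<Rightarrow> nat) \<and> limitin N (\<lambda>n. \<phi> (s (r n))) y sequentially \<and>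
        (if x \<in> X then y \<in> Y else y = \<phi> x)"
  shows "approaching_map M X N Y \<phi>"
  unfolding approaching_map_def
proof (intro conjI allI impI)
  show "continuous_map (subtopology M (topspace M - X)) (subtopology N (topspace N - Y)) \<phi>"
  proof (rule continuous_map_sequentiallyI)
    show "metrizable_space (subtopology M (topspace M - X))"
      using M metrizable_space_subtopology by blast
    fix s x assume s: "range s \<subseteq> topspace (subtopology M (topspace M - X))"
      "limitin (subtopology M (topspace M - X)) s x sequentially"
    then obtain r where "strict_mono (r :: nat \<Rightarrow> nat)"
        "limitin N (\<lambda>n. \<phi> (s (r n))) (\<phi> x) sequentially" and x: "x \<in> topspace M - X"
      using seq[of s x] by (auto simp: limitin_subtopology split: if_splits)
    moreover have "\<phi> (s n) \<in> topspace N - Y" for n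
      using s(1) by (intro im) auto
    ultimately show "\<exists>r. strict_mono (r :: nat \<Rightarrow> nat) \<and>
        limitin (subtopology N (topspace N - Y)) (\<phi> \<circ> s \<circ> r) (\<phi> x) sequentially"
      using im[OF x] by (intro exI[of _ r]) (auto simp: o_def limitin_subtopology)
  qed (use im in auto)
next
  fix s x assume "range s \<subseteq> topspace M - X \<and> x \<in> X \<and> limitin M s x sequentially"
  with seq[of s x] show "\<exists>r y. strict_mono (r :: nat \<Rightarrow> nat) \<and> y \<in> Y \<and>
      limitin N (\<phi> \<circ> s \<circ> r) y sequentially"
    by (auto simp: o_def)
qed

lemma approaching_map_cong:
  assumes "approaching_map M X N Y \<phi>" "\<And>x. x \<in> topspace M - X \<Longrightarrow> \<psi> x = \<phi> x"
  shows "approaching_map M X N Y \<psi>"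
  unfolding approaching_map_def
proof (intro conjI allI impI)
  show "continuous_map (subtopology M (topspace M - X)) (subtopology N (topspace N - Y)) \<psi>"
    by (rule continuous_map_eq[where f = \<phi>]) (use assms in \<open>auto simp: approaching_map_def\<close>)
next
  fix s x assume *: "range s \<subseteq> topspace M - X \<and> x \<in> X \<and> limitin M s x sequentially"
  then have "\<psi> (s n) = \<phi> (s n)" for n by (intro assms(2)) auto
  then have "\<psi> \<circ> s = \<phi> \<circ> s" by auto
  with * assms(1) show "\<exists>r y. strict_mono (r :: nat \<Rightarrow> nat) \<and> y \<in> Y \<and>
      limitin N (\<psi> \<circ> s \<circ> r) y sequentially"
    unfolding approaching_map_def by metis
qed

lemma approaching_map_sets_cong:
  assumes "approaching_map M X N Y \<phi>"
    "X \<inter> topspace M = X' \<inter> topspace M" "Y \<inter> topspace N = Y' \<inter> topspace N"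
  shows "approaching_map M X' N Y' \<phi>"
proof -
  have "topspace M - X = topspace M - X'" "topspace N - Y = topspace N - Y'" using assms by auto
  moreover have "x \<in> X \<longleftrightarrow> x \<in> X'" if "limitin M s x sequentially" for s x
    using assms(2) limitin_topspace[OF that] by auto
  moreover have "y \<in> Y \<longleftrightarrow> y \<in> Y'" if "limitin N s y sequentially" for s y
    using assms(3) limitin_topspace[OF that] by auto
  ultimately show ?thesis using assms(1) unfolding approaching_map_def by metis
qed

lemma approaching_map_continuous:
  assumes "continuous_map M N f" "\<And>x. x \<in> topspace M - X \<Longrightarrow> f x \<notin> Y"
    "\<And>x. x \<in> topspace M \<inter> X \<Longrightarrow> f x \<in> Y"
  shows "approaching_map M X N Y f"
  unfolding approaching_map_def
proof (intro conjI allI impI)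
  show "continuous_map (subtopology M (topspace M - X)) (subtopology N (topspace N - Y)) f"
    using assms(2) continuous_map_image_subset_topspace[OF assms(1)]
    by (auto simp: continuous_map_in_subtopology intro!: continuous_map_from_subtopology assms(1))
next
  fix s x assume *: "range s \<subseteq> topspace M - X \<and> x \<in> X \<and> limitin M s x sequentially"
  with assms(3)[of x] have "f x \<in> Y" using limitin_topspace by fastforce
  with * assms(1) show "\<exists>r y. strict_mono (r :: nat \<Rightarrow> nat) \<and> y \<in> Y \<and>
      limitin N (f \<circ> s \<circ> r) y sequentially"
    by (intro exI[of _ id] exI[of _ "f x"])
      (auto simp: o_def strict_mono_id intro: continuous_map_sequentiallyD)
qed

lemma approaching_map_compose:
  assumes p: "approaching_map M X N Y \<phi>" and q: "approaching_map N Y P Z \<psi>"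
  shows "approaching_map M X P Z (\<psi> \<circ> \<phi>)"
  unfolding approaching_map_def
proof (intro conjI allI impI)
  show "continuous_map (subtopology M (topspace M - X)) (subtopology P (topspace P - Z)) (\<psi> \<circ> \<phi>)"
    using assms continuous_map_compose unfolding approaching_map_def by blast
  fix s x assume *: "range s \<subseteq> topspace M - X \<and> x \<in> X \<and> limitin M s x sequentially"
  with p obtain r y where r: "strict_mono (r :: nat \<Rightarrow> nat)" "y \<in> Y"
    "limitin N (\<phi> \<circ> s \<circ> r) y sequentially"
    unfolding approaching_map_def by blast
  moreover have "range (\<phi> \<circ> s \<circ> r) \<subseteq> topspace N - Y"
    using * approaching_map_into[OF p] by auto
  ultimately obtain r' z where "strict_mono (r' :: nat \<Rightarrow> nat)" "z \<in> Z"
    "limitin P (\<psi> \<circ> (\<phi> \<circ> s \<circ> r) \<circ> r') z sequentially"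
    using q unfolding approaching_map_def by blast
  with r show "\<exists>r z. strict_mono (r :: nat \<Rightarrow> nat) \<and> z \<in> Z \<and>
      limitin P (\<psi> \<circ> \<phi> \<circ> s \<circ> r) z sequentially"
    by (intro exI[of _ "r \<circ> r'"] exI[of _ z]) (auto simp: o_assoc strict_mono_o)
qed

lemma approaching_map_subspace:
  assumes "approaching_map M X N Y \<phi>"
  shows "approaching_map (subtopology M C) X N Y \<phi>"
proof -
  have "approaching_map (subtopology M C) X M X id"
    by (rule approaching_map_continuous) (auto simp: continuous_map_from_subtopology)
  from approaching_map_compose[OF this assms] show ?thesis by simp
qed

lemma approaching_map_into_subspace:
  assumes p: "approaching_map M X N Y \<phi>" and L: "closedin N L"
    and im: "\<And>x. x \<in> topspace M - X \<Longrightarrow> \<phi> x \<in> L"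
  shows "approaching_map M X (subtopology N L) Y \<phi>"
  unfolding approaching_map_def
proof (intro conjI allI impI)
  have "continuous_map (subtopology M (topspace M - X)) N \<phi>"
    "\<And>x. x \<in> topspace M - X \<Longrightarrow> \<phi> x \<in> topspace N - Y"
    using p approaching_map_into[OF p] by (auto simp: approaching_map_def continuous_map_in_subtopology)
  then show "continuous_map (subtopology M (topspace M - X))
      (subtopology (subtopology N L) (topspace (subtopology N L) - Y)) \<phi>"
    using im by (auto simp: continuous_map_in_subtopology)
  fix s x assume *: "range s \<subseteq> topspace M - X \<and> x \<in> X \<and> limitin M s x sequentially"
  with p obtain r y where r: "strict_mono (r :: nat \<Rightarrow> nat)" "y \<in> Y"
    "limitin N (\<phi> \<circ> s \<circ> r) y sequentially"
    unfolding approaching_map_def by blast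
  moreover have sL: "\<phi> (s n) \<in> L" for n using * by (intro im) auto
  moreover have "y \<in> L"
    by (rule limitin_closedin[OF r(3) L]) (use sL in auto)
  ultimately show "\<exists>r y. strict_mono (r :: nat \<Rightarrow> nat) \<and> y \<in> Y \<and>
      limitin (subtopology N L) (\<phi> \<circ> s \<circ> r) y sequentially"
    by (intro exI[of _ r] exI[of _ y]) (auto simp: limitin_subtopology)
qed

text \<open>
  Compactness of the interval makes the second coordinate harmless, although \<open>\<tau>\<close> need not
  extend continuously over \<open>X\<close>.
\<close>

lemma approaching_map_Pair:
  assumes M: "metrizable_space M" and p: "approaching_map M X N Y \<phi>"
    and t: "continuous_map (subtopology M (topspace M - X)) unit_interval \<tau>"
  shows "approaching_map M X (prod_topology N unit_interval) (Y \<times> {0..1}) (\<lambda>x. (\<phi> x, \<tau> x))"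
proof (rule approaching_mapI[OF M])
  have tI: "\<tau> x \<in> {0..1}" if "x \<in> topspace M - X" for x
    using t that by (auto simp: continuous_map_in_subtopology)
  show "(\<phi> x, \<tau> x) \<in> topspace (prod_topology N unit_interval) - Y \<times> {0..1}"
    if "x \<in> topspace M - X" for x
    using approaching_map_into[OF p that] tI[OF that] by auto
  fix s x assume s: "range s \<subseteq> topspace M - X" and l: "limitin M s x sequentially"
  have sm: "s n \<in> topspace M - X" for n using s by auto
  from approaching_map_sequence[OF p s l] obtain r y where r: "strict_mono (r :: nat \<Rightarrow> nat)"
    and y: "limitin N (\<lambda>n. \<phi> (s (r n))) y sequentially" "x \<in> X \<Longrightarrow> y \<in> Y" "x \<notin> X \<Longrightarrow> y = \<phi> x"
    by metis
  have "range (\<lambda>n. \<tau> (s (r n))) \<subseteq> {0..1}" using tI sm by blast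
  from unit_interval_subsequence[OF this] obtain q c where q: "strict_mono (q :: nat \<Rightarrow> nat)"
    and c: "c \<in> {0..1}" "((\<lambda>n. \<tau> (s (r n))) \<circ> q) \<longlonglongrightarrow> c" .
  have rq: "strict_mono (r \<circ> q)" using r q strict_mono_o by blast
  have yq: "limitin N (\<lambda>n. \<phi> (s (r (q n)))) y sequentially"
    using limitin_subsequence[OF q y(1)] by (simp add: o_def)
  have cq: "limitin unit_interval (\<lambda>n. \<tau> (s (r (q n)))) c sequentially"
    using c tI sm by (auto simp: limitin_unit_interval o_def intro!: always_eventually)
  show "\<exists>r z. strict_mono (r :: nat \<Rightarrow> nat) \<and>
      limitin (prod_topology N unit_interval) (\<lambda>n. (\<phi> (s (r n)), \<tau> (s (r n)))) z sequentially \<and>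
      (if x \<in> X then z \<in> Y \<times> {0..1} else z = (\<phi> x, \<tau> x))"
  proof (intro exI[of _ "r \<circ> q"] exI[of _ "(y, c)"] conjI rq)
    show "limitin (prod_topology N unit_interval)
        (\<lambda>n. (\<phi> (s ((r \<circ> q) n)), \<tau> (s ((r \<circ> q) n)))) (y, c) sequentially"
      using yq cq by (simp add: limitin_Pair)
    have "c = \<tau> x" if "x \<notin> X"
    proof -
      have "x \<in> topspace M" using l limitin_topspace by metis
      have "limitin M (\<lambda>n. s (r (q n))) x sequentially"
        using limitin_subsequence[OF rq l] by (simp add: o_def)
      with that \<open>x \<in> topspace M\<close> s have "limitin (subtopology M (topspace M - X))
          (\<lambda>n. s (r (q n))) x sequentially"
        by (auto simp: limitin_subtopology intro!: always_eventually)
      from continuous_map_sequentiallyD[OF t this] cq show ?thesis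
        using limitin_unique_metrizable[OF metrizable_unit_interval] by blast
    qed
    with y c show "if x \<in> X then (y, c) \<in> Y \<times> {0..1} else (y, c) = (\<phi> x, \<tau> x)" by auto
  qed
qed

lemma approaching_map_glue:
  assumes M: "metrizable_space M" and C: "closedin M C" and D: "closedin M D"
    and CD: "topspace M - X \<subseteq> C \<union> D"
    and p: "approaching_map (subtopology M C) X N Y \<phi>"
    and q: "approaching_map (subtopology M D) X N Y \<phi>"
  shows "approaching_map M X N Y \<phi>"
proof (rule approaching_mapI[OF M])
  show "\<phi> x \<in> topspace N - Y" if "x \<in> topspace M - X" for x
    using approaching_map_into[OF p] approaching_map_into[OF q] CD that by auto
  fix s x assume s: "range s \<subseteq> topspace M - X" and l: "limitin M s x sequentially"
  have *: "\<exists>r z. strict_mono (r :: nat \<Rightarrow> nat) \<and>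
      limitin N (\<lambda>n. \<phi> (s (r n))) z sequentially \<and> (if x \<in> X then z \<in> Y else z = \<phi> x)"
    if E: "closedin M E" and e: "approaching_map (subtopology M E) X N Y \<phi>"
      and r: "strict_mono (r :: nat \<Rightarrow> nat)" "\<And>n. s (r n) \<in> E" for E r
  proof -
    have lr: "limitin M (s \<circ> r) x sequentially" by (rule limitin_subsequence[OF r(1) l])
    have "x \<in> E" by (rule limitin_closedin[OF lr E]) (use r in auto)
    with lr r(2) have "limitin (subtopology M E) (s \<circ> r) x sequentially"
      by (auto simp: limitin_subtopology intro!: always_eventually)
    moreover have "range (s \<circ> r) \<subseteq> topspace (subtopology M E) - X"
      using s r(2) by auto
    ultimately obtain r' y where r': "strict_mono (r' :: nat \<Rightarrow> nat)"
      "limitin N (\<lambda>n. \<phi> ((s \<circ> r) (r' n))) y sequentially" "x \<in> X \<Longrightarrow> y \<in> Y" "x \<notin> X \<Longrightarrow> y = \<phi> x"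
      using approaching_map_sequence[OF e] by metis
    then show ?thesis
      using r(1) by (intro exI[of _ "r \<circ> r'"] exI[of _ y]) (auto simp: strict_mono_o)
  qed
  show "\<exists>r z. strict_mono (r :: nat \<Rightarrow> nat) \<and>
      limitin N (\<lambda>n. \<phi> (s (r n))) z sequentially \<and> (if x \<in> X then z \<in> Y else z = \<phi> x)"
  proof (rule subsequence_cases[of "\<lambda>n. s n \<in> C"])
    fix r :: "nat \<Rightarrow> nat" assume "strict_mono r" "\<And>n. s (r n) \<in> C"
    from *[OF C p this] show ?thesis .
  next
    fix r :: "nat \<Rightarrow> nat" assume r: "strict_mono r" "\<And>n. s (r n) \<notin> C"
    then have "s (r n) \<in> D" for n using s CD by blast
    from *[OF D q r(1) this] show ?thesis .
  qed
qed

section \<open>Approaching homotopies\<close>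

lemma approaching_homotopicI:
  assumes "approaching_map (prod_topology M unit_interval) (X \<times> {0..1}) N Y \<Phi>"
    "\<And>x. x \<in> topspace M - X \<Longrightarrow> \<Phi> (x, 0) = \<phi> x" "\<And>x. x \<in> topspace M - X \<Longrightarrow> \<Phi> (x, 1) = \<psi> x"
  shows "approaching_homotopic M X N Y \<phi> \<psi>"
  using assms unfolding approaching_homotopic_def by blast

lemma approaching_homotopicE:
  assumes "approaching_homotopic M X N Y \<phi> \<psi>"
  obtains \<Phi> where "approaching_map (prod_topology M unit_interval) (X \<times> {0..1}) N Y \<Phi>"
    "\<And>x. x \<in> topspace M - X \<Longrightarrow> \<Phi> (x, 0) = \<phi> x" "\<And>x. x \<in> topspace M - X \<Longrightarrow> \<Phi> (x, 1) = \<psi> x"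
  using assms unfolding approaching_homotopic_def by blast

lemma approaching_map_fst:
  assumes "approaching_map M X N Y \<phi>"
  shows "approaching_map (prod_topology M unit_interval) (X \<times> {0..1}) N Y (\<lambda>z. \<phi> (fst z))"
proof -
  have "approaching_map (prod_topology M unit_interval) (X \<times> {0..1}) M X fst"
    by (rule approaching_map_continuous) (auto simp: continuous_map_fst)
  from approaching_map_compose[OF this assms] show ?thesis by (simp add: o_def)
qed

lemma approaching_map_slice:
  assumes "approaching_map (prod_topology M unit_interval) (X \<times> {0..1}) N Y \<Phi>" "t \<in> {0..1}"
  shows "approaching_map M X N Y (\<lambda>x. \<Phi> (x, t))"
proof -
  have "approaching_map M X (prod_topology M unit_interval) (X \<times> {0..1}) (\<lambda>x. (x, t))"
    by (rule approaching_map_continuous) (use assms(2) in \<open>auto simp: continuous_map_paired\<close>)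
  from approaching_map_compose[OF this assms(1)] show ?thesis by (simp add: o_def)
qed

lemma approaching_homotopic_imp_map:
  assumes "approaching_homotopic M X N Y \<phi> \<psi>"
  shows "approaching_map M X N Y \<phi>" "approaching_map M X N Y \<psi>"
proof -
  from assms obtain \<Phi> where F: "approaching_map (prod_topology M unit_interval) (X \<times> {0..1}) N Y \<Phi>"
    "\<And>x. x \<in> topspace M - X \<Longrightarrow> \<Phi> (x, 0) = \<phi> x" "\<And>x. x \<in> topspace M - X \<Longrightarrow> \<Phi> (x, 1) = \<psi> x"
    by (rule approaching_homotopicE) blast
  show "approaching_map M X N Y \<phi>"
    by (rule approaching_map_cong[OF approaching_map_slice[OF F(1), of 0]]) (use F(2) in auto)
  show "approaching_map M X N Y \<psi>"
    by (rule approaching_map_cong[OF approaching_map_slice[OF F(1), of 1]]) (use F(3) in auto)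
qed

lemma approaching_homotopic_refl:
  assumes "approaching_map M X N Y \<phi>" "\<And>x. x \<in> topspace M - X \<Longrightarrow> \<psi> x = \<phi> x"
  shows "approaching_homotopic M X N Y \<phi> \<psi>"
  by (rule approaching_homotopicI[OF approaching_map_fst[OF assms(1)]]) (use assms(2) in auto)

lemma approaching_homotopic_comp_left:
  assumes "approaching_homotopic M X N Y \<phi> \<psi>" "approaching_map N Y P Z \<theta>"
  shows "approaching_homotopic M X P Z (\<theta> \<circ> \<phi>) (\<theta> \<circ> \<psi>)"
proof -
  from assms(1) obtain \<Phi> where F: "approaching_map (prod_topology M unit_interval) (X \<times> {0..1}) N Y \<Phi>"
    "\<And>x. x \<in> topspace M - X \<Longrightarrow> \<Phi> (x, 0) = \<phi> x" "\<And>x. x \<in> topspace M - X \<Longrightarrow> \<Phi> (x, 1) = \<psi> x"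
    by (rule approaching_homotopicE) blast
  show ?thesis
    by (rule approaching_homotopicI[OF approaching_map_compose[OF F(1) assms(2)]]) (use F(2,3) in auto)
qed

lemma continuous_map_snd_unit:
  "continuous_map (subtopology (prod_topology M unit_interval) S) unit_interval snd"
  by (simp add: continuous_map_from_subtopology continuous_map_snd)

lemma approaching_homotopic_comp_right:
  assumes M: "metrizable_space M" and h: "approaching_homotopic N Y P Z \<phi> \<psi>"
    and c: "approaching_map M X N Y \<theta>"
  shows "approaching_homotopic M X P Z (\<phi> \<circ> \<theta>) (\<psi> \<circ> \<theta>)"
proof -
  from h obtain \<Phi> where F: "approaching_map (prod_topology N unit_interval) (Y \<times> {0..1}) P Z \<Phi>"
    "\<And>x. x \<in> topspace N - Y \<Longrightarrow> \<Phi> (x, 0) = \<phi> x" "\<And>x. x \<in> topspace N - Y \<Longrightarrow> \<Phi> (x, 1) = \<psi> x"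
    by (rule approaching_homotopicE) blast
  have "approaching_map (prod_topology M unit_interval) (X \<times> {0..1})
      (prod_topology N unit_interval) (Y \<times> {0..1}) (\<lambda>z. (\<theta> (fst z), snd z))"
    by (intro approaching_map_Pair metrizable_prod_unit_interval M approaching_map_fst c
      continuous_map_snd_unit)
  from approaching_homotopicI[OF approaching_map_compose[OF this F(1)]] show ?thesis
    using F(2,3) approaching_map_into[OF c] by auto
qed

lemma approaching_homotopic_cong:
  assumes "approaching_homotopic M X N Y \<phi> \<psi>" "\<And>x. x \<in> topspace M - X \<Longrightarrow> \<phi>' x = \<phi> x"
    "\<And>x. x \<in> topspace M - X \<Longrightarrow> \<psi>' x = \<psi> x"
  shows "approaching_homotopic M X N Y \<phi>' \<psi>'"
  using assms unfolding approaching_homotopic_def by metis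

lemma approaching_map_reparametrize:
  assumes M: "metrizable_space M"
    and F: "approaching_map (prod_topology M unit_interval) (X \<times> {0..1}) N Y \<Phi>"
    and s: "continuous_map unit_interval unit_interval \<sigma>"
  shows "approaching_map (prod_topology M unit_interval) (X \<times> {0..1}) N Y (\<lambda>z. \<Phi> (fst z, \<sigma> (snd z)))"
proof -
  have "approaching_map (prod_topology M unit_interval) (X \<times> {0..1}) M X fst"
    by (rule approaching_map_continuous) (auto simp: continuous_map_fst)
  moreover have "continuous_map (subtopology (prod_topology M unit_interval) S) unit_interval
      (\<lambda>z. \<sigma> (snd z))" for S
    using continuous_map_compose[OF continuous_map_snd_unit s] by (simp add: o_def)
  ultimately have "approaching_map (prod_topology M unit_interval) (X \<times> {0..1})
      (prod_topology M unit_interval) (X \<times> {0..1}) (\<lambda>z. (fst z, \<sigma> (snd z)))"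
    by (intro approaching_map_Pair metrizable_prod_unit_interval M)
  from approaching_map_compose[OF this F] show ?thesis by (simp add: o_def)
qed

lemma continuous_unit_interval:
  assumes "continuous_on {0..1} \<sigma>" "\<And>t. t \<in> {0..1} \<Longrightarrow> \<sigma> t \<in> {0..1}"
  shows "continuous_map unit_interval unit_interval \<sigma>"
  using assms by (auto simp: continuous_map_in_subtopology)

lemma approaching_homotopic_sym:
  assumes M: "metrizable_space M" and h: "approaching_homotopic M X N Y \<phi> \<psi>"
  shows "approaching_homotopic M X N Y \<psi> \<phi>"
proof -
  from h obtain \<Phi> where F: "approaching_map (prod_topology M unit_interval) (X \<times> {0..1}) N Y \<Phi>"
    "\<And>x. x \<in> topspace M - X \<Longrightarrow> \<Phi> (x, 0) = \<phi> x" "\<And>x. x \<in> topspace M - X \<Longrightarrow> \<Phi> (x, 1) = \<psi> x"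
    by (rule approaching_homotopicE) blast
  have "continuous_map unit_interval unit_interval (\<lambda>t. 1 - t)"
    by (intro continuous_unit_interval continuous_intros) auto
  from approaching_homotopicI[OF approaching_map_reparametrize[OF M F(1) this]] F(2,3)
  show ?thesis by auto
qed

lemma closedin_time_le:
  "closedin (prod_topology M unit_interval) {z \<in> topspace (prod_topology M unit_interval). snd z \<le> c}"
  "closedin (prod_topology M unit_interval) {z \<in> topspace (prod_topology M unit_interval). c \<le> snd z}"
proof -
  have "continuous_map (prod_topology M unit_interval) euclideanreal snd"
    using continuous_map_snd continuous_map_into_fulltopology by blast
  then show "closedin (prod_topology M unit_interval) {z \<in> topspace (prod_topology M unit_interval). snd z \<le> c}"
    "closedin (prod_topology M unit_interval) {z \<in> topspace (prod_topology M unit_interval). c \<le> snd z}"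
    by (intro closedin_continuous_le; simp)+
qed

lemma approaching_map_concatenate:
  assumes M: "metrizable_space M"
    and F: "approaching_map (prod_topology M unit_interval) (X \<times> {0..1}) N Y F"
    and G: "approaching_map (prod_topology M unit_interval) (X \<times> {0..1}) N Y G"
    and eq: "\<And>x. x \<in> topspace M - X \<Longrightarrow> F (x, 1) = G (x, 0)"
  shows "approaching_map (prod_topology M unit_interval) (X \<times> {0..1}) N Y
    (\<lambda>z. if snd z \<le> 1/2 then F (fst z, 2 * snd z) else G (fst z, 2 * snd z - 1))" (is "approaching_map ?M ?X _ _ ?H")
proof (rule approaching_map_glue[OF metrizable_prod_unit_interval[OF M]])
  let ?C = "{z \<in> topspace ?M. snd z \<le> 1/2}" and ?D = "{z \<in> topspace ?M. 1/2 \<le> snd z}"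
  show "closedin ?M ?C" "closedin ?M ?D" by (rule closedin_time_le)+
  show "topspace ?M - ?X \<subseteq> ?C \<union> ?D" by auto
  have "continuous_map unit_interval unit_interval (\<lambda>t. min 1 (2 * t))"
    "continuous_map unit_interval unit_interval (\<lambda>t. max 0 (2 * t - 1))"
    by (intro continuous_unit_interval continuous_intros; auto)+
  from approaching_map_reparametrize[OF M F this(1)] approaching_map_reparametrize[OF M G this(2)]
  have FG: "approaching_map ?M ?X N Y (\<lambda>z. F (fst z, min 1 (2 * snd z)))"
     "approaching_map ?M ?X N Y (\<lambda>z. G (fst z, max 0 (2 * snd z - 1)))" .
  show "approaching_map (subtopology ?M ?C) ?X N Y ?H"
    by (rule approaching_map_cong[OF approaching_map_subspace[OF FG(1)]]) auto
  show "approaching_map (subtopology ?M ?D) ?X N Y ?H"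
  proof (rule approaching_map_cong[OF approaching_map_subspace[OF FG(2)]])
    fix z assume z: "z \<in> topspace (subtopology ?M ?D) - ?X"
    show "?H z = G (fst z, max 0 (2 * snd z - 1))"
    proof (cases "snd z = 1/2")
      case True
      then have "2 * snd z = 1" by simp
      with z eq[of "fst z"] show ?thesis by (auto simp: mem_Times_iff)
    qed (use z in auto)
  qed
qed

lemma approaching_homotopic_trans:
  assumes M: "metrizable_space M" and h: "approaching_homotopic M X N Y \<phi> \<psi>"
    and k: "approaching_homotopic M X N Y \<psi> \<theta>"
  shows "approaching_homotopic M X N Y \<phi> \<theta>"
proof -
  from h obtain F where F: "approaching_map (prod_topology M unit_interval) (X \<times> {0..1}) N Y F"
    "\<And>x. x \<in> topspace M - X \<Longrightarrow> F (x, 0) = \<phi> x" "\<And>x. x \<in> topspace M - X \<Longrightarrow> F (x, 1) = \<psi> x"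
    by (rule approaching_homotopicE) blast
  from k obtain G where G: "approaching_map (prod_topology M unit_interval) (X \<times> {0..1}) N Y G"
    "\<And>x. x \<in> topspace M - X \<Longrightarrow> G (x, 0) = \<psi> x" "\<And>x. x \<in> topspace M - X \<Longrightarrow> G (x, 1) = \<theta> x"
    by (rule approaching_homotopicE) blast
  from approaching_map_concatenate[OF M F(1) G(1)] F(2,3) G(2,3) show ?thesis
    by (intro approaching_homotopicI) auto
qed

section \<open>Dugundji's extension theorem\<close>

text \<open>Stone's theorem, by M. E. Rudin's construction.\<close>

lemma (in Metric_space) Stone_refinement:
  fixes U :: "'i \<Rightarrow> 'a set"
  assumes U: "\<And>i. openin mtopology (U i)" and cover: "M \<subseteq> (\<Union>i. U i)"
  obtains V :: "'i \<Rightarrow> 'a set" where "\<And>i. openin mtopology (V i)" "\<And>i. V i \<subseteq> U i"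
    "M \<subseteq> (\<Union>i. V i)" "\<And>x. x \<in> M \<Longrightarrow> \<exists>e>0. finite {i. V i \<inter> mball x e \<noteq> {}}"
proof -
  obtain R :: "'i rel" where R: "Well_order R" "Field R = UNIV"
    using well_ordering by metis
  define less where "less i j \<longleftrightarrow> (i, j) \<in> R - Id" for i j
  have wf: "wf (R - Id)" using R by (simp add: well_order_on_def)
  have total: "less i j \<or> less j i" if "i \<noteq> j" for i j
    using R that by (auto simp: less_def well_order_on_def linear_order_on_def total_on_def)
  define rho :: "nat \<Rightarrow> real" where "rho n = (1/2) ^ n" for n
  have rho_pos: "rho n > 0" for n by (simp add: rho_def)
  have rho_mono: "rho n \<le> rho m" if "m \<le> n" for m n
    using that by (simp add: rho_def power_decreasing)
  have rho_Suc: "rho n = 2 * rho (Suc n)" for n by (simp add: rho_def)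
  define center where "center S n i = {x \<in> M. x \<in> U i \<and> (\<forall>j. less j i \<longrightarrow> x \<notin> U j) \<and>
      mball x (3 * rho n) \<subseteq> U i \<and> x \<notin> S}" for S n i
  define step where "step S n i = (\<Union>x\<in>center S n i. mball x (rho n))" for S n i
  define C where "C = rec_nat {} (\<lambda>n S. S \<union> (\<Union>i. step S n i))"
  define D where "D n i = step (C n) n i" for n i
  have C_Suc: "C (Suc n) = C n \<union> (\<Union>i. D n i)" for n by (simp add: C_def D_def)
  have C_eq: "C n = (\<Union>k<n. \<Union>i. D k i)" for n
  proof (induction n)
    case 0 then show ?case by (simp add: C_def)
  next
    case (Suc n) then show ?case by (simp add: C_Suc lessThan_Suc Un_commute)
  qed
  have D_open: "openin mtopology (D n i)" for n i
    unfolding D_def step_def by (intro openin_Union) auto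
  have D_sub: "D n i \<subseteq> U i" for n i
  proof
    fix p assume "p \<in> D n i"
    then obtain x where "x \<in> center (C n) n i" "p \<in> mball x (rho n)"
      by (auto simp: D_def step_def simp del: in_mball)
    moreover have "mball x (rho n) \<subseteq> mball x (3 * rho n)"
      using rho_pos[of n] by (intro mball_subset_concentric) simp
    ultimately show "p \<in> U i" by (auto simp: center_def)
  qed
  have D_cover: "\<exists>n i. x \<in> D n i" if x: "x \<in> M" for x
  proof -
    from cover x have "{i. x \<in> U i} \<noteq> {}" by auto
    then obtain i where i: "x \<in> U i" "\<And>j. less j i \<Longrightarrow> x \<notin> U j"
      using wf unfolding wf_eq_minimal less_def by (metis empty_Collect_eq mem_Collect_eq)
    from U[of i] i(1) obtain e where e: "e > 0" "mball x e \<subseteq> U i"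
      by (auto simp: openin_mtopology)
    obtain n where "(1/2::real) ^ n < e / 3" using real_arch_pow_inv[of "e/3" "1/2"] e by auto
    then have "mball x (3 * rho n) \<subseteq> U i"
      using mball_subset_concentric[of "3 * rho n" e x] e(2) by (auto simp: rho_def)
    with i x have "x \<in> center (C n) n i \<or> x \<in> C n" by (auto simp: center_def)
    then show ?thesis
    proof
      assume "x \<in> center (C n) n i"
      then have "x \<in> D n i" using x rho_pos by (auto simp: D_def step_def simp del: in_mball)
      then show ?thesis by blast
    qed (auto simp: C_eq)
  qed
  have locfin: "\<exists>e>0. finite {l. (\<Union>k. D k l) \<inter> mball x e \<noteq> {}}" if x: "x \<in> M" for x
  proof -
    from D_cover[OF x] obtain n i where ni: "x \<in> D n i" by blast
    with D_open[of n i] obtain e where e: "e > 0" "mball x e \<subseteq> D n i"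
      by (auto simp: openin_mtopology)
    obtain j where "(1/2::real) ^ j < e" using real_arch_pow_inv[of e "1/2"] e by auto
    then have j: "mball x (rho j) \<subseteq> D n i"
      using mball_subset_concentric[of "rho j" e x] e(2) by (auto simp: rho_def)
    define m where "m = Suc (n + j)"
    have late: "D k l \<inter> mball x (rho m) = {}" if "k \<ge> m" for k l
    proof (rule ccontr)
      assume "D k l \<inter> mball x (rho m) \<noteq> {}"
      then obtain y p where y: "y \<in> center (C k) k l" and p: "p \<in> mball y (rho k)" "p \<in> mball x (rho m)"
        by (auto simp: D_def step_def simp del: in_mball)
      have "n < k" using that by (simp add: m_def)
      with y have "y \<notin> D n i" by (auto simp: center_def C_eq)
      with j have "y \<notin> mball x (rho j)" by blast
      moreover have yM: "y \<in> M" using y by (simp add: center_def)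
      ultimately have "rho j \<le> d x y" using x by auto
      also have "\<dots> \<le> d x p + d p y" using p yM x by (intro triangle) auto
      also have "\<dots> < rho m + rho k" using p by (auto simp: commute)
      also have "\<dots> \<le> rho (Suc j) + rho (Suc j)"
        using that by (intro add_mono rho_mono) (auto simp: m_def)
      finally show False using rho_Suc[of j] by simp
    qed
    have single: "l = l'" if k: "k < m" and l: "D k l \<inter> mball x (rho m) \<noteq> {}"
        "D k l' \<inter> mball x (rho m) \<noteq> {}" for k l l'
    proof (rule ccontr)
      have *: False if ll: "less l l'" and l: "D k l \<inter> mball x (rho m) \<noteq> {}"
        "D k l' \<inter> mball x (rho m) \<noteq> {}" for l l'
      proof -
        from l obtain y p where y: "y \<in> center (C k) k l" and p: "p \<in> mball y (rho k)" "p \<in> mball x (rho m)"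
          by (auto simp: D_def step_def simp del: in_mball)
        from l obtain z q where z: "z \<in> center (C k) k l'" and q: "q \<in> mball z (rho k)" "q \<in> mball x (rho m)"
          by (auto simp: D_def step_def simp del: in_mball)
        have "z \<notin> mball y (3 * rho k)" using y z ll by (auto simp: center_def)
        moreover have yz: "y \<in> M" "z \<in> M" using y z by (auto simp: center_def)
        ultimately have "3 * rho k \<le> d y z" by auto
        also have "\<dots> \<le> d y p + d p q + d q z"
        proof -
          have "d y z \<le> d y q + d q z" using yz q by (intro triangle) auto
          moreover have "d y q \<le> d y p + d p q" using yz p q by (intro triangle) auto
          ultimately show ?thesis by simp
        qed
        also have "d p q \<le> d p x + d x q" using p q x by (intro triangle) auto
        finally have "3 * rho k \<le> d y p + d p x + d x q + d q z" by simp
        also have "\<dots> < rho k + rho m + rho m + rho k"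
          using p q by (intro add_strict_mono) (auto simp: commute)
        finally have "rho k < 2 * rho m" by simp
        moreover have "2 * rho m \<le> rho k"
          using rho_Suc[of "n + j"] k rho_mono[of k "n + j"] by (simp add: m_def)
        ultimately show False by simp
      qed
      assume "l \<noteq> l'"
      with total[of l l'] *[of l l'] *[of l' l] l show False by blast
    qed
    have "finite {l. D k l \<inter> mball x (rho m) \<noteq> {}}" if "k < m" for k
    proof (cases "\<exists>l. D k l \<inter> mball x (rho m) \<noteq> {}")
      case True
      then obtain l where "D k l \<inter> mball x (rho m) \<noteq> {}" by blast
      with single[OF that] have "{l. D k l \<inter> mball x (rho m) \<noteq> {}} \<subseteq> {l}" by blast
      then show ?thesis using finite_subset by blast
    qed simp
    then have "finite (\<Union>k<m. {l. D k l \<inter> mball x (rho m) \<noteq> {}})" by blast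
    moreover have "{l. (\<Union>k. D k l) \<inter> mball x (rho m) \<noteq> {}} \<subseteq> (\<Union>k<m. {l. D k l \<inter> mball x (rho m) \<noteq> {}})"
      using late by (force simp: not_less[symmetric])
    ultimately have "finite {l. (\<Union>k. D k l) \<inter> mball x (rho m) \<noteq> {}}"
      by (rule finite_subset[rotated])
    with rho_pos[of m] show ?thesis by (intro exI[of _ "rho m"] conjI)
  qed
  show thesis
  proof (rule that[of "\<lambda>i. \<Union>n. D n i"])
    show "openin mtopology (\<Union>n. D n i)" for i using D_open by blast
    show "(\<Union>n. D n i) \<subseteq> U i" for i using D_sub by blast
    show "M \<subseteq> (\<Union>i. \<Union>n. D n i)" using D_cover by fastforce
    show "\<exists>e>0. finite {i. (\<Union>n. D n i) \<inter> mball x e \<noteq> {}}" if "x \<in> M" for x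
      by (rule locfin[OF that])
  qed
qed

lemma Dugundji_extension:
  fixes W :: "'w topology" and C :: "'v::real_normed_vector set"
  assumes W: "metrizable_space W" and B: "closedin W B" and ne: "B \<noteq> {}"
    and f: "continuous_map (subtopology W B) (top_of_set C) f" and C: "convex C"
  obtains g where "continuous_map W (top_of_set C) g" "\<And>x. x \<in> B \<Longrightarrow> g x = f x"
proof -
  from W obtain M d where "Metric_space M d" and X: "W = Metric_space.mtopology M d"
    by (auto simp: metrizable_space_def)
  then interpret Metric_space M d by simp
  have BM: "B \<subseteq> M" using closedin_subset[OF B] by (simp add: X)
  obtain \<delta> :: "'w \<Rightarrow> real"
    where dist: "\<And>x. \<delta> x \<ge> 0" "\<And>x c. c \<in> B \<Longrightarrow> \<delta> x \<le> d x c"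
    "\<And>x y. \<lbrakk>x \<in> M; y \<in> M\<rbrakk> \<Longrightarrow> \<bar>\<delta> x - \<delta> y\<bar> \<le> d x y"
    "\<And>x. x \<in> M \<Longrightarrow> \<delta> x = 0 \<longleftrightarrow> x \<in> B" "\<And>x r. \<delta> x < r \<Longrightarrow> \<exists>c\<in>B. d x c < r"
    by (rule distance_function[OF B[unfolded X] ne]) (rule that)
  interpret S: Metric_space "M - B" d by (rule subspace) auto
  have Stop: "S.mtopology = subtopology mtopology (M - B)"
    by (rule Submetric.mtopology_submetric) (unfold_locales; auto)
  have MB: "openin mtopology (M - B)"
    using B by (simp add: X closedin_def)
  define U where "U b = {w \<in> M - B. b \<in> B \<and> d w b < 2 * \<delta> w}" for b
  have U: "openin S.mtopology (U b)" for b
    unfolding S.openin_mtopology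
  proof (intro conjI allI impI)
    fix w assume w: "w \<in> U b"
    define e where "e = (2 * \<delta> w - d w b) / 3"
    have e: "e > 0" using w by (simp add: U_def e_def)
    have "S.mball w e \<subseteq> U b"
    proof
      fix v assume v: "v \<in> S.mball w e"
      then have vw: "v \<in> M" "w \<in> M" "b \<in> M" "d w v < e" using w BM by (auto simp: U_def)
      have "d v b \<le> d v w + d w b" using vw by (intro triangle) auto
      moreover have "\<bar>\<delta> w - \<delta> v\<bar> \<le> d w v" using vw dist(3) by blast
      ultimately have "d v b < 2 * \<delta> v" using vw commute[of v w] by (simp add: e_def abs_le_iff field_simps)
      with v w show "v \<in> U b" by (auto simp: U_def)
    qed
    with e show "\<exists>r>0. S.mball w r \<subseteq> U b" by blast
  qed (auto simp: U_def)
  have "M - B \<subseteq> (\<Union>b. U b)"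
  proof
    fix w assume w: "w \<in> M - B"
    then have "\<delta> w > 0" using dist(1)[of w] dist(4)[of w] by force
    then obtain c where "c \<in> B" "d w c < 2 * \<delta> w" using dist(5)[of w "2 * \<delta> w"] by auto
    with w show "w \<in> (\<Union>b. U b)" by (auto simp: U_def)
  qed
  from S.Stone_refinement[of U, OF U this] obtain V :: "'w \<Rightarrow> 'w set"
    where V: "\<And>b. openin S.mtopology (V b)" "\<And>b. V b \<subseteq> U b" "M - B \<subseteq> (\<Union>b. V b)"
      "\<And>x. x \<in> M - B \<Longrightarrow> \<exists>e>0. finite {b. V b \<inter> S.mball x e \<noteq> {}}"
    by metis
  have "\<exists>l. continuous_map S.mtopology unit_interval l \<and> (\<forall>x\<in>M - B. l x = 0 \<longleftrightarrow> x \<notin> V b)" for b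
  proof -
    have "closedin S.mtopology ((M - B) - V b)"
      using V(1)[of b] by (metis S.topspace_mtopology openin_closedin_eq)
    from closed_zero_set[OF S.metrizable_space_mtopology this] show ?thesis
      by (metis Diff_iff S.topspace_mtopology)
  qed
  then obtain l where l: "\<And>b. continuous_map S.mtopology unit_interval (l b)"
    "\<And>b x. x \<in> M - B \<Longrightarrow> l b x = 0 \<longleftrightarrow> x \<notin> V b" by metis
  have l0: "l b x \<ge> 0" if "x \<in> M - B" for b x
    using l(1)[of b] that by (auto simp: continuous_map_in_subtopology)
  define J where "J x = {b. x \<in> V b}" for x
  have finJ: "finite (J x)" if x: "x \<in> M - B" for x
  proof -
    from V(4)[OF x] obtain e where "e > 0" "finite {b. V b \<inter> S.mball x e \<noteq> {}}" by blast
    moreover from this have "J x \<subseteq> {b. V b \<inter> S.mball x e \<noteq> {}}" using x by (auto simp: J_def)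
    ultimately show ?thesis using finite_subset by blast
  qed
  have pos: "(\<Sum>b\<in>J x. l b x) > 0" if x: "x \<in> M - B" for x
  proof -
    from V(3) x obtain b where "b \<in> J x" by (auto simp: J_def)
    moreover have "l b x > 0" if "b \<in> J x" for b
      using that l(2)[OF x, of b] l0[OF x, of b] by (auto simp: J_def)
    ultimately show ?thesis using finJ[OF x] by (intro sum_pos) auto
  qed
  have JB: "J x \<subseteq> B" for x using V(2) by (force simp: J_def U_def)
  define F where "F x = (\<Sum>b\<in>J x. (l b x / (\<Sum>c\<in>J x. l c x)) *\<^sub>R f b)" for x
  have F_in: "F x \<in> K" if x: "x \<in> M - B" and K: "convex K" "\<And>b. b \<in> J x \<Longrightarrow> f b \<in> K" for x K
    unfolding F_def
  proof (rule convex_sum[OF finJ[OF x] K(1)])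
    show "(\<Sum>b\<in>J x. l b x / (\<Sum>c\<in>J x. l c x)) = 1"
      using pos[OF x] by (simp add: sum_divide_distrib[symmetric])
    show "l b x / (\<Sum>c\<in>J x. l c x) \<ge> 0" for b using pos[OF x] l0[OF x] by simp
  qed (rule K(2))
  have fC: "f b \<in> C" if "b \<in> B" for b
    using f that BM X by (auto simp: continuous_map_in_subtopology)
  define g where "g x = (if x \<in> B then f x else F x)" for x
  have "F x \<in> C" if "x \<in> M - B" for x
    by (rule F_in[OF that C]) (use fC JB in blast)
  then have gC: "g x \<in> C" if "x \<in> M" for x
    using fC that by (auto simp: g_def)
  have "continuous_map W (top_of_set C) g"
  proof (rule continuous_map_sequentiallyI[OF W])
    fix s x assume s: "range s \<subseteq> topspace W" and lim: "limitin W s x sequentially"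
    have sM: "s n \<in> M" for n using s X by auto
    have xM: "x \<in> M" using lim limitin_topspace X by fastforce
    have "(\<lambda>n. g (s n)) \<longlonglongrightarrow> g x"
    proof (cases "x \<in> B")
      case True
      show ?thesis
      proof (rule LIMSEQ_I)
        fix e :: real assume e: "e > 0"
        have near: "\<exists>r>0. \<forall>b\<in>B. d b x < r \<longrightarrow> norm (f b - f x) < e"
        proof (rule ccontr)
          assume "\<not> ?thesis"
          then have "\<forall>n. \<exists>b\<in>B. d b x < inverse (Suc n) \<and> \<not> norm (f b - f x) < e"
            by (metis inverse_positive_iff_positive of_nat_0_less_iff zero_less_Suc)
          then obtain b where b: "\<And>n. b n \<in> B" "\<And>n. d (b n) x < inverse (Suc n)"
            "\<And>n. \<not> norm (f (b n) - f x) < e" by metis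
          have "limitin mtopology b x sequentially"
            unfolding limit_metric_sequentially
          proof (intro conjI allI impI xM)
            fix r :: real assume "r > 0"
            then obtain N where N: "inverse (Suc N) < r" using reals_Archimedean by blast
            have "b n \<in> M \<and> d (b n) x < r" if "n \<ge> N" for n
            proof -
              have "inverse (Suc n) \<le> inverse (Suc N)" using that by (simp add: field_simps)
              then have "d (b n) x < r" using N b(2)[of n] by linarith
              then show ?thesis using b(1)[of n] BM by auto
            qed
            then show "\<exists>N. \<forall>n\<ge>N. b n \<in> M \<and> d (b n) x < r" by blast
          qed
          then have "limitin (subtopology W B) b x sequentially"
            using b True by (simp add: limitin_subtopology X)
          from continuous_map_sequentiallyD[OF f this] have "(\<lambda>n. f (b n)) \<longlonglongrightarrow> f x"
            by (simp add: limitin_subtopology)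
          from LIMSEQ_D[OF this e] b(3) show False by blast
        qed
        then obtain r where r: "r > 0" "\<And>b. b \<in> B \<Longrightarrow> d b x < r \<Longrightarrow> norm (f b - f x) < e" by blast
        from lim r(1) obtain N where N: "\<And>n. n \<ge> N \<Longrightarrow> d (s n) x < r / 3"
          unfolding X limit_metric_sequentially by (meson zero_less_divide_iff zero_less_numeral)
        have "norm (g (s n) - g x) < e" if n: "n \<ge> N" for n
        proof (cases "s n \<in> B")
          case True
          have "d (s n) x < r" using N[OF n] r(1) by simp
          with True \<open>x \<in> B\<close> show ?thesis using r(2) by (simp add: g_def)
        next
          case False
          then have sn: "s n \<in> M - B" using sM by simp
          have "F (s n) \<in> ball (f x) e"
          proof (rule F_in[OF sn])
            fix b assume b: "b \<in> J (s n)"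
            then have bB: "b \<in> B" using JB by blast
            from b V(2)[of b] have "d (s n) b < 2 * \<delta> (s n)" by (auto simp: J_def U_def)
            moreover have "\<delta> (s n) \<le> d (s n) x" using dist(2) True by blast
            moreover have "d b x \<le> d b (s n) + d (s n) x"
              using bB BM sM xM by (intro triangle) auto
            ultimately have "d b x < r" using N[OF n] by (simp add: commute)
            from r(2)[OF bB this] show "f b \<in> ball (f x) e"
              by (simp add: dist_norm norm_minus_commute)
          qed simp
          with False True show ?thesis by (simp add: g_def dist_norm norm_minus_commute)
        qed
        then show "\<exists>N. \<forall>n\<ge>N. norm (g (s n) - g x) < e" by blast
      qed
    next
      case False
      with xM have x: "x \<in> M - B" by simp
      from V(4)[OF x] obtain e where e: "e > 0" "finite {b. V b \<inter> S.mball x e \<noteq> {}}" by blast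
      define T where "T = {b. V b \<inter> S.mball x e \<noteq> {}}"
      have FT: "F y = (\<Sum>b\<in>T. (l b y / (\<Sum>c\<in>T. l c y)) *\<^sub>R f b)" if y: "y \<in> S.mball x e" for y
      proof -
        have yM: "y \<in> M - B" using y by simp
        have JT: "J y \<subseteq> T" using y by (auto simp: J_def T_def)
        have z: "l b y = 0" if "b \<in> T - J y" for b using that l(2)[OF yM] by (auto simp: J_def)
        have "(\<Sum>c\<in>T. l c y) = (\<Sum>c\<in>J y. l c y)"
          using JT e(2) z by (intro sum.mono_neutral_right) (auto simp: T_def)
        moreover have "(\<Sum>b\<in>T. (l b y / k) *\<^sub>R f b) = (\<Sum>b\<in>J y. (l b y / k) *\<^sub>R f b)" for k
          using JT e(2) z by (intro sum.mono_neutral_right) (auto simp: T_def)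
        ultimately show ?thesis by (simp add: F_def)
      qed
      have limS: "\<forall>\<^sub>F n in sequentially. s n \<in> M - B"
        using limitinD[OF lim[unfolded X] MB x] .
      then have limS': "limitin S.mtopology s x sequentially"
        using lim x by (simp add: Stop limitin_subtopology X)
      have ev: "\<forall>\<^sub>F n in sequentially. s n \<in> S.mball x e"
        using limS' x e(1) by (intro limitinD) auto
      have lb: "(\<lambda>n. l b (s n)) \<longlonglongrightarrow> l b x" for b
        using continuous_map_sequentiallyD[OF l(1) limS'] by (simp add: limitin_subtopology)
      have xe: "x \<in> S.mball x e" using x e by simp
      have "(\<Sum>c\<in>T. l c x) \<noteq> 0"
      proof -
        have "(\<Sum>c\<in>J x. l c x) \<le> (\<Sum>c\<in>T. l c x)"
          using xe x l0 e(2) by (intro sum_mono2) (auto simp: J_def T_def)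
        with pos[OF x] show ?thesis by simp
      qed
      then have "(\<lambda>n. \<Sum>b\<in>T. (l b (s n) / (\<Sum>c\<in>T. l c (s n))) *\<^sub>R f b) \<longlonglongrightarrow>
          (\<Sum>b\<in>T. (l b x / (\<Sum>c\<in>T. l c x)) *\<^sub>R f b)"
        by (intro tendsto_intros lb)
      moreover have "\<forall>\<^sub>F n in sequentially. (\<Sum>b\<in>T. (l b (s n) / (\<Sum>c\<in>T. l c (s n))) *\<^sub>R f b) = g (s n)"
        using ev by eventually_elim (auto simp: FT g_def)
      ultimately show ?thesis
        using FT[OF xe] False by (simp add: g_def Lim_transform_eventually)
    qed
    then show "\<exists>r. strict_mono (r :: nat \<Rightarrow> nat) \<and>
        limitin (top_of_set C) (g \<circ> s \<circ> r) (g x) sequentially"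
      using gC sM xM by (intro exI[of _ id]) (simp add: strict_mono_id limitin_subtopology o_def)
  qed (use gC X in auto)
  then show thesis by (rule that) (simp add: g_def)
qed

lemma abs_extensor_convex:
  fixes C :: "'v::real_normed_vector set"
  assumes C: "convex C" "C \<noteq> {}"
  shows "abs_extensor TYPE('u) (top_of_set C)"
  unfolding abs_extensor_def
proof (intro conjI allI impI)
  show "metrizable_space (top_of_set C)"
    by (simp add: metrizable_space_euclidean metrizable_space_subtopology)
  fix W :: "'u topology" and B f
  assume W: "metrizable_space W \<and> closedin W B \<and> continuous_map (subtopology W B) (top_of_set C) f"
  show "\<exists>g. continuous_map W (top_of_set C) g \<and> (\<forall>x\<in>B. g x = f x)"
  proof (cases "B = {}")
    case True
    from C obtain c where "c \<in> C" by blast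
    with True show ?thesis by (intro exI[of _ "\<lambda>_. c"]) auto
  next
    case False
    from W Dugundji_extension[of W B C f] False C show ?thesis by metis
  qed
qed

section \<open>Existence of hulls\<close>

lemma homotopy_negligible_homeomorphic:
  assumes N: "homotopy_negligible N Y" and h: "homeomorphic_map N N' c"
  shows "homotopy_negligible N' (c ` Y)"
  unfolding homotopy_negligible_def
proof (intro conjI)
  from h obtain c' where cc': "homeomorphic_maps N N' c c'"
    using homeomorphic_map_maps by blast
  have YN: "closedin N Y" using N by (simp add: homotopy_negligible_def)
  with h show "closedin N' (c ` Y)"
    using homeomorphic_map_closedness[OF h closedin_subset[OF YN]] by simp
  from N obtain H where H: "continuous_map (prod_topology N unit_interval) N H"
    "\<And>x. x \<in> topspace N \<Longrightarrow> H (x, 0) = x"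
    "\<And>x t. x \<in> topspace N \<Longrightarrow> t \<in> {0<..1} \<Longrightarrow> H (x, t) \<in> topspace N - Y"
    unfolding homotopy_negligible_def by metis
  have cc: "continuous_map N N' c" "continuous_map N' N c'"
    "\<And>x. x \<in> topspace N \<Longrightarrow> c' (c x) = x" "\<And>x. x \<in> topspace N' \<Longrightarrow> c (c' x) = x"
    using cc' by (auto simp: homeomorphic_maps_def)
  have c'N: "c' x \<in> topspace N" if "x \<in> topspace N'" for x
    using cc(2) that by (auto simp: continuous_map_def)
  have cN: "c x \<in> topspace N'" if "x \<in> topspace N" for x
    using cc(1) that by (auto simp: continuous_map_def)
  show "\<exists>H. continuous_map (prod_topology N' unit_interval) N' H \<and>
      (\<forall>x\<in>topspace N'. H (x, 0) = x) \<and>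
      (\<forall>x\<in>topspace N'. \<forall>t\<in>{0<..1}. H (x, t) \<in> topspace N' - c ` Y)"
  proof (intro exI[of _ "\<lambda>z. c (H (c' (fst z), snd z))"] conjI ballI)
    have "continuous_map (prod_topology N' unit_interval) (prod_topology N unit_interval)
        (\<lambda>z. (c' (fst z), snd z))"
      using continuous_map_compose[OF continuous_map_fst cc(2)]
      by (simp add: continuous_map_paired continuous_map_snd o_def)
    from continuous_map_compose[OF continuous_map_compose[OF this H(1)] cc(1)]
    show "continuous_map (prod_topology N' unit_interval) N' (\<lambda>z. c (H (c' (fst z), snd z)))"
      by (simp add: o_def)
    fix x assume x: "x \<in> topspace N'"
    show "c (H (c' (fst (x, 0 :: real)), snd (x, 0))) = x"
      using H(2)[OF c'N[OF x]] cc(4)[OF x] by simp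
    fix t :: real assume t: "t \<in> {0<..1}"
    have *: "H (c' x, t) \<in> topspace N - Y" by (rule H(3)[OF c'N[OF x] t])
    have "c (H (c' x, t)) \<notin> c ` Y"
    proof
      assume "c (H (c' x, t)) \<in> c ` Y"
      then obtain y where y: "y \<in> Y" "c (H (c' x, t)) = c y" by blast
      then have "y \<in> topspace N" using closedin_subset[OF YN] by blast
      with y(2) cc(3) * have "H (c' x, t) = y" by (metis DiffD1)
      with * y(1) show False by simp
    qed
    with * cN show "c (H (c' (fst (x, t)), snd (x, t))) \<in> topspace N' - c ` Y" by simp
  qed
qed

lemma homotopy_negligible_prod:
  assumes M: "homotopy_negligible M X" and S: "closedin (prod_topology M K) S"
    and SX: "\<And>x k. (x, k) \<in> S \<Longrightarrow> x \<in> X"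
  shows "homotopy_negligible (prod_topology M K) S"
  unfolding homotopy_negligible_def
proof (intro conjI S)
  from M obtain H where H: "continuous_map (prod_topology M unit_interval) M H"
    "\<And>x. x \<in> topspace M \<Longrightarrow> H (x, 0) = x"
    "\<And>x t. x \<in> topspace M \<Longrightarrow> t \<in> {0<..1} \<Longrightarrow> H (x, t) \<in> topspace M - X"
    unfolding homotopy_negligible_def by metis
  have c1: "continuous_map (prod_topology (prod_topology M K) unit_interval) (prod_topology M unit_interval)
      (\<lambda>z. (fst (fst z), snd z))"
    using continuous_map_compose[OF continuous_map_fst continuous_map_fst]
    by (simp add: continuous_map_paired continuous_map_snd o_def)
  have c2: "continuous_map (prod_topology (prod_topology M K) unit_interval) K (\<lambda>z. snd (fst z))"
    using continuous_map_compose[OF continuous_map_fst continuous_map_snd] by (simp add: o_def)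
  show "\<exists>H. continuous_map (prod_topology (prod_topology M K) unit_interval) (prod_topology M K) H \<and>
      (\<forall>x\<in>topspace (prod_topology M K). H (x, 0) = x) \<and>
      (\<forall>x\<in>topspace (prod_topology M K). \<forall>t\<in>{0<..1}. H (x, t) \<in> topspace (prod_topology M K) - S)"
  proof (intro exI[of _ "\<lambda>z. (H (fst (fst z), snd z), snd (fst z))"] conjI ballI)
    show "continuous_map (prod_topology (prod_topology M K) unit_interval) (prod_topology M K)
        (\<lambda>z. (H (fst (fst z), snd z), snd (fst z)))"
      using continuous_map_compose[OF c1 H(1)] c2 by (simp add: continuous_map_paired o_def)
  next
    fix x :: "'a \<times> 'b" assume x: "x \<in> topspace (prod_topology M K)"
    then show "(H (fst (fst (x, 0 :: real)), snd (x, 0 :: real)), snd (fst (x, 0 :: real))) = x"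
      using H(2)[of "fst x"] by (auto simp: mem_Times_iff)
    fix t :: real assume "t \<in> {0<..1}"
    with x H(3)[of "fst x" t] SX
    show "(H (fst (fst (x, t)), snd (x, t)), snd (fst (x, t))) \<in> topspace (prod_topology M K) - S"
      by (auto simp: mem_Times_iff)
  qed
qed

lemma homotopy_negligible_zero:
  assumes X: "closedin M X"
  shows "homotopy_negligible (prod_topology M unit_interval) (X \<times> {0})"
  unfolding homotopy_negligible_def
proof (intro conjI exI[of _ "\<lambda>z. (fst (fst z), max (snd (fst z)) (snd z))"] ballI)
  have "closedin unit_interval {0}" by (intro closed_subset) auto
  with X show "closedin (prod_topology M unit_interval) (X \<times> {0})" by (simp add: closedin_prod_Times_iff)
  have "continuous_map (prod_topology (prod_topology M unit_interval) unit_interval) unit_interval (\<lambda>z. snd (fst z))"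
    using continuous_map_compose[OF continuous_map_fst continuous_map_snd] by (simp add: o_def)
  moreover have "continuous_map (prod_topology (prod_topology M unit_interval) unit_interval) unit_interval snd"
    by (rule continuous_map_snd)
  ultimately have "continuous_map (prod_topology (prod_topology M unit_interval) unit_interval) unit_interval
      (\<lambda>z. max (snd (fst z)) (snd z))"
    by (auto simp: continuous_map_in_subtopology Pi_iff intro: continuous_map_real_max)
  then show "continuous_map (prod_topology (prod_topology M unit_interval) unit_interval)
      (prod_topology M unit_interval) (\<lambda>z. (fst (fst z), max (snd (fst z)) (snd z)))"
    using continuous_map_compose[OF continuous_map_fst continuous_map_fst]
    by (simp add: continuous_map_paired o_def)
qed (auto simp: max_def)

lemma lepoll_times_infinite:
  assumes "infinite (UNIV :: 'u set)" "A \<lesssim> (UNIV :: 'u set)" "B \<lesssim> (UNIV :: 'u set)"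
  shows "A \<times> B \<lesssim> (UNIV :: 'u set)"
proof -
  have "A \<times> B \<lesssim> (UNIV :: 'u set) \<times> (UNIV :: 'u set)"
    by (rule times_lepoll_mono[OF assms(2,3)])
  also have "(UNIV :: 'u set) \<times> (UNIV :: 'u set) \<approx> (UNIV :: 'u set)"
    using card_of_Times_same_infinite[OF assms(1)] by (simp add: eqpoll_iff_card_of_ordIso)
  finally show ?thesis .
qed

lemma lists_lepoll_infinite:
  assumes inf: "infinite (UNIV :: 'u set)" and a: "(UNIV :: 'a set) \<lesssim> (UNIV :: 'u set)"
  shows "(UNIV :: 'a list set) \<lesssim> (UNIV :: 'u set)"
proof -
  from a obtain i :: "'a \<Rightarrow> 'u" where i: "inj i" by (auto simp: lepoll_def)
  have "(UNIV :: 'u set) \<times> (UNIV :: 'u set) \<lesssim> (UNIV :: 'u set)"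
    by (rule lepoll_times_infinite[OF inf]) (rule lepoll_refl)+
  then obtain p :: "'u \<times> 'u \<Rightarrow> 'u" where p: "inj p" by (auto simp: lepoll_def)
  define e where "e l = foldr (\<lambda>x u. p (i x, u)) l undefined" for l
  have e: "l = l'" if "length l = length l'" "e l = e l'" for l l'
    using that
  proof (induction l l' rule: list_induct2)
    case (Cons x xs y ys)
    then have "p (i x, e xs) = p (i y, e ys)" by (simp add: e_def)
    then have "i x = i y" "e xs = e ys" using p by (auto dest: injD)
    with Cons i show ?case by (auto dest: injD)
  qed simp
  have "inj (\<lambda>l. (length l, e l))" by (rule injI) (use e in auto)
  then have "(UNIV :: 'a list set) \<lesssim> (UNIV :: nat set) \<times> (UNIV :: 'u set)"
    by (auto simp: lepoll_def)
  also have "\<dots> \<lesssim> (UNIV :: 'u set)"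
    by (rule lepoll_times_infinite[OF inf]) (use inf in \<open>auto simp: infinite_le_lepoll\<close>)
  finally show ?thesis .
qed

lemma convex_hull_lepoll:
  fixes f :: "'u \<Rightarrow> 'v::real_vector"
  assumes u: "(UNIV :: real set) \<lesssim> (UNIV :: 'u set)"
  shows "convex hull (f ` A) \<lesssim> (UNIV :: 'u set)"
proof -
  have inf: "infinite (UNIV :: 'u set)"
    using u infinite_UNIV_char_0 lepoll_trans infinite_le_lepoll by metis
  define g where "g l = sum_list (map (\<lambda>(x, c). c *\<^sub>R f x) l)" for l :: "('u \<times> real) list"
  have "convex hull (f ` A) \<subseteq> range g"
  proof
    fix y assume "y \<in> convex hull (f ` A)"
    then obtain S w where S: "finite S" "S \<subseteq> f ` A" "(\<Sum>v\<in>S. w v *\<^sub>R v) = y"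
      unfolding convex_hull_explicit by blast
    from S(1) obtain l where l: "set l = S" "distinct l" using finite_distinct_list by blast
    have "y = sum_list (map (\<lambda>v. w v *\<^sub>R v) l)"
      using S(3) l by (simp add: sum_list_distinct_conv_sum_set)
    also have "map (\<lambda>v. w v *\<^sub>R v) l = map (\<lambda>v. w v *\<^sub>R f (inv_into A f v)) l"
      using l S(2) by (auto simp: f_inv_into_f subset_iff)
    also have "sum_list \<dots> = g (map (\<lambda>v. (inv_into A f v, w v)) l)"
      by (simp add: g_def o_def)
    finally show "y \<in> range g" by blast
  qed
  then have "convex hull (f ` A) \<lesssim> (UNIV :: ('u \<times> real) list set)"
    by (rule subset_image_lepoll)
  also have "\<dots> \<lesssim> (UNIV :: 'u set)"
    using lepoll_times_infinite[OF inf lepoll_refl u] by (intro lists_lepoll_infinite inf) simp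
  finally show ?thesis .
qed

text \<open>
  The Kuratowski embedding is closed in its convex hull: if \<open>d(y\<^sub>n, \<cdot>)\<close> converges uniformly to a
  convex combination of functions \<open>d(x, \<cdot>)\<close>, then evaluation at \<open>y\<^sub>n\<close> shows that \<open>y\<^sub>n\<close> converges to
  each of the points \<open>x\<close>.
\<close>

lemma Kuratowski_embedding:
  fixes X :: "'u topology"
  assumes X: "metrizable_space X"
  obtains \<kappa> :: "'u \<Rightarrow> ('u discrete \<Rightarrow>\<^sub>C real)" where
    "embedding_map X (top_of_set (convex hull (\<kappa> ` topspace X))) \<kappa>"
    "closedin (top_of_set (convex hull (\<kappa> ` topspace X))) (\<kappa> ` topspace X)"
proof -
  from X obtain M0 d0 where m0: "Metric_space M0 d0" and X0: "X = Metric_space.mtopology M0 d0"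
    by (auto simp: metrizable_space_def)
  obtain d where m: "Metric_space M0 d" and Xd: "X = Metric_space.mtopology M0 d" and d1: "\<And>x y. d x y \<le> 1"
  proof (rule that[of "Metric_space.capped_dist d0 1"])
    show "Metric_space M0 (Metric_space.capped_dist d0 1)" by (rule Metric_space.capped_dist[OF m0])
    show "X = Metric_space.mtopology M0 (Metric_space.capped_dist d0 1)"
      using Metric_space.mtopology_capped_metric[OF m0] X0 by simp
    show "Metric_space.capped_dist d0 1 x y \<le> 1" for x y
      by (simp add: Metric_space.capped_dist_def[OF m0])
  qed
  interpret Metric_space M0 d by (rule m)
  have top: "topspace X = M0" by (simp add: Xd)
  define k where "k x z = (if of_discrete z \<in> M0 then d x (of_discrete z) else 0)" for x z
  define \<kappa> where "\<kappa> x = Bcontfun (k x)" for x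
  have "k x \<in> bcontfun" for x
  proof (rule bcontfun_normI)
    show "continuous_on UNIV (k x)"
      by (intro continuous_openin_preimage_eq[THEN iffD2]) (auto simp: open_discrete)
    show "norm (k x z) \<le> 1" for z using d1 by (simp add: k_def)
  qed
  then have k: "apply_bcontfun (\<kappa> x) = k x" for x by (simp add: \<kappa>_def Bcontfun_inverse)
  have dist: "dist (\<kappa> x) (\<kappa> y) = d x y" if "x \<in> M0" "y \<in> M0" for x y
  proof (rule antisym)
    show "dist (\<kappa> x) (\<kappa> y) \<le> d x y"
    proof (rule dist_bound)
      fix z
      show "dist (apply_bcontfun (\<kappa> x) z) (apply_bcontfun (\<kappa> y) z) \<le> d x y"
        using mdist_reverse_triangle[of x "of_discrete z" y] that
        by (auto simp: k k_def dist_real_def commute)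
    qed
    have "dist (apply_bcontfun (\<kappa> x) (discrete y)) (apply_bcontfun (\<kappa> y) (discrete y)) \<le> dist (\<kappa> x) (\<kappa> y)"
      by (rule dist_bounded)
    then show "d x y \<le> dist (\<kappa> x) (\<kappa> y)"
      using that by (simp add: k k_def discrete_inverse dist_real_def)
  qed
  have inj: "inj_on \<kappa> M0" by (rule inj_onI) (use dist zero in force)
  define C where "C = convex hull (\<kappa> ` M0)"
  have sub: "\<kappa> ` M0 \<subseteq> C" by (simp add: C_def hull_subset)
  have lim: "limitin X s x sequentially \<longleftrightarrow> (\<lambda>n. \<kappa> (s n)) \<longlonglongrightarrow> \<kappa> x" if "range s \<subseteq> M0" "x \<in> M0" for s x
  proof -
    have "s n \<in> M0" for n using that by blast
    with that show ?thesis
      by (simp add: Xd limit_metric_sequentially lim_sequentially dist)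
  qed
  have "closedin (top_of_set C) (\<kappa> ` M0)"
    unfolding closedin_sequentially[OF metrizable_space_subtopology[OF metrizable_space_euclidean]]
  proof (intro conjI allI impI)
    show "\<kappa> ` M0 \<subseteq> topspace (top_of_set C)" using sub by simp
    fix s p assume s: "range s \<subseteq> \<kappa> ` M0 \<and> limitin (top_of_set C) s p sequentially"
    then have sp: "s \<longlonglongrightarrow> p" and pC: "p \<in> C" by (auto simp: limitin_subtopology)
    from s have "\<forall>n. \<exists>y\<in>M0. s n = \<kappa> y" by blast
    then obtain y where y: "\<And>n. y n \<in> M0" "\<And>n. s n = \<kappa> (y n)" by metis
    from pC obtain S w where S: "finite S" "S \<subseteq> \<kappa> ` M0" "\<And>x. x \<in> S \<Longrightarrow> 0 \<le> w x" "sum w S = 1"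
      "(\<Sum>v\<in>S. w v *\<^sub>R v) = p"
      unfolding C_def convex_hull_explicit by blast
    have "\<exists>v\<in>S. w v > 0"
    proof (rule ccontr)
      assume "\<not> ?thesis"
      then have "sum w S \<le> 0" by (intro sum_nonpos) (auto simp: not_less)
      with S(4) show False by simp
    qed
    then obtain v where v: "v \<in> S" "w v > 0" by blast
    with S(2) obtain x where x: "x \<in> M0" "v = \<kappa> x" by blast
    have bound: "w v * d x (y n) \<le> dist (s n) p" for n
    proof -
      let ?z = "discrete (y n)"
      have app: "apply_bcontfun p ?z = (\<Sum>u\<in>S. w u * apply_bcontfun u ?z)"
      proof -
        have "apply_bcontfun (\<Sum>u\<in>T. w u *\<^sub>R u) ?z = (\<Sum>u\<in>T. w u * apply_bcontfun u ?z)" if "finite T" for T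
          using that by (induction T) (auto simp: zero_bcontfun.rep_eq plus_bcontfun.rep_eq scaleR_bcontfun.rep_eq)
        with S(1,5) show ?thesis by auto
      qed
      have nn: "0 \<le> w u * apply_bcontfun u ?z" if "u \<in> S" for u
        using S(2,3) that by (auto simp: k k_def)
      have "w v * d x (y n) = w v * apply_bcontfun v ?z"
        using x y by (simp add: k k_def discrete_inverse)
      also have "\<dots> \<le> (\<Sum>u\<in>S. w u * apply_bcontfun u ?z)"
        using v(1) S(1) nn by (intro member_le_sum) auto
      also have "\<dots> = dist (apply_bcontfun (s n) ?z) (apply_bcontfun p ?z)"
        using nn y by (simp add: app k k_def discrete_inverse dist_real_def sum_nonneg)
      also have "\<dots> \<le> dist (s n) p" by (rule dist_bounded)
      finally show ?thesis .
    qed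
    have "(\<lambda>n. dist (s n) p / w v) \<longlonglongrightarrow> 0 / w v"
      by (intro tendsto_divide tendsto_const tendsto_dist_iff[THEN iffD1] sp) (use v(2) in simp)
    moreover have "dist (s n) v \<le> dist (s n) p / w v" for n
      using bound[of n] v(2) x y by (simp add: dist field_simps commute)
    ultimately have "(\<lambda>n. dist (s n) v) \<longlonglongrightarrow> 0"
      by (intro Lim_null_comparison[of "\<lambda>n. dist (s n) v"] always_eventually) auto
    then have "s \<longlonglongrightarrow> v" by (rule tendsto_dist_iff[THEN iffD2])
    with sp have "p = v" using LIMSEQ_unique by blast
    with x show "p \<in> \<kappa> ` M0" by simp
  qed
  moreover have "embedding_map X (top_of_set C) \<kappa>"
  proof -
    let ?j = "inv_into M0 \<kappa>"
    have mk: "metrizable_space (top_of_set (\<kappa> ` M0))"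
      by (simp add: metrizable_space_euclidean metrizable_space_subtopology)
    have "homeomorphic_maps X (top_of_set (\<kappa> ` M0)) \<kappa> ?j"
      unfolding homeomorphic_maps_def
    proof (intro conjI ballI)
      show "continuous_map X (top_of_set (\<kappa> ` M0)) \<kappa>"
      proof (rule continuous_map_sequentiallyI[OF X])
        fix s x assume s: "range s \<subseteq> topspace X" "limitin X s x sequentially"
        then have "x \<in> M0" using limitin_topspace top by metis
        with s lim[of s x] show "\<exists>r. strict_mono (r :: nat \<Rightarrow> nat) \<and>
            limitin (top_of_set (\<kappa> ` M0)) (\<kappa> \<circ> s \<circ> r) (\<kappa> x) sequentially"
          by (intro exI[of _ id])
            (auto simp: strict_mono_id limitin_subtopology o_def top intro!: always_eventually)
      qed (simp add: top)
      show "continuous_map (top_of_set (\<kappa> ` M0)) X ?j"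
      proof (rule continuous_map_sequentiallyI[OF mk])
        fix s p assume s: "range s \<subseteq> topspace (top_of_set (\<kappa> ` M0))"
          "limitin (top_of_set (\<kappa> ` M0)) s p sequentially"
        then have p: "p \<in> \<kappa> ` M0" "s \<longlonglongrightarrow> p" by (auto simp: limitin_subtopology)
        have sn: "s n \<in> \<kappa> ` M0" for n using s(1) by auto
        have "limitin X (\<lambda>n. ?j (s n)) (?j p) sequentially"
          using lim[of "\<lambda>n. ?j (s n)" "?j p"] p sn inv_into_into[OF sn]
          by (auto simp: f_inv_into_f image_subset_iff inj)
        then show "\<exists>r. strict_mono (r :: nat \<Rightarrow> nat) \<and> limitin X (?j \<circ> s \<circ> r) (?j p) sequentially"
          by (intro exI[of _ id]) (auto simp: strict_mono_id o_def)
      qed (auto simp: top inv_into_into)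
    qed (use inj top in \<open>auto simp: f_inv_into_f\<close>)
    then have "homeomorphic_map X (top_of_set (\<kappa> ` M0)) \<kappa>"
      by (simp add: homeomorphic_maps_map)
    moreover have "top_of_set (\<kappa> ` M0) = subtopology (top_of_set C) (\<kappa> ` topspace X)"
      using sub by (simp add: subtopology_subtopology top Int_absorb1)
    ultimately show ?thesis by (simp add: embedding_map_def)
  qed
  ultimately show thesis using that[of \<kappa>] by (simp add: C_def top)
qed

lemma copy_AR:
  fixes P :: "'p topology"
  assumes P: "abs_extensor TYPE('u) P" and card: "topspace P \<lesssim> (UNIV :: 'u set)"
  obtains P' :: "'u topology" and c where "homeomorphic_map P P' c" "AR_space P'"
proof -
  from card obtain c :: "'p \<Rightarrow> 'u" where c: "inj_on c (topspace P)" by (auto simp: lepoll_def)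
  from copy_topology[OF c] obtain P' where h: "homeomorphic_map P P' c" .
  have "AR_space P'" using abs_extensor_homeomorphic[OF P h] by (simp add: AR_space_iff_abs_extensor)
  with h show thesis by (rule that)
qed

lemma closed_embedding_homeomorphic:
  assumes "closed_embedding X P f" "homeomorphic_map P P' c"
  shows "closed_embedding X P' (c \<circ> f)"
proof -
  have "embedding_map P P' c"
    using assms(2) homeomorphic_imp_surjective_map[OF assms(2)]
    by (simp add: embedding_map_def)
  then have "embedding_map X P' (c \<circ> f)"
    using assms(1) embedding_map_compose by (auto simp: closed_embedding_def)
  moreover have "closedin P' (c ` (f ` topspace X))"
    using assms homeomorphic_map_closedness[OF assms(2)] closedin_subset
    by (auto simp: closed_embedding_def)
  ultimately show ?thesis by (simp add: closed_embedding_def image_comp)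
qed

lemma AR_hull_iff:
  "AR_hull X (M, e) \<longleftrightarrow>
    AR_space M \<and> closed_embedding X M e \<and> homotopy_negligible M (e ` topspace X)"
  by (auto simp: AR_hull_def closed_embedding_def homotopy_negligible_def)

lemma copy_hull:
  fixes P :: "'p topology" and X :: "'u topology"
  assumes P: "abs_extensor TYPE('u) P" and card: "topspace P \<lesssim> (UNIV :: 'u set)"
    and f: "closed_embedding X P f" and n: "homotopy_negligible P (f ` topspace X)"
  obtains P' :: "'u topology" and c where "homeomorphic_map P P' c" "AR_hull X (P', c \<circ> f)"
proof -
  from copy_AR[OF P card] obtain P' :: "'u topology" and c where h: "homeomorphic_map P P' c" "AR_space P'" .
  have "AR_hull X (P', c \<circ> f)"
    using h closed_embedding_homeomorphic[OF f h(1)] homotopy_negligible_homeomorphic[OF n h(1)]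
    by (simp add: AR_hull_iff image_comp)
  with h(1) show thesis by (rule that)
qed

lemma AR_hull_exists:
  fixes X :: "'u topology"
  assumes u: "(UNIV :: real set) \<lesssim> (UNIV :: 'u set)" and X: "metrizable_space X"
  obtains m where "AR_hull X m"
proof (cases "topspace X = {}")
  case True
  let ?P = "discrete_topology {undefined :: 'u}"
  have "AR_space ?P"
    unfolding AR_space_def
  proof (intro conjI allI impI)
    fix W :: "'u topology" and B f
    assume "metrizable_space W \<and> closedin W B \<and> continuous_map (subtopology W B) ?P f"
    then have "f x = undefined" if "x \<in> B" for x
      using that closedin_subset[of W B] by (auto simp: continuous_map_def)
    then show "\<exists>g. continuous_map W ?P g \<and> (\<forall>x\<in>B. g x = f x)"
      by (intro exI[of _ "\<lambda>_. undefined"]) simp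
  qed (simp add: metrizable_space_discrete_topology)
  moreover have "embedding_map X ?P id"
    using True by (auto simp: embedding_map_def)
  moreover have "homotopy_negligible ?P (id ` topspace X)"
    using True by (auto simp: homotopy_negligible_def intro!: exI[of _ fst] continuous_map_fst)
  ultimately show thesis using that[of "(?P, id)"] by (simp add: AR_hull_def)
next
  case False
  from Kuratowski_embedding[OF X] obtain \<kappa> :: "'u \<Rightarrow> ('u discrete \<Rightarrow>\<^sub>C real)" where
    k: "embedding_map X (top_of_set (convex hull (\<kappa> ` topspace X))) \<kappa>"
    "closedin (top_of_set (convex hull (\<kappa> ` topspace X))) (\<kappa> ` topspace X)" .
  define C where "C = convex hull (\<kappa> ` topspace X)"
  have ne: "C \<noteq> {}" using False by (simp add: C_def)
  have inf: "infinite (UNIV :: 'u set)"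
    using u infinite_UNIV_char_0 lepoll_trans infinite_le_lepoll by metis
  let ?P = "prod_topology (top_of_set C) unit_interval"
  have "{0..1::real} \<lesssim> (UNIV :: 'u set)"
    using u subset_imp_lepoll[of "{0..1::real}" UNIV] lepoll_trans by auto
  then have card: "topspace ?P \<lesssim> (UNIV :: 'u set)"
    using lepoll_times_infinite[OF inf convex_hull_lepoll[OF u]] by (simp add: C_def)
  have ae: "abs_extensor TYPE('u) ?P"
    using ne by (intro abs_extensor_prod abs_extensor_convex abs_extensor_unit_interval)
      (auto simp: C_def)
  have im: "(\<lambda>x. (\<kappa> x, 0::real)) ` topspace X = \<kappa> ` topspace X \<times> {0}" by auto
  have neg: "homotopy_negligible ?P ((\<lambda>x. (\<kappa> x, 0)) ` topspace X)"
    unfolding im by (rule homotopy_negligible_zero) (use k(2) in \<open>simp add: C_def\<close>)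
  have "embedding_map (top_of_set C) ?P (\<lambda>x. (x, 0))"
    unfolding section_map_def retraction_maps_def
    by (intro section_imp_embedding_map[unfolded section_map_def retraction_maps_def] exI[of _ fst] conjI
      continuous_map_fst continuous_map_pairedI continuous_map_id[unfolded id_def]) auto
  with k(1) have "embedding_map X ?P (\<lambda>x. (\<kappa> x, 0))"
    using embedding_map_compose[of X "top_of_set C" \<kappa> ?P "\<lambda>x. (x, 0)"] by (simp add: C_def o_def)
  with neg have "closed_embedding X ?P (\<lambda>x. (\<kappa> x, 0))"
    by (simp add: closed_embedding_def homotopy_negligible_def)
  from copy_hull[OF ae card this neg] that show thesis by metis
qed

section \<open>The homotopy category\<close>

lemma homotopy_class_eq_iff:
  assumes "continuous_map X Y f"
  shows "homotopy_class X Y f = homotopy_class X Y g \<longleftrightarrow> homotopic_with (\<lambda>_. True) X Y f g"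
proof
  assume "homotopy_class X Y f = homotopy_class X Y g"
  moreover have "f \<in> homotopy_class X Y f" using assms by (simp add: homotopy_class_def)
  ultimately show "homotopic_with (\<lambda>_. True) X Y f g"
    by (auto simp: homotopy_class_def homotopic_with_sym)
next
  assume "homotopic_with (\<lambda>_. True) X Y f g"
  then show "homotopy_class X Y f = homotopy_class X Y g"
    unfolding homotopy_class_def using homotopic_with_trans homotopic_with_symD by blast
qed

lemma hM_Compose_class:
  assumes f: "continuous_map X Y f" and g: "continuous_map Y Z g"
  shows "Compose hM X Y Z (homotopy_class Y Z g) (homotopy_class X Y f) = homotopy_class X Z (g \<circ> f)"
proof -
  have "homotopy_class X Z (g' \<circ> f') = homotopy_class X Z (g \<circ> f)"
    if "homotopic_with (\<lambda>_. True) X Y f f'" "homotopic_with (\<lambda>_. True) Y Z g g'" for f' g'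
  proof -
    have "homotopic_with (\<lambda>_. True) X Z (g \<circ> f) (g' \<circ> f')"
      by (rule homotopic_compose[OF that])
    then show ?thesis
      using homotopy_class_eq_iff[OF continuous_map_compose[OF f g]] by blast
  qed
  moreover have "f \<in> homotopy_class X Y f" "g \<in> homotopy_class Y Z g"
    using f g by (simp_all add: homotopy_class_def)
  ultimately show ?thesis unfolding hM_def cat.simps homotopy_class_def by blast
qed

lemma Obj_hM: "Obj hM = {X. metrizable_space X}"
  and Hom_hM: "Hom hM X Y = {homotopy_class X Y f |f. continuous_map X Y f}"
  and Ident_hM: "Ident hM X = homotopy_class X X id"
  by (simp_all add: hM_def)

lemma category_hM: "category hM"
proof
  fix X Y Z :: "'v topology" and f g
  assume "f \<in> Hom hM X Y" "g \<in> Hom hM Y Z"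
  then show "Compose hM X Y Z g f \<in> Hom hM X Z"
    by (auto simp: Hom_hM hM_Compose_class intro: continuous_map_compose)
next
  fix X Y :: "'v topology" and f
  assume "f \<in> Hom hM X Y"
  then obtain f0 where f: "f = homotopy_class X Y f0" "continuous_map X Y f0" by (auto simp: Hom_hM)
  show "Compose hM X X Y f (Ident hM X) = f" "Compose hM X Y Y (Ident hM Y) f = f"
    using hM_Compose_class[OF continuous_map_id f(2)] hM_Compose_class[OF f(2) continuous_map_id]
    by (simp_all add: f Ident_hM)
next
  fix W X Y Z :: "'v topology" and f g h
  assume "f \<in> Hom hM W X" "g \<in> Hom hM X Y" "h \<in> Hom hM Y Z"
  then obtain f0 g0 h0 where *: "f = homotopy_class W X f0" "continuous_map W X f0"
    "g = homotopy_class X Y g0" "continuous_map X Y g0" "h = homotopy_class Y Z h0" "continuous_map Y Z h0"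
    by (auto simp: Hom_hM)
  then show "Compose hM W Y Z h (Compose hM W X Y g f) = Compose hM W X Z (Compose hM X Y Z h g) f"
    by (simp add: hM_Compose_class continuous_map_compose[OF *(2,4)] continuous_map_compose[OF *(4,6)] o_assoc)
qed (auto simp: Ident_hM Hom_hM)

section \<open>The fine shape category\<close>

definition hull_approaching ::
    "'u topology \<Rightarrow> 'u topology \<times> ('u \<Rightarrow> 'u) \<Rightarrow> 'u topology \<Rightarrow> 'u topology \<times> ('u \<Rightarrow> 'u) \<Rightarrow> ('u \<Rightarrow> 'u) \<Rightarrow> bool"
  where "hull_approaching X m Y n = approaching_map (fst m) (snd m ` topspace X) (fst n) (snd n ` topspace Y)"

definition hull_homotopic ::
    "'u topology \<Rightarrow> 'u topology \<times> ('u \<Rightarrow> 'u) \<Rightarrow> 'u topology \<Rightarrow> 'u topology \<times> ('u \<Rightarrow> 'u) \<Rightarrow>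
      ('u \<Rightarrow> 'u) \<Rightarrow> ('u \<Rightarrow> 'u) \<Rightarrow> bool"
  where "hull_homotopic X m Y n =
    approaching_homotopic (fst m) (snd m ` topspace X) (fst n) (snd n ` topspace Y)"

lemma AR_hullD:
  assumes "AR_hull (X :: 'u topology) m"
  shows "abs_extensor TYPE('u) (fst m)" "metrizable_space (fst m)" "embedding_map X (fst m) (snd m)"
    "homotopy_negligible (fst m) (snd m ` topspace X)" "closedin (fst m) (snd m ` topspace X)"
    "snd m ` topspace X \<subseteq> topspace (fst m)"
proof -
  have *: "abs_extensor TYPE('u) (fst m)" "embedding_map X (fst m) (snd m)"
    "homotopy_negligible (fst m) (snd m ` topspace X)"
    using assms by (auto simp: AR_hull_def AR_space_iff_abs_extensor split: prod.splits)
  then show "abs_extensor TYPE('u) (fst m)" "embedding_map X (fst m) (snd m)"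
    "homotopy_negligible (fst m) (snd m ` topspace X)" by simp_all
  from *(1) show "metrizable_space (fst m)" by (rule abs_extensor_metrizable)
  from *(3) show c: "closedin (fst m) (snd m ` topspace X)" by (simp add: homotopy_negligible_def)
  from closedin_subset[OF c] show "snd m ` topspace X \<subseteq> topspace (fst m)" .
qed

lemma fsh_reps_iff:
  "(m, n, \<phi>) \<in> fsh_reps X Y \<longleftrightarrow> AR_hull X m \<and> AR_hull Y n \<and> hull_approaching X m Y n \<phi>"
  by (cases m; cases n) (simp add: fsh_reps_def hull_approaching_def)

lemma fsh_rel_iff:
  "((m, n, \<phi>), (m', n', \<psi>)) \<in> fsh_rel X Y \<longleftrightarrow>
    (m, n, \<phi>) \<in> fsh_reps X Y \<and> (m', n', \<psi>) \<in> fsh_reps X Y \<and>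
    (\<exists>a b. hull_map X m X m' id a \<and> hull_map Y n Y n' id b \<and> hull_homotopic X m Y n' (b \<circ> \<phi>) (\<psi> \<circ> a))"
  by (cases m; cases n; cases m'; cases n') (simp add: fsh_rel_def hull_homotopic_def)

lemma hull_map_iff:
  "hull_map X m Y n f g \<longleftrightarrow> continuous_map (fst m) (fst n) g \<and>
    (\<forall>x\<in>topspace X. g (snd m x) = snd n (f x)) \<and>
    {x \<in> topspace (fst m). g x \<in> snd n ` topspace Y} = snd m ` topspace X"
  by (cases m; cases n) (simp add: hull_map_def)

definition fsh_class :: "'u topology \<Rightarrow> 'u topology \<Rightarrow> 'u fsh_rep \<Rightarrow> 'u fsh_rep set" where
  "fsh_class X Y \<rho> = fsh_rel X Y `` {\<rho>}"

definition fsh_functor :: "'u topology \<Rightarrow> 'u topology \<Rightarrow> ('u \<Rightarrow> 'u) set \<Rightarrow> 'u fsh_rep set" where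
  "fsh_functor X Y a = induced_fsh_class X Y (SOME f. f \<in> a)"

lemma hull_approaching_compose:
  "\<lbrakk>hull_approaching X m Y n \<phi>; hull_approaching Y n Z p \<psi>\<rbrakk> \<Longrightarrow> hull_approaching X m Z p (\<psi> \<circ> \<phi>)"
  unfolding hull_approaching_def by (rule approaching_map_compose)

lemma hull_homotopic_refl:
  "hull_approaching X m Y n \<phi> \<Longrightarrow> hull_homotopic X m Y n \<phi> \<phi>"
  unfolding hull_approaching_def hull_homotopic_def by (rule approaching_homotopic_refl) auto

lemma hull_homotopic_sym:
  "\<lbrakk>AR_hull X m; hull_homotopic X m Y n \<phi> \<psi>\<rbrakk> \<Longrightarrow> hull_homotopic X m Y n \<psi> \<phi>"
  unfolding hull_homotopic_def by (rule approaching_homotopic_sym[OF AR_hullD(2)])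

lemma hull_homotopic_trans:
  "\<lbrakk>AR_hull X m; hull_homotopic X m Y n \<phi> \<psi>; hull_homotopic X m Y n \<psi> \<theta>\<rbrakk> \<Longrightarrow> hull_homotopic X m Y n \<phi> \<theta>"
  unfolding hull_homotopic_def by (rule approaching_homotopic_trans[OF AR_hullD(2)])

lemma hull_homotopic_comp_left:
  "\<lbrakk>hull_homotopic X m Y n \<phi> \<psi>; hull_approaching Y n Z p \<theta>\<rbrakk> \<Longrightarrow> hull_homotopic X m Z p (\<theta> \<circ> \<phi>) (\<theta> \<circ> \<psi>)"
  unfolding hull_approaching_def hull_homotopic_def by (rule approaching_homotopic_comp_left)

lemma hull_homotopic_comp_right:
  "\<lbrakk>AR_hull X m; hull_homotopic Y n Z p \<phi> \<psi>; hull_approaching X m Y n \<theta>\<rbrakk> \<Longrightarrow>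
    hull_homotopic X m Z p (\<phi> \<circ> \<theta>) (\<psi> \<circ> \<theta>)"
  unfolding hull_approaching_def hull_homotopic_def by (rule approaching_homotopic_comp_right[OF AR_hullD(2)])

lemma hull_map_approaching:
  assumes "hull_map X m Y n f g"
  shows "hull_approaching X m Y n g"
  unfolding hull_approaching_def
  by (rule approaching_map_continuous) (use assms in \<open>auto simp: hull_map_iff\<close>)

lemma hull_map_id: "AR_hull X m \<Longrightarrow> hull_map X m X m id id"
  using AR_hullD(6)[of X m] by (auto simp: hull_map_iff)

lemma hull_map_compose:
  assumes f: "hull_map X m Y n f g" and f': "hull_map Y n Z p f' g'" and Y: "f \<in> topspace X \<rightarrow> topspace Y"
  shows "hull_map X m Z p (f' \<circ> f) (g' \<circ> g)"
proof -
  have g: "g x \<in> topspace (fst n)" if "x \<in> topspace (fst m)" for x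
    using f that by (auto simp: hull_map_iff continuous_map_def)
  have "g' (g x) \<in> snd p ` topspace Z \<longleftrightarrow> x \<in> snd m ` topspace X" if x: "x \<in> topspace (fst m)" for x
  proof -
    have "g' (g x) \<in> snd p ` topspace Z \<longleftrightarrow> g x \<in> snd n ` topspace Y"
      using f' g[OF x] unfolding hull_map_iff by blast
    also have "\<dots> \<longleftrightarrow> x \<in> snd m ` topspace X" using f x unfolding hull_map_iff by blast
    finally show ?thesis .
  qed
  moreover have "snd m ` topspace X \<subseteq> topspace (fst m)" using f unfolding hull_map_iff by blast
  ultimately have "{x \<in> topspace (fst m). (g' \<circ> g) x \<in> snd p ` topspace Z} = snd m ` topspace X" by auto
  moreover have "continuous_map (fst m) (fst p) (g' \<circ> g)"
    using f f' by (auto simp: hull_map_iff intro: continuous_map_compose)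
  moreover have "(g' \<circ> g) (snd m x) = snd p ((f' \<circ> f) x)" if "x \<in> topspace X" for x
    using f f' that Y unfolding hull_map_iff by (auto simp: Pi_iff)
  ultimately show ?thesis unfolding hull_map_iff by blast
qed

lemma embedding_map_inverse:
  assumes "embedding_map X M e"
  obtains e' where "continuous_map (subtopology M (e ` topspace X)) X e'" "\<And>x. x \<in> topspace X \<Longrightarrow> e' (e x) = x"
proof -
  from assms obtain e' where e': "homeomorphic_maps X (subtopology M (e ` topspace X)) e e'"
    using homeomorphic_map_maps unfolding embedding_map_def by blast
  then show thesis by (intro that) (auto simp: homeomorphic_maps_def)
qed

lemma embedding_map_continuous: "embedding_map X M e \<Longrightarrow> continuous_map X M e"
  unfolding embedding_map_def
  by (rule continuous_map_into_fulltopology[OF homeomorphic_imp_continuous_map])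

lemma hull_map_exists:
  fixes X Y :: "'u topology"
  assumes m: "AR_hull X m" and n: "AR_hull Y n" and f: "continuous_map X Y f"
  obtains g where "hull_map X m Y n f g"
proof -
  let ?C = "snd m ` topspace X"
  from embedding_map_inverse[OF AR_hullD(3)[OF m]] obtain e'
    where e': "continuous_map (subtopology (fst m) ?C) X e'"
      "\<And>x. x \<in> topspace X \<Longrightarrow> e' (snd m x) = x" by metis
  have "continuous_map (subtopology (fst m) ?C) (fst n) (snd n \<circ> (f \<circ> e'))"
    using e'(1) f embedding_map_continuous[OF AR_hullD(3)[OF n]] by (intro continuous_map_compose)
  from pushoff_extension[OF AR_hullD(1)[OF n] AR_hullD(4)[OF n] subset_imp_lepoll[OF subset_UNIV] AR_hullD(2,5)[OF m] this]
  obtain g where g: "continuous_map (fst m) (fst n) g" "\<And>x. x \<in> ?C \<Longrightarrow> g x = (snd n \<circ> (f \<circ> e')) x"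
    "\<And>x. x \<in> topspace (fst m) - ?C \<Longrightarrow> g x \<in> topspace (fst n) - snd n ` topspace Y" by metis
  have fY: "f x \<in> topspace Y" if "x \<in> topspace X" for x using f that by (auto simp: continuous_map_def)
  have "hull_map X m Y n f g"
    unfolding hull_map_iff
  proof (intro conjI ballI g(1))
    show "g (snd m x) = snd n (f x)" if "x \<in> topspace X" for x using that g(2) e'(2) by simp
    then show "{x \<in> topspace (fst m). g x \<in> snd n ` topspace Y} = ?C"
      using g(3) AR_hullD(6)[OF m] fY by (auto simp: image_subset_iff)
  qed
  then show thesis by (rule that)
qed

lemma lepoll_prod_unit_interval:
  assumes u: "(UNIV :: real set) \<lesssim> (UNIV :: 'u set)" and A: "A \<lesssim> (UNIV :: 'u set)"
  shows "A \<times> {0..1::real} \<lesssim> (UNIV :: 'u set)"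
proof -
  have "infinite (UNIV :: 'u set)"
    using u infinite_UNIV_char_0 lepoll_trans infinite_le_lepoll by metis
  moreover have "{0..1::real} \<lesssim> (UNIV :: 'u set)"
    using u subset_imp_lepoll[of "{0..1::real}" UNIV] lepoll_trans by auto
  ultimately show ?thesis using A by (intro lepoll_times_infinite)
qed

lemma closedin_prod_unit_interval:
  "closedin M X \<Longrightarrow> closed T \<Longrightarrow> T \<subseteq> {0..1} \<Longrightarrow> closedin (prod_topology M unit_interval) (X \<times> T)"
  by (simp add: closedin_prod_Times_iff closed_subset)

lemma hull_map_homotopic:
  fixes X Y :: "'u topology"
  assumes u: "(UNIV :: real set) \<lesssim> (UNIV :: 'u set)"
    and m: "AR_hull X m" and n: "AR_hull Y n"
    and g0: "hull_map X m Y n f0 g0" and g1: "hull_map X m Y n f1 g1"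
    and h: "homotopic_with (\<lambda>_. True) X Y f0 f1"
  shows "hull_homotopic X m Y n g0 g1"
proof -
  from h obtain h where h: "continuous_map (prod_topology unit_interval X) Y h"
    "\<And>x. h (0, x) = f0 x" "\<And>x. h (1, x) = f1 x"
    unfolding homotopic_with_def by blast
  let ?C = "snd m ` topspace X" and ?W = "prod_topology (fst m) unit_interval"
  from embedding_map_inverse[OF AR_hullD(3)[OF m]] obtain e'
    where e': "continuous_map (subtopology (fst m) ?C) X e'"
      "\<And>x. x \<in> topspace X \<Longrightarrow> e' (snd m x) = x" by metis
  define k where "k z = (if snd z = 0 then g0 (fst z) else if snd z = 1 then g1 (fst z)
    else snd n (h (snd z, e' (fst z))))" for z
  let ?A0 = "topspace (fst m) \<times> {0::real}" and ?A1 = "topspace (fst m) \<times> {1::real}" and ?B = "?C \<times> {0..1::real}"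
  have kB: "k z = snd n (h (snd z, e' (fst z)))" if "z \<in> ?B" for z
    using that g0 g1 e'(2) h(2,3) by (auto simp: k_def hull_map_iff)
  have cl: "closedin ?W ?A0" "closedin ?W ?A1" "closedin ?W ?B"
    using AR_hullD(5)[OF m] by (auto intro!: closedin_prod_unit_interval)
  have c0: "continuous_map (subtopology ?W ?A0) (fst n) k"
  proof (rule continuous_map_eq[where f = "g0 \<circ> fst"])
    show "continuous_map (subtopology ?W ?A0) (fst n) (g0 \<circ> fst)"
      using g0 by (auto simp: hull_map_iff intro!: continuous_map_compose[OF continuous_map_from_subtopology[OF continuous_map_fst]])
  qed (auto simp: k_def)
  have c1: "continuous_map (subtopology ?W ?A1) (fst n) k"
  proof (rule continuous_map_eq[where f = "g1 \<circ> fst"])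
    show "continuous_map (subtopology ?W ?A1) (fst n) (g1 \<circ> fst)"
      using g1 by (auto simp: hull_map_iff intro!: continuous_map_compose[OF continuous_map_from_subtopology[OF continuous_map_fst]])
  qed (auto simp: k_def)
  have cB: "continuous_map (subtopology ?W ?B) (fst n) k"
  proof (rule continuous_map_eq[where f = "snd n \<circ> (h \<circ> (\<lambda>z. (snd z, e' (fst z))))"])
    have "continuous_map (subtopology ?W ?B) (subtopology (fst m) ?C) fst"
      by (auto simp: continuous_map_in_subtopology intro: continuous_map_from_subtopology[OF continuous_map_fst])
    then have "continuous_map (subtopology ?W ?B) X (\<lambda>z. e' (fst z))"
      using continuous_map_compose[OF _ e'(1)] by (auto simp: o_def)
    then have "continuous_map (subtopology ?W ?B) (prod_topology unit_interval X) (\<lambda>z. (snd z, e' (fst z)))"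
      by (simp add: continuous_map_paired continuous_map_snd_unit)
    then show "continuous_map (subtopology ?W ?B) (fst n) (snd n \<circ> (h \<circ> (\<lambda>z. (snd z, e' (fst z)))))"
      using h(1) embedding_map_continuous[OF AR_hullD(3)[OF n]] by (intro continuous_map_compose)
  qed (auto simp: kB)
  have "continuous_map (subtopology ?W (?A0 \<union> ?A1 \<union> ?B)) (fst n) k"
    using cl c0 c1 cB by (intro continuous_map_Un_closed closedin_Un)
  moreover have "closedin ?W (?A0 \<union> ?A1 \<union> ?B)" using cl by (intro closedin_Un)
  moreover have "topspace ?W \<lesssim> (UNIV :: 'u set)"
    using lepoll_prod_unit_interval[OF u subset_imp_lepoll[OF subset_UNIV]] by simp
  ultimately obtain G where G: "continuous_map ?W (fst n) G" "\<And>z. z \<in> ?A0 \<union> ?A1 \<union> ?B \<Longrightarrow> G z = k z"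
    "\<And>z. z \<in> topspace ?W - (?A0 \<union> ?A1 \<union> ?B) \<Longrightarrow> G z \<in> topspace (fst n) - snd n ` topspace Y"
    using pushoff_extension[OF AR_hullD(1,4)[OF n] _ metrizable_prod_unit_interval[OF AR_hullD(2)[OF m]]]
    by metis
  have hY: "h (t, x) \<in> topspace Y" if "t \<in> {0..1}" "x \<in> topspace X" for t x
    using h(1) that by (auto simp: continuous_map_def Pi_iff)
  have out: "G z \<notin> snd n ` topspace Y" if z: "z \<in> topspace ?W - ?B" for z
  proof (cases "z \<in> ?A0 \<union> ?A1")
    case True
    then have "G z = k z" using G(2) by blast
    with True z g0 g1 show ?thesis by (auto simp: k_def hull_map_iff)
  next
    case False
    with z G(3)[of z] show ?thesis by blast
  qed
  show ?thesis
    unfolding hull_homotopic_def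
  proof (rule approaching_homotopicI)
    show "approaching_map ?W ?B (fst n) (snd n ` topspace Y) G"
    proof (rule approaching_map_continuous[OF G(1)])
      show "G z \<notin> snd n ` topspace Y" if "z \<in> topspace ?W - ?B" for z by (rule out[OF that])
      show "G z \<in> snd n ` topspace Y" if "z \<in> topspace ?W \<inter> ?B" for z
      proof -
        from that obtain x t where z: "z = (snd m x, t)" "x \<in> topspace X" "t \<in> {0..1}" by auto
        have "G z = k z" using that by (intro G(2)) blast
        also have "\<dots> = snd n (h (t, x))" using kB[of z] that z e'(2) by auto
        finally show ?thesis using hY z by simp
      qed
    qed
    fix x assume x: "x \<in> topspace (fst m) - ?C"
    then have "G (x, 0) = k (x, 0)" "G (x, 1) = k (x, 1)" by (auto intro!: G(2))
    then show "G (x, 0) = g0 x" "G (x, 1) = g1 x" by (auto simp: k_def)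
  qed
qed

lemma Obj_fSh: "Obj fSh = {X. metrizable_space X}" by (simp add: fSh_def)

lemma Ident_fSh: "Ident fSh X = induced_fsh_class X X id" by (simp add: fSh_def)

context
  assumes u: "(UNIV :: real set) \<lesssim> (UNIV :: 'u set)"
begin

lemma hull_map_unique:
  fixes X Y :: "'u topology"
  assumes m: "AR_hull X m" and n: "AR_hull Y n"
    and g0: "hull_map X m Y n f g0" and g1: "hull_map X m Y n f g1" and f: "continuous_map X Y f"
  shows "hull_homotopic X m Y n g0 g1"
  by (rule hull_map_homotopic[OF u m n g0 g1]) (use f in simp)

lemma hull_map_inverse:
  fixes X :: "'u topology"
  assumes m: "AR_hull X m" and m': "AR_hull X m'"
    and a: "hull_map X m X m' id a" and b: "hull_map X m' X m id b"
  shows "hull_homotopic X m X m (b \<circ> a) id"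
proof -
  have "hull_map X m X m (id \<circ> id) (b \<circ> a)" by (rule hull_map_compose[OF a b]) simp
  then show ?thesis using hull_map_unique[OF m m] hull_map_id[OF m] by (metis comp_id continuous_map_id)
qed

lemma hull_map_id_exists:
  fixes X :: "'u topology"
  assumes "AR_hull X m" "AR_hull X m'"
  obtains a where "hull_map X m X m' id a"
  using hull_map_exists[OF assms continuous_map_id] by blast

lemma fsh_rel_any:
  fixes X Y :: "'u topology"
  assumes r: "((m, n, \<phi>), (m', n', \<psi>)) \<in> fsh_rel X Y"
    and a: "hull_map X m X m' id a" and b: "hull_map Y n Y n' id b"
  shows "hull_homotopic X m Y n' (b \<circ> \<phi>) (\<psi> \<circ> a)"
proof -
  from r obtain a' b' where *: "AR_hull X m" "AR_hull Y n" "hull_approaching X m Y n \<phi>"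
    "AR_hull X m'" "AR_hull Y n'" "hull_approaching X m' Y n' \<psi>"
    and a': "hull_map X m X m' id a'" and b': "hull_map Y n Y n' id b'"
    and h: "hull_homotopic X m Y n' (b' \<circ> \<phi>) (\<psi> \<circ> a')"
    by (auto simp: fsh_rel_iff fsh_reps_iff)
  have "hull_homotopic X m Y n' (b \<circ> \<phi>) (b' \<circ> \<phi>)"
    using hull_homotopic_comp_right[OF *(1) hull_map_unique[OF *(2,5) b b' continuous_map_id] *(3)] .
  moreover have "hull_homotopic X m Y n' (\<psi> \<circ> a') (\<psi> \<circ> a)"
    using hull_homotopic_comp_left[OF hull_map_unique[OF *(1,4) a' a continuous_map_id] *(6)] .
  ultimately show ?thesis using h hull_homotopic_trans[OF *(1)] by blast
qed

lemma fsh_rel_same_hulls: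
  fixes X Y :: "'u topology"
  assumes "AR_hull X m" "AR_hull Y n" "hull_approaching X m Y n \<phi>" "hull_approaching X m Y n \<psi>"
  shows "((m, n, \<phi>), (m, n, \<psi>)) \<in> fsh_rel X Y \<longleftrightarrow> hull_homotopic X m Y n \<phi> \<psi>"
proof
  assume "((m, n, \<phi>), (m, n, \<psi>)) \<in> fsh_rel X Y"
  from fsh_rel_any[OF this hull_map_id[OF assms(1)] hull_map_id[OF assms(2)]]
  show "hull_homotopic X m Y n \<phi> \<psi>" by simp
next
  assume "hull_homotopic X m Y n \<phi> \<psi>"
  then have "hull_homotopic X m Y n (id \<circ> \<phi>) (\<psi> \<circ> id)" by simp
  with assms show "((m, n, \<phi>), (m, n, \<psi>)) \<in> fsh_rel X Y"
    using hull_map_id[OF assms(1)] hull_map_id[OF assms(2)] unfolding fsh_rel_iff fsh_reps_iff by blast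
qed

lemma fsh_rel_sym:
  fixes X Y :: "'u topology"
  assumes r: "(\<rho>, \<sigma>) \<in> fsh_rel X Y"
  shows "(\<sigma>, \<rho>) \<in> fsh_rel X Y"
proof -
  obtain m n \<phi> m' n' \<psi> where rs: "\<rho> = (m, n, \<phi>)" "\<sigma> = (m', n', \<psi>)" by (cases \<rho>; cases \<sigma>) blast
  from r obtain a b where *: "AR_hull X m" "AR_hull Y n" "hull_approaching X m Y n \<phi>"
    "AR_hull X m'" "AR_hull Y n'" "hull_approaching X m' Y n' \<psi>"
    and a: "hull_map X m X m' id a" and b: "hull_map Y n Y n' id b"
    and h: "hull_homotopic X m Y n' (b \<circ> \<phi>) (\<psi> \<circ> a)"
    by (auto simp: fsh_rel_iff fsh_reps_iff rs)
  from hull_map_id_exists[OF *(4,1)] obtain a' where a': "hull_map X m' X m id a'" .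
  from hull_map_id_exists[OF *(5,2)] obtain b' where b': "hull_map Y n' Y n id b'" .
  note ap = a'[THEN hull_map_approaching] b'[THEN hull_map_approaching]
    a[THEN hull_map_approaching] b[THEN hull_map_approaching]
  have "hull_homotopic X m' Y n' (\<psi> \<circ> (a \<circ> a')) (\<psi> \<circ> id)"
    by (rule hull_homotopic_comp_left[OF hull_map_inverse[OF *(4,1) a' a] *(6)])
  then have "hull_homotopic X m' Y n (b' \<circ> (\<psi> \<circ> (a \<circ> a'))) (b' \<circ> (\<psi> \<circ> id))"
    by (rule hull_homotopic_comp_left[OF _ ap(2)])
  then have 1: "hull_homotopic X m' Y n (b' \<circ> \<psi>) (b' \<circ> ((\<psi> \<circ> a) \<circ> a'))"
    using hull_homotopic_sym[OF *(4)] by (simp add: o_assoc)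
  have "hull_homotopic X m' Y n' ((b \<circ> \<phi>) \<circ> a') ((\<psi> \<circ> a) \<circ> a')"
    by (rule hull_homotopic_comp_right[OF *(4) h ap(1)])
  then have 2: "hull_homotopic X m' Y n (b' \<circ> ((\<psi> \<circ> a) \<circ> a')) (b' \<circ> ((b \<circ> \<phi>) \<circ> a'))"
    using hull_homotopic_comp_left[OF _ ap(2)] hull_homotopic_sym[OF *(4)] by blast
  have "hull_homotopic X m' Y n ((b' \<circ> b) \<circ> (\<phi> \<circ> a')) (id \<circ> (\<phi> \<circ> a'))"
    by (rule hull_homotopic_comp_right[OF *(4) hull_map_inverse[OF *(2,5) b b']])
      (rule hull_approaching_compose[OF ap(1) *(3)])
  then have 3: "hull_homotopic X m' Y n (b' \<circ> ((b \<circ> \<phi>) \<circ> a')) (\<phi> \<circ> a')" by (simp add: o_assoc)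
  have "hull_homotopic X m' Y n (b' \<circ> \<psi>) (\<phi> \<circ> a')"
    using hull_homotopic_trans[OF *(4)] 1 2 3 by metis
  with * a' b' show ?thesis by (auto simp: fsh_rel_iff fsh_reps_iff rs)
qed

lemma fsh_rel_trans:
  fixes X Y :: "'u topology"
  assumes "(\<rho>, \<sigma>) \<in> fsh_rel X Y" "(\<sigma>, \<tau>) \<in> fsh_rel X Y"
  shows "(\<rho>, \<tau>) \<in> fsh_rel X Y"
proof -
  obtain m n \<phi> m' n' \<psi> m'' n'' \<theta> where rs: "\<rho> = (m, n, \<phi>)" "\<sigma> = (m', n', \<psi>)" "\<tau> = (m'', n'', \<theta>)"
    by (cases \<rho>; cases \<sigma>; cases \<tau>) blast
  from assms(1) obtain a b where *: "AR_hull X m" "AR_hull Y n" "hull_approaching X m Y n \<phi>"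
    "AR_hull X m'" "AR_hull Y n'" "hull_approaching X m' Y n' \<psi>"
    and a: "hull_map X m X m' id a" and b: "hull_map Y n Y n' id b"
    and h: "hull_homotopic X m Y n' (b \<circ> \<phi>) (\<psi> \<circ> a)"
    by (auto simp: fsh_rel_iff fsh_reps_iff rs)
  from assms(2) obtain a' b' where **: "AR_hull X m''" "AR_hull Y n''" "hull_approaching X m'' Y n'' \<theta>"
    and a': "hull_map X m' X m'' id a'" and b': "hull_map Y n' Y n'' id b'"
    and h': "hull_homotopic X m' Y n'' (b' \<circ> \<psi>) (\<theta> \<circ> a')"
    by (auto simp: fsh_rel_iff fsh_reps_iff rs)
  have "hull_homotopic X m Y n'' (b' \<circ> (b \<circ> \<phi>)) (b' \<circ> (\<psi> \<circ> a))"
    by (rule hull_homotopic_comp_left[OF h hull_map_approaching[OF b']])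
  moreover have "hull_homotopic X m Y n'' ((b' \<circ> \<psi>) \<circ> a) ((\<theta> \<circ> a') \<circ> a)"
    by (rule hull_homotopic_comp_right[OF *(1) h' hull_map_approaching[OF a]])
  ultimately have "hull_homotopic X m Y n'' ((b' \<circ> b) \<circ> \<phi>) (\<theta> \<circ> (a' \<circ> a))"
    using hull_homotopic_trans[OF *(1)] by (metis o_assoc)
  moreover have "hull_map X m X m'' id (a' \<circ> a)" "hull_map Y n Y n'' id (b' \<circ> b)"
    using hull_map_compose[OF a a'] hull_map_compose[OF b b'] by simp_all
  ultimately show ?thesis using * ** by (auto simp: fsh_rel_iff fsh_reps_iff rs)
qed

lemma equiv_fsh_rel: "equiv (fsh_reps X Y) (fsh_rel (X :: 'u topology) Y)"
proof (rule equivI)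
  show "fsh_rel X Y \<subseteq> fsh_reps X Y \<times> fsh_reps X Y" by (auto simp: fsh_rel_def)
  show "refl_on (fsh_reps X Y) (fsh_rel X Y)"
  proof (rule refl_onI)
    fix \<rho> assume r: "\<rho> \<in> fsh_reps X Y"
    obtain m n \<phi> where rs: "\<rho> = (m, n, \<phi>)" by (cases \<rho>) blast
    show "(\<rho>, \<rho>) \<in> fsh_rel X Y"
      using r unfolding rs fsh_reps_iff by (auto simp: fsh_rel_same_hulls hull_homotopic_refl)
  qed
  show "sym (fsh_rel X Y)" by (rule symI) (rule fsh_rel_sym)
  show "trans (fsh_rel X Y)" by (rule transI) (rule fsh_rel_trans)
qed

lemma fsh_class_eq_iff:
  fixes X Y :: "'u topology"
  assumes "AR_hull X m" "AR_hull Y n" "hull_approaching X m Y n \<phi>" "hull_approaching X m Y n \<psi>"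
  shows "fsh_class X Y (m, n, \<phi>) = fsh_class X Y (m, n, \<psi>) \<longleftrightarrow> hull_homotopic X m Y n \<phi> \<psi>"
  unfolding fsh_class_def
  using eq_equiv_class_iff[OF equiv_fsh_rel, of "(m, n, \<phi>)" X Y "(m, n, \<psi>)"] assms
  by (simp add: fsh_reps_iff fsh_rel_same_hulls)

lemma fsh_class_in_Hom:
  "\<lbrakk>AR_hull X m; AR_hull Y n; hull_approaching X m Y n \<phi>\<rbrakk> \<Longrightarrow> fsh_class X Y (m, n, \<phi>) \<in> Hom fSh X Y"
  by (auto simp: fSh_def fsh_class_def fsh_reps_iff intro: quotientI)

lemma fsh_Hom_representative:
  fixes X Y :: "'u topology"
  assumes \<alpha>: "\<alpha> \<in> Hom fSh X Y" and m: "AR_hull X m" and n: "AR_hull Y n"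
  obtains \<phi> where "hull_approaching X m Y n \<phi>" "\<alpha> = fsh_class X Y (m, n, \<phi>)"
proof -
  from \<alpha> obtain m' n' \<psi> where *: "(m', n', \<psi>) \<in> fsh_reps X Y" and \<alpha>': "\<alpha> = fsh_class X Y (m', n', \<psi>)"
    by (auto simp: fSh_def fsh_class_def quotient_def)
  then have m': "AR_hull X m'" and n': "AR_hull Y n'" and p: "hull_approaching X m' Y n' \<psi>"
    by (auto simp: fsh_reps_iff)
  from hull_map_id_exists[OF m m'] obtain a where a: "hull_map X m X m' id a" .
  from hull_map_id_exists[OF n n'] obtain b where b: "hull_map Y n Y n' id b" .
  from hull_map_id_exists[OF n' n] obtain b' where b': "hull_map Y n' Y n id b'" .
  note ap = a[THEN hull_map_approaching] b[THEN hull_map_approaching] b'[THEN hull_map_approaching]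
  have phi: "hull_approaching X m Y n (b' \<circ> (\<psi> \<circ> a))"
    using hull_approaching_compose ap p by blast
  have "hull_homotopic X m Y n' ((b \<circ> b') \<circ> (\<psi> \<circ> a)) (id \<circ> (\<psi> \<circ> a))"
    by (rule hull_homotopic_comp_right[OF m hull_map_inverse[OF n' n b' b]])
      (rule hull_approaching_compose[OF ap(1) p])
  then have "((m, n, b' \<circ> (\<psi> \<circ> a)), (m', n', \<psi>)) \<in> fsh_rel X Y"
    using m n m' n' p phi a b by (auto simp: fsh_rel_iff fsh_reps_iff o_assoc)
  then have "fsh_class X Y (m, n, b' \<circ> (\<psi> \<circ> a)) = \<alpha>"
    unfolding \<alpha>' fsh_class_def by (rule equiv_class_eq[OF equiv_fsh_rel])
  with phi show thesis using that by blast
qed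

lemma fsh_Compose_class:
  fixes X Y Z :: "'u topology"
  assumes m: "AR_hull X m" and n: "AR_hull Y n" and p: "AR_hull Z p"
    and \<phi>: "hull_approaching X m Y n \<phi>" and \<psi>: "hull_approaching Y n Z p \<psi>"
  shows "Compose fSh X Y Z (fsh_class Y Z (n, p, \<psi>)) (fsh_class X Y (m, n, \<phi>)) = fsh_class X Z (m, p, \<psi> \<circ> \<phi>)"
    (is "?L = ?R")
proof -
  have comp: "hull_approaching X m Z p (\<psi> \<circ> \<phi>)" by (rule hull_approaching_compose[OF \<phi> \<psi>])
  have self: "((m, n, \<phi>), (m, n, \<phi>)) \<in> fsh_rel X Y" "((n, p, \<psi>), (n, p, \<psi>)) \<in> fsh_rel Y Z"
    using m n p \<phi> \<psi> by (auto simp: fsh_rel_same_hulls hull_homotopic_refl)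
  have key: "((m', p', \<psi>' \<circ> \<phi>'), (m, p, \<psi> \<circ> \<phi>)) \<in> fsh_rel X Z"
    if 1: "((m, n, \<phi>), (m', n', \<phi>')) \<in> fsh_rel X Y" and 2: "((n, p, \<psi>), (n', p', \<psi>')) \<in> fsh_rel Y Z"
    for m' n' p' \<phi>' \<psi>'
  proof -
    from 1 obtain a b where a: "hull_map X m X m' id a" and b: "hull_map Y n Y n' id b"
      and h: "hull_homotopic X m Y n' (b \<circ> \<phi>) (\<phi>' \<circ> a)" and m': "AR_hull X m'" and \<phi>': "hull_approaching X m' Y n' \<phi>'"
      by (auto simp: fsh_rel_iff fsh_reps_iff)
    from 2 have p': "AR_hull Z p'" and \<psi>': "hull_approaching Y n' Z p' \<psi>'" by (auto simp: fsh_rel_iff fsh_reps_iff)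
    from hull_map_id_exists[OF p p'] obtain c where c: "hull_map Z p Z p' id c" .
    have h2: "hull_homotopic Y n Z p' (c \<circ> \<psi>) (\<psi>' \<circ> b)" by (rule fsh_rel_any[OF 2 b c])
    have "hull_homotopic X m Z p' ((c \<circ> \<psi>) \<circ> \<phi>) ((\<psi>' \<circ> b) \<circ> \<phi>)"
      by (rule hull_homotopic_comp_right[OF m h2 \<phi>])
    moreover have "hull_homotopic X m Z p' (\<psi>' \<circ> (b \<circ> \<phi>)) (\<psi>' \<circ> (\<phi>' \<circ> a))"
      by (rule hull_homotopic_comp_left[OF h \<psi>'])
    ultimately have "hull_homotopic X m Z p' (c \<circ> (\<psi> \<circ> \<phi>)) ((\<psi>' \<circ> \<phi>') \<circ> a)"
      using hull_homotopic_trans[OF m] by (metis o_assoc)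
    then have "((m, p, \<psi> \<circ> \<phi>), (m', p', \<psi>' \<circ> \<phi>')) \<in> fsh_rel X Z"
      using m p m' p' comp hull_approaching_compose[OF \<phi>' \<psi>'] a c by (auto simp: fsh_rel_iff fsh_reps_iff)
    then show ?thesis by (rule fsh_rel_sym)
  qed
  show ?thesis
  proof
    show "?L \<subseteq> ?R"
      using key fsh_rel_trans[OF fsh_rel_sym[OF key]] by (auto simp: fSh_def fsh_class_def)
    show "?R \<subseteq> ?L"
    proof
      fix \<rho> assume "\<rho> \<in> ?R"
      with self have "(m, n, \<phi>) \<in> fsh_class X Y (m, n, \<phi>) \<and> (n, p, \<psi>) \<in> fsh_class Y Z (n, p, \<psi>) \<and>
        ((m, p, \<psi> \<circ> \<phi>), \<rho>) \<in> fsh_rel X Z" by (simp add: fsh_class_def)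
      then show "\<rho> \<in> ?L" unfolding fSh_def cat.simps by blast
    qed
  qed
qed

lemma induced_fsh_class_eq:
  fixes X Y :: "'u topology"
  assumes m: "AR_hull X m" and n: "AR_hull Y n" and f: "continuous_map X Y f" and g: "hull_map X m Y n f g"
  shows "induced_fsh_class X Y f = fsh_class X Y (m, n, g)"
proof
  show "fsh_class X Y (m, n, g) \<subseteq> induced_fsh_class X Y f"
    unfolding induced_fsh_class_def fsh_class_def using m n g by blast
  show "induced_fsh_class X Y f \<subseteq> fsh_class X Y (m, n, g)"
  proof
    fix \<rho> assume "\<rho> \<in> induced_fsh_class X Y f"
    then obtain m' n' g' where m': "AR_hull X m'" and n': "AR_hull Y n'" and g': "hull_map X m' Y n' f g'"
      and r: "((m', n', g'), \<rho>) \<in> fsh_rel X Y"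
      by (auto simp: induced_fsh_class_def)
    from hull_map_id_exists[OF m m'] obtain a where a: "hull_map X m X m' id a" .
    from hull_map_id_exists[OF n n'] obtain b where b: "hull_map Y n Y n' id b" .
    have "f \<in> topspace X \<rightarrow> topspace Y" using f by (simp add: continuous_map_def)
    from hull_map_compose[OF g b this] hull_map_compose[OF a g']
    have "hull_map X m Y n' f (b \<circ> g)" "hull_map X m Y n' f (g' \<circ> a)" by simp_all
    from hull_map_unique[OF m n' this f] have "((m, n, g), (m', n', g')) \<in> fsh_rel X Y"
      using m n m' n' a b hull_map_approaching[OF g] hull_map_approaching[OF g']
      by (auto simp: fsh_rel_iff fsh_reps_iff)
    from fsh_rel_trans[OF this r] show "\<rho> \<in> fsh_class X Y (m, n, g)" by (simp add: fsh_class_def)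
  qed
qed

lemma Ident_fSh_class: "AR_hull (X :: 'u topology) m \<Longrightarrow> Ident fSh X = fsh_class X X (m, m, id)"
  unfolding Ident_fSh by (rule induced_fsh_class_eq) (auto simp: hull_map_id)

lemma hull_approaching_id: "AR_hull X m \<Longrightarrow> hull_approaching X m X m id"
  by (rule hull_map_approaching[OF hull_map_id])

lemma category_fSh: "category (fSh :: ('u topology, 'u fsh_rep set) cat)"
proof
  fix X :: "'u topology" assume "X \<in> Obj fSh"
  then obtain m where m: "AR_hull X m" using AR_hull_exists[OF u] by (auto simp: Obj_fSh)
  show "Ident fSh X \<in> Hom fSh X X"
    unfolding Ident_fSh_class[OF m] by (intro fsh_class_in_Hom m hull_approaching_id)
next
  fix X Y Z :: "'u topology" and f g
  assume "X \<in> Obj fSh" "Y \<in> Obj fSh" "Z \<in> Obj fSh"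
  then obtain m n p where h: "AR_hull X m" "AR_hull Y n" "AR_hull Z p"
    using AR_hull_exists[OF u] unfolding Obj_fSh by (metis mem_Collect_eq)
  assume fg: "f \<in> Hom fSh X Y" "g \<in> Hom fSh Y Z"
  from fsh_Hom_representative[OF fg(1) h(1,2)] obtain \<phi>
    where \<phi>: "hull_approaching X m Y n \<phi>" "f = fsh_class X Y (m, n, \<phi>)" .
  from fsh_Hom_representative[OF fg(2) h(2,3)] obtain \<psi>
    where \<psi>: "hull_approaching Y n Z p \<psi>" "g = fsh_class Y Z (n, p, \<psi>)" .
  show "Compose fSh X Y Z g f \<in> Hom fSh X Z"
    unfolding \<phi> \<psi> fsh_Compose_class[OF h \<phi>(1) \<psi>(1)]
    by (intro fsh_class_in_Hom h hull_approaching_compose[OF \<phi>(1) \<psi>(1)])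
next
  fix X Y :: "'u topology" and f
  assume "X \<in> Obj fSh" "Y \<in> Obj fSh"
  then obtain m n where h: "AR_hull X m" "AR_hull Y n"
    using AR_hull_exists[OF u] unfolding Obj_fSh by (metis mem_Collect_eq)
  assume f: "f \<in> Hom fSh X Y"
  from fsh_Hom_representative[OF f h] obtain \<phi>
    where \<phi>: "hull_approaching X m Y n \<phi>" "f = fsh_class X Y (m, n, \<phi>)" .
  show "Compose fSh X X Y f (Ident fSh X) = f"
    unfolding \<phi> Ident_fSh_class[OF h(1)]
    using fsh_Compose_class[OF h(1) h hull_approaching_id[OF h(1)] \<phi>(1)] by simp
  show "Compose fSh X Y Y (Ident fSh Y) f = f"
    unfolding \<phi> Ident_fSh_class[OF h(2)]
    using fsh_Compose_class[OF h h(2) \<phi>(1) hull_approaching_id[OF h(2)]] by simp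
next
  fix W X Y Z :: "'u topology" and f g k
  assume "W \<in> Obj fSh" "X \<in> Obj fSh" "Y \<in> Obj fSh" "Z \<in> Obj fSh"
  then obtain l m n p where h: "AR_hull W l" "AR_hull X m" "AR_hull Y n" "AR_hull Z p"
    using AR_hull_exists[OF u] unfolding Obj_fSh by (metis mem_Collect_eq)
  assume fg: "f \<in> Hom fSh W X" "g \<in> Hom fSh X Y" "k \<in> Hom fSh Y Z"
  from fsh_Hom_representative[OF fg(1) h(1,2)] obtain \<phi>
    where \<phi>: "hull_approaching W l X m \<phi>" "f = fsh_class W X (l, m, \<phi>)" .
  from fsh_Hom_representative[OF fg(2) h(2,3)] obtain \<psi>
    where \<psi>: "hull_approaching X m Y n \<psi>" "g = fsh_class X Y (m, n, \<psi>)" .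
  from fsh_Hom_representative[OF fg(3) h(3,4)] obtain \<theta>
    where \<theta>: "hull_approaching Y n Z p \<theta>" "k = fsh_class Y Z (n, p, \<theta>)" .
  note c = hull_approaching_compose[OF \<phi>(1) \<psi>(1)] hull_approaching_compose[OF \<psi>(1) \<theta>(1)]
  show "Compose fSh W Y Z k (Compose fSh W X Y g f) = Compose fSh W X Z (Compose fSh X Y Z k g) f"
    unfolding \<phi>(2) \<psi>(2) \<theta>(2)
    by (simp add: fsh_Compose_class[OF h(1,2,3) \<phi>(1) \<psi>(1)] fsh_Compose_class[OF h(2,3,4) \<psi>(1) \<theta>(1)]
      fsh_Compose_class[OF h(1,3,4) c(1) \<theta>(1)] fsh_Compose_class[OF h(1,2,4) \<phi>(1) c(2)] o_assoc)
qed

lemma fsh_functor_class: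
  fixes X Y :: "'u topology"
  assumes X: "metrizable_space X" and Y: "metrizable_space Y" and f: "continuous_map X Y f"
  shows "fsh_functor X Y (homotopy_class X Y f) = induced_fsh_class X Y f"
proof -
  have "f \<in> homotopy_class X Y f" using f by (simp add: homotopy_class_def)
  then have "(SOME g. g \<in> homotopy_class X Y f) \<in> homotopy_class X Y f" by (rule someI[of "\<lambda>g. g \<in> homotopy_class X Y f"])
  then obtain f' where f': "(SOME g. g \<in> homotopy_class X Y f) = f'" and h: "homotopic_with (\<lambda>_. True) X Y f f'"
    by (simp add: homotopy_class_def)
  then have c: "continuous_map X Y f'" using homotopic_with_imp_continuous_maps by blast
  obtain m n where mn: "AR_hull X m" "AR_hull Y n" using AR_hull_exists[OF u X] AR_hull_exists[OF u Y] by metis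
  from hull_map_exists[OF mn f] obtain g where g: "hull_map X m Y n f g" .
  from hull_map_exists[OF mn c] obtain g' where g': "hull_map X m Y n f' g'" .
  have "fsh_class X Y (m, n, g) = fsh_class X Y (m, n, g')"
    using hull_map_homotopic[OF u mn g g' h] hull_map_approaching[OF g] hull_map_approaching[OF g'] mn
    by (simp add: fsh_class_eq_iff)
  then show ?thesis
    by (simp add: fsh_functor_def f' induced_fsh_class_eq[OF mn f g] induced_fsh_class_eq[OF mn c g'])
qed

lemma induced_fsh_class_compose:
  fixes X Y Z :: "'u topology"
  assumes X: "metrizable_space X" and Y: "metrizable_space Y" and Z: "metrizable_space Z"
    and f: "continuous_map X Y f" and g: "continuous_map Y Z g"
  shows "induced_fsh_class X Z (g \<circ> f) = Compose fSh X Y Z (induced_fsh_class Y Z g) (induced_fsh_class X Y f)"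
proof -
  obtain m n p where h: "AR_hull X m" "AR_hull Y n" "AR_hull Z p" using AR_hull_exists[OF u X] AR_hull_exists[OF u Y] AR_hull_exists[OF u Z] by metis
  from hull_map_exists[OF h(1,2) f] obtain k where k: "hull_map X m Y n f k" .
  from hull_map_exists[OF h(2,3) g] obtain l where l: "hull_map Y n Z p g l" .
  have kl: "hull_map X m Z p (g \<circ> f) (l \<circ> k)"
    by (rule hull_map_compose[OF k l]) (use f in \<open>simp add: continuous_map_def\<close>)
  show ?thesis
    using fsh_Compose_class[OF h hull_map_approaching[OF k] hull_map_approaching[OF l]]
    by (simp add: induced_fsh_class_eq[OF h(1,2) f k] induced_fsh_class_eq[OF h(2,3) g l]
      induced_fsh_class_eq[OF h(1,3) continuous_map_compose[OF f g] kl])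
qed

lemma induced_fsh_class_in_Hom:
  fixes X Y :: "'u topology"
  assumes "metrizable_space X" "metrizable_space Y" "continuous_map X Y f"
  shows "induced_fsh_class X Y f \<in> Hom fSh X Y"
proof -
  obtain m n where h: "AR_hull X m" "AR_hull Y n" using AR_hull_exists[OF u assms(1)] AR_hull_exists[OF u assms(2)] by metis
  from hull_map_exists[OF h assms(3)] obtain k where k: "hull_map X m Y n f k" .
  show ?thesis
    unfolding induced_fsh_class_eq[OF h assms(3) k] by (intro fsh_class_in_Hom h hull_map_approaching[OF k])
qed

end

section \<open>FDR-embeddings are the closed embeddings inducing isomorphisms\<close>

lemma fsh_isomorphismI:
  fixes X Y :: "'u topology"
  assumes u: "(UNIV :: real set) \<lesssim> (UNIV :: 'u set)"
    and m: "AR_hull X m" and n: "AR_hull Y n"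
    and \<phi>: "hull_approaching X m Y n \<phi>" and \<psi>: "hull_approaching Y n X m \<psi>"
    and "hull_homotopic X m X m (\<psi> \<circ> \<phi>) id" "hull_homotopic Y n Y n (\<phi> \<circ> \<psi>) id"
  shows "isomorphism_in fSh X Y (fsh_class X Y (m, n, \<phi>))"
  unfolding isomorphism_in_def
proof (intro conjI bexI)
  show "fsh_class X Y (m, n, \<phi>) \<in> Hom fSh X Y" "fsh_class Y X (n, m, \<psi>) \<in> Hom fSh Y X"
    using m n \<phi> \<psi> by (auto intro: fsh_class_in_Hom[OF u])
  show "Compose fSh X Y X (fsh_class Y X (n, m, \<psi>)) (fsh_class X Y (m, n, \<phi>)) = Ident fSh X"
    using assms hull_approaching_compose[OF \<phi> \<psi>] hull_approaching_id[OF u m]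
    by (simp add: fsh_Compose_class[OF u] Ident_fSh_class[OF u] fsh_class_eq_iff[OF u])
  show "Compose fSh Y X Y (fsh_class X Y (m, n, \<phi>)) (fsh_class Y X (n, m, \<psi>)) = Ident fSh Y"
    using assms hull_approaching_compose[OF \<psi> \<phi>] hull_approaching_id[OF u n]
    by (simp add: fsh_Compose_class[OF u] Ident_fSh_class[OF u] fsh_class_eq_iff[OF u])
qed

lemma fsh_isomorphismE:
  fixes X Y :: "'u topology"
  assumes u: "(UNIV :: real set) \<lesssim> (UNIV :: 'u set)"
    and m: "AR_hull X m" and n: "AR_hull Y n" and \<phi>: "hull_approaching X m Y n \<phi>"
    and iso: "isomorphism_in fSh X Y (fsh_class X Y (m, n, \<phi>))"
  obtains \<psi> where "hull_approaching Y n X m \<psi>" "hull_homotopic X m X m (\<psi> \<circ> \<phi>) id"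
    "hull_homotopic Y n Y n (\<phi> \<circ> \<psi>) id"
proof -
  from iso obtain g where g: "g \<in> Hom fSh Y X"
    and c: "Compose fSh X Y X g (fsh_class X Y (m, n, \<phi>)) = Ident fSh X"
      "Compose fSh Y X Y (fsh_class X Y (m, n, \<phi>)) g = Ident fSh Y"
    by (auto simp: isomorphism_in_def)
  from fsh_Hom_representative[OF u g n m] obtain \<psi>
    where \<psi>: "hull_approaching Y n X m \<psi>" "g = fsh_class Y X (n, m, \<psi>)" .
  show thesis
  proof (rule that[OF \<psi>(1)])
    show "hull_homotopic X m X m (\<psi> \<circ> \<phi>) id"
      using c(1) hull_approaching_compose[OF \<phi> \<psi>(1)] hull_approaching_id[OF u m]
      by (simp add: \<psi>(2) fsh_Compose_class[OF u m n m \<phi> \<psi>(1)] Ident_fSh_class[OF u m] fsh_class_eq_iff[OF u m m])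
    show "hull_homotopic Y n Y n (\<phi> \<circ> \<psi>) id"
      using c(2) hull_approaching_compose[OF \<psi>(1) \<phi>] hull_approaching_id[OF u n]
      by (simp add: \<psi>(2) fsh_Compose_class[OF u n m n \<psi>(1) \<phi>] Ident_fSh_class[OF u n] fsh_class_eq_iff[OF u n n])
  qed
qed

lemma FDR_embedding_isomorphism:
  fixes X Y :: "'u topology"
  assumes u: "(UNIV :: real set) \<lesssim> (UNIV :: 'u set)" and i: "FDR_embedding X Y i"
  shows "isomorphism_in fSh X Y (induced_fsh_class X Y i)"
proof -
  have ce: "closed_embedding X Y i" using i by (simp add: FDR_embedding_def)
  then have ci: "continuous_map X Y i"
    using embedding_map_continuous by (auto simp: closed_embedding_def)
  from i obtain M e L \<Phi> where n: "AR_hull Y (M, e)" and L: "closedin M L" and ARL: "AR_space (subtopology M L)"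
    and LA: "L \<inter> e ` topspace Y = e ` i ` topspace X"
    and neg: "homotopy_negligible (subtopology M L) (e ` i ` topspace X)"
    and \<Phi>: "approaching_map (prod_topology M unit_interval) (e ` topspace Y \<times> {0..1}) M (e ` topspace Y) \<Phi>"
    and \<Phi>0: "\<forall>x\<in>topspace M - e ` topspace Y. \<Phi> (x, 0) = x"
    and \<Phi>1: "(\<lambda>x. \<Phi> (x, 1)) ` (topspace M - e ` topspace Y) = L - e ` i ` topspace X"
    and \<Phi>L: "\<forall>x\<in>L - e ` i ` topspace X. \<forall>t\<in>{0..1}. \<Phi> (x, t) = x"
    unfolding FDR_embedding_def FDR_inclusion_def by (elim conjE exE) (rule that)
  have LM: "L \<subseteq> topspace M" by (rule closedin_subset[OF L])
  let ?l = "(subtopology M L, e \<circ> i)" and ?n = "(M, e)"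
  have "embedding_map X M (e \<circ> i)"
    using ce AR_hullD(3)[OF n] embedding_map_compose by (auto simp: closed_embedding_def)
  then have "embedding_map X (subtopology M L) (e \<circ> i)"
    using LA by (auto simp: embedding_map_in_subtopology)
  with ARL neg have l: "AR_hull X ?l" by (simp add: AR_hull_def image_comp)
  have hm: "hull_map X ?l Y ?n i id"
    unfolding hull_map_iff
  proof (intro conjI)
    show "continuous_map (fst ?l) (fst ?n) id" by (simp add: continuous_map_from_subtopology)
    show "{x \<in> topspace (fst ?l). id x \<in> snd ?n ` topspace Y} = snd ?l ` topspace X"
      using LA LM by (auto simp: image_comp)
  qed simp
  define \<rho> where "\<rho> x = \<Phi> (x, 1)" for x
  have "approaching_map M (e ` topspace Y) M (e ` topspace Y) \<rho>"
    unfolding \<rho>_def by (rule approaching_map_slice[OF \<Phi>]) simp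
  then have "approaching_map M (e ` topspace Y) (subtopology M L) (e ` topspace Y) \<rho>"
    by (rule approaching_map_into_subspace[OF _ L]) (use \<Phi>1 in \<open>auto simp: \<rho>_def\<close>)
  then have "approaching_map M (e ` topspace Y) (subtopology M L) (e ` i ` topspace X) \<rho>"
    by (rule approaching_map_sets_cong) (use LA LM in auto)
  then have \<rho>: "hull_approaching Y ?n X ?l \<rho>" by (simp add: hull_approaching_def image_comp)
  have "approaching_homotopic M (e ` topspace Y) M (e ` topspace Y) id \<rho>"
    by (rule approaching_homotopicI[OF \<Phi>]) (auto simp: \<Phi>0 \<rho>_def)
  then have 1: "hull_homotopic Y ?n Y ?n (id \<circ> \<rho>) id"
    using hull_homotopic_sym[OF n, of Y ?n id \<rho>] by (simp add: hull_homotopic_def)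
  have "\<rho> x = x" if "x \<in> L - e ` i ` topspace X" for x using \<Phi>L that by (simp add: \<rho>_def)
  then have "hull_homotopic X ?l X ?l id \<rho>"
    using hull_approaching_id[OF u l] unfolding hull_homotopic_def hull_approaching_def
    by (intro approaching_homotopic_refl) (auto simp: image_comp)
  then have 2: "hull_homotopic X ?l X ?l (\<rho> \<circ> id) id"
    using hull_homotopic_sym[OF l] by simp
  show ?thesis
    unfolding induced_fsh_class_eq[OF u l n ci hm]
    by (rule fsh_isomorphismI[OF u l n hull_map_approaching[OF hm] \<rho> 2 1])
qed

text \<open>
  A deformation of pairs \<open>(M \<setminus> X, L \<setminus> A) \<rightarrow> (L \<setminus> A, L \<setminus> A)\<close> is made stationary on \<open>L \<setminus> A\<close>. The
  homotopy extension property is replaced by the homotopy \<open>k\<close>, which pulls a neighbourhood of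
  \<open>L \<setminus> A\<close> into \<open>L\<close> and is the identity near \<open>X \<setminus> A\<close>, so that it does not affect convergence to
  \<open>X\<close>; the cut-off \<open>f\<close> cannot be extended continuously over \<open>A\<close>.
\<close>

lemma strong_deformation:
  fixes M :: "'u topology"
  assumes u: "(UNIV :: real set) \<lesssim> (UNIV :: 'u set)"
    and M: "abs_extensor TYPE('u) M" and X: "homotopy_negligible M X"
    and L: "closedin M L" and EL: "abs_extensor TYPE('u) (subtopology M L)"
    and A: "L \<inter> X = A" and nA: "homotopy_negligible (subtopology M L) A"
    and \<rho>: "approaching_map M X (subtopology M L) A \<rho>"
    and hL: "approaching_homotopic (subtopology M L) A (subtopology M L) A \<rho> id"
    and hM: "approaching_homotopic M X M X \<rho> id"
  obtains \<Phi> where "approaching_map (prod_topology M unit_interval) (X \<times> {0..1}) M X \<Phi>"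
    "\<And>x. x \<in> topspace M - X \<Longrightarrow> \<Phi> (x, 0) = x"
    "(\<lambda>x. \<Phi> (x, 1)) ` (topspace M - X) = L - A"
    "\<And>x t. \<lbrakk>x \<in> L - A; t \<in> {0..1}\<rbrakk> \<Longrightarrow> \<Phi> (x, t) = x"
proof -
  let ?W = "prod_topology M unit_interval" and ?L = "subtopology M L" and ?XI = "X \<times> {0..1::real}"
  have metM: "metrizable_space M" by (rule abs_extensor_metrizable[OF M])
  note metW = metrizable_prod_unit_interval[OF metM]
  have LM: "L \<subseteq> topspace M" by (rule closedin_subset[OF L])
  have cX: "closedin M X" using X by (simp add: homotopy_negligible_def)
  have cA: "closedin M A" using L cX A by (metis closedin_Int)
  have XM: "X \<subseteq> topspace M" by (rule closedin_subset[OF cX])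
  have idL: "continuous_map (subtopology M L) (subtopology M L) id" by simp
  obtain \<rho>0 where r0: "continuous_map M ?L \<rho>0" "\<And>x. x \<in> L \<Longrightarrow> \<rho>0 x = id x"
    "\<And>x. x \<in> topspace M - L \<Longrightarrow> \<rho>0 x \<in> topspace ?L - A"
    by (rule pushoff_extension[OF EL nA subset_imp_lepoll[OF subset_UNIV] metM L idL]) (rule that)
  then have r0: "continuous_map M ?L \<rho>0" "\<And>x. x \<in> L \<Longrightarrow> \<rho>0 x = x"
    "\<And>x. x \<in> topspace M - L \<Longrightarrow> \<rho>0 x \<in> L - A"
    by auto
  define k0 where "k0 z = (if snd z = 1 then \<rho>0 (fst z) else fst z)" for z :: "'u \<times> real"
  let ?A0 = "topspace M \<times> {0::real}" and ?A1 = "topspace M \<times> {1::real}" and ?B = "L \<times> {0..1::real}"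
  have cl: "closedin ?W ?A0" "closedin ?W ?A1" "closedin ?W ?B"
    using L by (auto intro!: closedin_prod_unit_interval)
  have fstM: "continuous_map (subtopology ?W S) M fst" for S
    by (rule continuous_map_from_subtopology[OF continuous_map_fst])
  have "continuous_map (subtopology ?W ?A0) M k0"
    by (rule continuous_map_eq[OF fstM]) (auto simp: k0_def)
  moreover have "continuous_map (subtopology ?W ?A1) M k0"
    by (rule continuous_map_eq[OF continuous_map_compose[OF fstM continuous_map_into_fulltopology[OF r0(1)]]])
      (auto simp: k0_def)
  moreover have "continuous_map (subtopology ?W ?B) M k0"
    by (rule continuous_map_eq[OF fstM]) (auto simp: k0_def r0(2))
  ultimately have "continuous_map (subtopology ?W (?A0 \<union> ?A1 \<union> ?B)) M k0"
    using cl by (intro continuous_map_Un_closed closedin_Un)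
  moreover have "closedin ?W (?A0 \<union> ?A1 \<union> ?B)" using cl by (intro closedin_Un)
  moreover have "topspace ?W \<lesssim> (UNIV :: 'u set)"
    using lepoll_prod_unit_interval[OF u subset_imp_lepoll[OF subset_UNIV]] by simp
  ultimately obtain h where h: "continuous_map ?W M h" "\<And>z. z \<in> ?A0 \<union> ?A1 \<union> ?B \<Longrightarrow> h z = k0 z"
    "\<And>z. z \<in> topspace ?W - (?A0 \<union> ?A1 \<union> ?B) \<Longrightarrow> h z \<in> topspace M - X"
    using pushoff_extension[OF M X _ metW] by metis
  have h0: "h (x, 0) = x" if "x \<in> topspace M" for x using h(2)[of "(x, 0)"] that by (simp add: k0_def)
  have h1: "h (x, 1) = \<rho>0 x" if "x \<in> topspace M" for x using h(2)[of "(x, 1)"] that by (simp add: k0_def)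
  have hLx: "h (x, t) = x" if "x \<in> L" "t \<in> {0..1}" for x t
    using h(2)[of "(x, t)"] that r0(2) by (simp add: k0_def)
  have r0A: "\<rho>0 x \<in> L - A" if "x \<in> topspace M - A" for x
    using r0(2,3)[of x] that by (cases "x \<in> L") auto
  have hX: "h (x, t) \<in> topspace M - X" if x: "x \<in> topspace M - X" and t: "t \<in> {0..1}" for x t
  proof -
    consider "t = 0" | "t = 1" | "x \<in> L" | "(x, t) \<in> topspace ?W - (?A0 \<union> ?A1 \<union> ?B)"
      using x t by auto
    then show ?thesis
    proof cases
      case 2 then show ?thesis using h1[of x] r0A[of x] x A LM by auto
    qed (use x t h0 hLx h(3) in auto)
  qed
  let ?D = "subtopology M (topspace M - A)"
  have "normal_space ?D"
    using metM metrizable_space_subtopology metrizable_imp_normal_space by blast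
  moreover have "closedin ?D (L - A)" "closedin ?D (X - A)"
    using L cX LM XM by (auto simp: closedin_subtopology)
  moreover have "disjnt (L - A) (X - A)" using A by (auto simp: disjnt_def)
  ultimately obtain f where f: "continuous_map ?D unit_interval f" "f ` (L - A) \<subseteq> {0}" "f ` (X - A) \<subseteq> {1}"
    using Urysohn_lemma[of ?D "L - A" "X - A" 0 1] by auto
  then have fD: "continuous_map ?D euclideanreal f" and f01: "\<And>x. x \<in> topspace M - A \<Longrightarrow> f x \<in> {0..1}"
    by (auto simp: continuous_map_in_subtopology)
  have fL: "f x = 0" if "x \<in> L - A" for x using f(2) that by blast
  have fX: "f x = 1" if "x \<in> X - A" for x using f(3) that by blast
  have AX: "A \<subseteq> X" "A \<subseteq> L" using A by auto
  define w where "w x = max 0 (min 1 (2 - 3 * f x))" for x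
  define v where "v x = min 1 (3 * f x)" for x
  have w01: "w x \<in> {0..1}" for x by (simp add: w_def)
  have v01: "v x \<in> {0..1}" if "x \<in> topspace M - X" for x
    using f01[of x] that AX by (auto simp: v_def)
  have w1: "w x = 1" if "f x \<le> 1/3" for x using that by (simp add: w_def)
  define k where "k z = h (fst z, snd z * w (fst z))" for z
  have kL: "k (x, t) = x" if "x \<in> L - A" "t \<in> {0..1}" for x t
    using that by (simp add: k_def fL w1 hLx)
  have kX: "k (x, t) \<in> topspace M - X" if "x \<in> topspace M - X" "t \<in> {0..1}" for x t
    using hX[OF that(1), of "t * w x"] that(2) w01[of x] by (simp add: k_def mult_le_one)
  have k: "approaching_map ?W ?XI M X k"
  proof (rule approaching_mapI[OF metW])
    show "k z \<in> topspace M - X" if "z \<in> topspace ?W - ?XI" for z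
      using kX[of "fst z" "snd z"] that by (auto simp: mem_Times_iff)
    fix s z assume s: "range s \<subseteq> topspace ?W - ?XI" and lim: "limitin ?W s z sequentially"
    obtain x t where z: "z = (x, t)" by (cases z)
    have xt: "x \<in> topspace M" "t \<in> {0..1}" using lim limitin_topspace z by fastforce+
    have sn: "fst (s n) \<in> topspace M - X" "snd (s n) \<in> {0..1}" for n
    proof -
      have "s n \<in> topspace ?W - ?XI" by (rule subsetD[OF s rangeI])
      then show "fst (s n) \<in> topspace M - X" "snd (s n) \<in> {0..1}" by (auto simp: mem_Times_iff)
    qed
    have l1: "limitin M (\<lambda>n. fst (s n)) x sequentially" and l2: "(\<lambda>n. snd (s n)) \<longlonglongrightarrow> t"
      using lim by (auto simp: z limitin_Pair limitin_subtopology)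
    define \<tau> where "\<tau> n = snd (s n) * w (fst (s n))" for n
    have \<tau>: "\<tau> n \<in> {0..1}" for n using sn(2)[of n] w01[of "fst (s n)"] by (simp add: \<tau>_def mult_le_one)
    then have "range \<tau> \<subseteq> {0..1}" by blast
    from unit_interval_subsequence[OF this]
    obtain r \<sigma> where r: "strict_mono (r :: nat \<Rightarrow> nat)" and \<sigma>: "\<sigma> \<in> {0..1}" "(\<tau> \<circ> r) \<longlonglongrightarrow> \<sigma>" .
    have l1r: "limitin M (\<lambda>n. fst (s (r n))) x sequentially"
      using limitin_subsequence[OF r l1] by (simp add: o_def)
    have "limitin ?W (\<lambda>n. (fst (s (r n)), \<tau> (r n))) (x, \<sigma>) sequentially"
      using l1r \<sigma> \<tau> by (auto simp: limitin_Pair limitin_unit_interval o_def)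
    from continuous_map_sequentiallyD[OF h(1) this]
    have *: "limitin M (\<lambda>n. k (s (r n))) (h (x, \<sigma>)) sequentially" by (simp add: k_def \<tau>_def)
    have "if z \<in> ?XI then h (x, \<sigma>) \<in> X else h (x, \<sigma>) = k z"
    proof (cases "x \<in> A")
      case True
      with AX \<sigma>(1) xt show ?thesis by (auto simp: z hLx)
    next
      case False
      have "limitin ?D (\<lambda>n. fst (s (r n))) x sequentially"
        using l1r sn xt False AX by (auto simp: limitin_subtopology intro!: always_eventually)
      from continuous_map_sequentiallyD[OF fD this] have "(\<lambda>n. f (fst (s (r n)))) \<longlonglongrightarrow> f x" by simp
      then have "(\<lambda>n. w (fst (s (r n)))) \<longlonglongrightarrow> w x" unfolding w_def by (intro tendsto_intros)
      moreover have "(\<lambda>n. snd (s (r n))) \<longlonglongrightarrow> t" using LIMSEQ_subseq_LIMSEQ[OF l2 r] by (simp add: o_def)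
      ultimately have "(\<tau> \<circ> r) \<longlonglongrightarrow> t * w x" by (auto simp: \<tau>_def o_def intro: tendsto_mult)
      with \<sigma>(2) have "\<sigma> = t * w x" by (rule LIMSEQ_unique)
      moreover have "w x = 0" if "x \<in> X" using fX[of x] that False by (simp add: w_def)
      ultimately show ?thesis using h0[OF xt(1)] xt by (auto simp: z k_def)
    qed
    with r * show "\<exists>r y. strict_mono (r :: nat \<Rightarrow> nat) \<and> limitin M (\<lambda>n. k (s (r n))) y sequentially \<and>
        (if z \<in> ?XI then y \<in> X else y = k z)" by blast
  qed
  define k1 where "k1 x = k (x, 1)" for x
  have k1: "approaching_map M X M X k1" unfolding k1_def by (rule approaching_map_slice[OF k]) simp
  have k1L: "k1 x = x" if "x \<in> L - A" for x using kL[OF that] by (simp add: k1_def)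
  have k1in: "k1 x \<in> L - A" if "x \<in> topspace M - X" "f x \<le> 1/3" for x
    using that h1[of x] r0A[of x] AX by (auto simp: k1_def k_def w1)
  have fW: "continuous_map (subtopology ?W S) euclideanreal (\<lambda>z. f (fst z))" if "S \<subseteq> (topspace M - X) \<times> {0..1}" for S
  proof -
    have "continuous_map (subtopology ?W S) ?D fst"
      using fstM that AX by (auto simp: continuous_map_in_subtopology)
    from continuous_map_compose[OF this fD] show ?thesis by (simp add: o_def)
  qed
  have sndW: "continuous_map (subtopology ?W S) euclideanreal snd" for S
    using continuous_map_into_fulltopology[OF continuous_map_snd_unit] .
  have vW: "continuous_map (subtopology ?W S) euclideanreal (\<lambda>z. v (fst z))" if "S \<subseteq> (topspace M - X) \<times> {0..1}" for S
    unfolding v_def by (intro continuous_map_real_min continuous_map_real_mult_left fW[OF that]) simp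
  have time: "continuous_map (subtopology ?W S) unit_interval \<tau>"
    if "S \<subseteq> (topspace M - X) \<times> {0..1}" "continuous_map (subtopology ?W S) euclideanreal \<tau>" "\<And>z. z \<in> S \<Longrightarrow> \<tau> z \<in> {0..1}" for S \<tau>
    using that by (auto simp: continuous_map_in_subtopology)
  from hL obtain G where G: "approaching_map (prod_topology ?L unit_interval) (A \<times> {0..1}) ?L A G"
    "\<And>x. x \<in> topspace ?L - A \<Longrightarrow> G (x, 0) = \<rho> x" "\<And>x. x \<in> topspace ?L - A \<Longrightarrow> G (x, 1) = id x"
    by (rule approaching_homotopicE) blast
  define H where "H z = (if f (fst z) \<le> 1/3 then G (k1 (fst z), (1 - v (fst z)) * (1 - snd z)) else \<rho> (k1 (fst z)))" for z
  define C1 where "C1 = (X \<union> {x \<in> topspace M - X. f x \<le> 1/3}) \<times> {0..1::real}"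
  define C2 where "C2 = (X \<union> {x \<in> topspace M - X. 1/3 \<le> f x}) \<times> {0..1::real}"
  have half: "closedin M (X \<union> {x \<in> topspace M - X. f x \<in> T})" if T: "closed T" for T
  proof -
    have "closedin ?D {x \<in> topspace ?D. f x \<in> T}"
      by (rule closedin_continuous_map_preimage[OF fD]) (use T in simp)
    then obtain E where E: "closedin M E" "{x \<in> topspace ?D. f x \<in> T} = E \<inter> (topspace M - A)"
      by (auto simp: closedin_subtopology)
    then have "X \<union> {x \<in> topspace M - X. f x \<in> T} = X \<union> E"
      using AX closedin_subset[OF E(1)] by auto
    with E(1) cX show ?thesis by auto
  qed
  have cC: "closedin ?W C1" "closedin ?W C2"
    unfolding C1_def C2_def using half[of "{..1/3}"] half[of "{1/3..}"]
    by (auto intro!: closedin_prod_unit_interval)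
  have H: "approaching_map ?W ?XI ?L A H"
  proof (rule approaching_map_glue[OF metW cC])
    show "topspace ?W - ?XI \<subseteq> C1 \<union> C2" by (auto simp: C1_def C2_def)
    have k1W: "approaching_map (subtopology ?W C) ?XI M X (\<lambda>z. k1 (fst z))" for C
      by (rule approaching_map_subspace[OF approaching_map_fst[OF k1]])
    have sub1: "topspace (subtopology ?W C1) - ?XI \<subseteq> (topspace M - X) \<times> {0..1}" by (auto simp: C1_def)
    have "approaching_map (subtopology ?W C1) ?XI ?L X (\<lambda>z. k1 (fst z))"
    proof (rule approaching_map_into_subspace[OF k1W L])
      show "k1 (fst z) \<in> L" if "z \<in> topspace (subtopology ?W C1) - ?XI" for z
        using k1in[of "fst z"] that by (auto simp: C1_def)
    qed
    then have "approaching_map (subtopology ?W C1) ?XI ?L A (\<lambda>z. k1 (fst z))"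
      by (rule approaching_map_sets_cong) (use A LM in auto)
    moreover have "continuous_map (subtopology (subtopology ?W C1) (topspace (subtopology ?W C1) - ?XI)) unit_interval
        (\<lambda>z. (1 - v (fst z)) * (1 - snd z))"
    proof -
      have "continuous_map (subtopology ?W (C1 \<inter> (topspace (subtopology ?W C1) - ?XI))) unit_interval
        (\<lambda>z. (1 - v (fst z)) * (1 - snd z))"
      proof (rule time)
        show "C1 \<inter> (topspace (subtopology ?W C1) - ?XI) \<subseteq> (topspace M - X) \<times> {0..1}" using sub1 by blast
        then show "continuous_map (subtopology ?W (C1 \<inter> (topspace (subtopology ?W C1) - ?XI))) euclideanreal
            (\<lambda>z. (1 - v (fst z)) * (1 - snd z))"
          by (intro continuous_map_real_mult continuous_map_diff vW sndW) auto
        show "(1 - v (fst z)) * (1 - snd z) \<in> {0..1}" if "z \<in> C1 \<inter> (topspace (subtopology ?W C1) - ?XI)" for z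
        proof -
          have "fst z \<in> topspace M - X" "snd z \<in> {0..1}" using sub1 that by auto
          with v01[of "fst z"] show ?thesis by (auto intro!: mult_nonneg_nonneg mult_le_one)
        qed
      qed
      then show ?thesis by (simp add: subtopology_subtopology)
    qed
    ultimately have "approaching_map (subtopology ?W C1) ?XI (prod_topology ?L unit_interval) (A \<times> {0..1})
        (\<lambda>z. (k1 (fst z), (1 - v (fst z)) * (1 - snd z)))"
      by (intro approaching_map_Pair metrizable_space_subtopology metW)
    from approaching_map_compose[OF this G(1)]
    show "approaching_map (subtopology ?W C1) ?XI ?L A H"
      by (rule approaching_map_cong) (auto simp: C1_def H_def)
    from approaching_map_compose[OF k1W \<rho>]
    show "approaching_map (subtopology ?W C2) ?XI ?L A H"
    proof (rule approaching_map_cong)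
      fix z assume z: "z \<in> topspace (subtopology ?W C2) - ?XI"
      then have x: "fst z \<in> topspace M - X" "1/3 \<le> f (fst z)" by (auto simp: C2_def)
      show "H z = (\<rho> \<circ> (\<lambda>z. k1 (fst z))) z"
      proof (cases "f (fst z) \<le> 1/3")
        case True
        with x have "v (fst z) = 1" by (simp add: v_def)
        then show ?thesis using True k1in[OF x(1) True] G(2)[of "k1 (fst z)"] LM by (auto simp: H_def)
      qed (simp add: H_def)
    qed
  qed
  define \<rho>' where "\<rho>' x = H (x, 0)" for x
  have r': "approaching_map M X ?L A \<rho>'" unfolding \<rho>'_def by (rule approaching_map_slice[OF H]) simp
  have r'L: "\<rho>' x = x" if "x \<in> L - A" for x
    using that k1L[OF that] fL[OF that] G(3)[of x] LM by (auto simp: \<rho>'_def H_def v_def)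
  have r'in: "\<rho>' x \<in> L - A" if "x \<in> topspace M - X" for x
    using approaching_map_into[OF r' that] by auto
  have incl: "approaching_map ?L A M X id"
    by (rule approaching_map_continuous) (use A in \<open>auto simp: continuous_map_from_subtopology\<close>)
  have "approaching_homotopic M X ?L A \<rho>' (\<rho> \<circ> k1)"
  proof (rule approaching_homotopicI[OF H])
    fix x assume x: "x \<in> topspace M - X"
    show "H (x, 1) = (\<rho> \<circ> k1) x"
      using k1in[OF x] G(2)[of "k1 x"] LM by (auto simp: H_def)
  qed (simp add: \<rho>'_def)
  then have e1: "approaching_homotopic M X M X \<rho>' (\<rho> \<circ> k1)"
    using approaching_homotopic_comp_left[OF _ incl] by fastforce
  have "approaching_homotopic M X M X id k1"
    by (rule approaching_homotopicI[OF k]) (auto simp: k_def k1_def h0)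
  moreover have \<rho>M: "approaching_map M X M X \<rho>" using approaching_homotopic_imp_map(1)[OF hM] .
  ultimately have e2: "approaching_homotopic M X M X \<rho> (\<rho> \<circ> k1)"
    using approaching_homotopic_comp_left by fastforce
  have "approaching_homotopic M X M X id \<rho>'"
    using approaching_homotopic_trans[OF metM approaching_homotopic_sym[OF metM hM]
      approaching_homotopic_trans[OF metM e2 approaching_homotopic_sym[OF metM e1]]] .
  then obtain F where F: "approaching_map ?W ?XI M X F"
    "\<And>x. x \<in> topspace M - X \<Longrightarrow> F (x, 0) = id x" "\<And>x. x \<in> topspace M - X \<Longrightarrow> F (x, 1) = \<rho>' x"
    by (rule approaching_homotopicE) blast
  have topXI: "topspace ?W - ?XI = (topspace M - X) \<times> {0..1}" by auto
  have r'M: "approaching_map M X M X \<rho>'" using approaching_map_compose[OF r' incl] by simp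
  have E: "approaching_map ?W ?XI M X (\<lambda>z. F (q (fst z), min (v (fst z)) (\<sigma> (snd z))))"
    if q: "approaching_map M X M X q" and s: "continuous_on UNIV \<sigma>" "\<And>t. t \<in> {0..1} \<Longrightarrow> \<sigma> t \<in> {0..1}" for q \<sigma>
  proof -
    have "continuous_map (subtopology ?W (topspace ?W - ?XI)) euclideanreal (\<lambda>z. \<sigma> (snd z))"
      using continuous_map_compose[OF sndW, of euclideanreal \<sigma>] s(1) by (simp add: o_def)
    then have "continuous_map (subtopology ?W (topspace ?W - ?XI)) unit_interval (\<lambda>z. min (v (fst z)) (\<sigma> (snd z)))"
      using v01 s(2) by (intro time continuous_map_real_min vW) (auto simp: min_def)
    from approaching_map_compose[OF approaching_map_Pair[OF metW approaching_map_fst[OF q] this] F(1)]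
    show ?thesis by (simp add: o_def)
  qed
  define E1 where "E1 z = F (k1 (fst z), min (v (fst z)) (snd z))" for z
  define E2 where "E2 z = F (\<rho>' (k1 (fst z)), min (v (fst z)) (1 - snd z))" for z
  have E1: "approaching_map ?W ?XI M X E1"
    unfolding E1_def by (rule E[OF k1]) (auto intro!: continuous_intros)
  have E2: "approaching_map ?W ?XI M X E2"
    unfolding E2_def using E[OF approaching_map_compose[OF k1 r'M], of "\<lambda>t. 1 - t"]
    by (simp add: continuous_on_diff)
  have k1X: "k1 x \<in> topspace M - X" if "x \<in> topspace M - X" for x
    by (rule approaching_map_into[OF k1 that])
  have r'X: "\<rho>' x \<in> topspace M - X" if "x \<in> topspace M - X" for x
    by (rule approaching_map_into[OF r'M that])
  have E12: "E1 (x, 1) = E2 (x, 0)" if x: "x \<in> topspace M - X" for x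
  proof (cases "f x \<le> 1/3")
    case True
    then have "\<rho>' (k1 x) = k1 x" by (intro r'L k1in x)
    then show ?thesis using v01[OF x] by (simp add: E1_def E2_def)
  next
    case False
    then have "v x = 1" by (simp add: v_def)
    then show ?thesis using F(3) k1X[OF x] r'X r'L r'in by (simp add: E1_def E2_def)
  qed
  define J where "J z = (if snd z \<le> 1/2 then E1 (fst z, 2 * snd z) else E2 (fst z, 2 * snd z - 1))" for z
  have J: "approaching_map ?W ?XI M X J"
    unfolding J_def using approaching_map_concatenate[OF metM E1 E2 E12] .
  have kJ: "k (x, 1) = J (x, 0)" if x: "x \<in> topspace M - X" for x
    using F(2)[OF k1X[OF x]] v01[OF x] by (simp add: J_def E1_def k1_def)
  define \<Phi> where "\<Phi> z = (if snd z \<le> 1/2 then k (fst z, 2 * snd z) else J (fst z, 2 * snd z - 1))" for z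
  have \<Phi>: "approaching_map ?W ?XI M X \<Phi>"
    unfolding \<Phi>_def using approaching_map_concatenate[OF metM k J kJ] .
  have \<Phi>1: "\<Phi> (x, 1) = \<rho>' (k1 x)" if x: "x \<in> topspace M - X" for x
    using F(2) r'X k1X[OF x] v01[OF x] by (simp add: \<Phi>_def J_def E2_def)
  have \<Phi>L: "\<Phi> (x, t) = x" if x: "x \<in> L - A" and t: "t \<in> {0..1}" for x t
  proof -
    have xX: "x \<in> topspace M - X" using x A LM by auto
    have "v x = 0" using fL[OF x] by (simp add: v_def)
    then have "J (x, c) = x" if "c \<in> {0..1}" for c
      using k1L[OF x] r'L[OF x] F(2)[OF xX] that by (simp add: J_def E1_def E2_def)
    then show ?thesis using kL[OF x, of "2 * t"] t by (simp add: \<Phi>_def)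
  qed
  show thesis
  proof (rule that[OF \<Phi>])
    show "\<Phi> (x, 0) = x" if "x \<in> topspace M - X" for x using that h0[of x] by (simp add: \<Phi>_def k_def)
    show "(\<lambda>x. \<Phi> (x, 1)) ` (topspace M - X) = L - A"
    proof
      show "(\<lambda>x. \<Phi> (x, 1)) ` (topspace M - X) \<subseteq> L - A" using \<Phi>1 r'in k1X by auto
      show "L - A \<subseteq> (\<lambda>x. \<Phi> (x, 1)) ` (topspace M - X)"
      proof
        fix x assume x: "x \<in> L - A"
        then have "x \<in> topspace M - X" using A LM by auto
        moreover have "x = \<Phi> (x, 1)" using \<Phi>L[OF x] by simp
        ultimately show "x \<in> (\<lambda>x. \<Phi> (x, 1)) ` (topspace M - X)" by blast
      qed
    qed
  qed (rule \<Phi>L)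
qed

text \<open>
  With hulls \<open>M\<close> of \<open>Y\<close> and \<open>K\<close> of \<open>X\<close>, the space \<open>Y\<close> is embedded in \<open>M \<times> K\<close> as the graph of an
  extension \<open>h : Y \<rightarrow> K\<close> of the embedding of \<open>X\<close>, and \<open>L\<close> is the graph of an extension
  \<open>r : K \<rightarrow> M\<close> of \<open>i\<close>.
\<close>

lemma closed_embedding_FDR:
  fixes X Y :: "'u topology"
  assumes u: "(UNIV :: real set) \<lesssim> (UNIV :: 'u set)"
    and X: "metrizable_space X" and Y: "metrizable_space Y" and i: "closed_embedding X Y i"
    and iso: "isomorphism_in fSh X Y (induced_fsh_class X Y i)"
  shows "FDR_embedding X Y i"
proof -
  have inf: "infinite (UNIV :: 'u set)"
    using u infinite_UNIV_char_0 lepoll_trans infinite_le_lepoll by metis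
  have ei: "embedding_map X Y i" and cli: "closedin Y (i ` topspace X)"
    using i by (auto simp: closed_embedding_def)
  have ci: "continuous_map X Y i" by (rule embedding_map_continuous[OF ei])
  obtain M e0 where m: "AR_hull Y (M, e0)" using AR_hull_exists[OF u Y] by (metis surj_pair)
  obtain K e1 where k: "AR_hull X (K, e1)" using AR_hull_exists[OF u X] by (metis surj_pair)
  have M: "abs_extensor TYPE('u) M" and e0: "continuous_map Y M e0" and nM: "homotopy_negligible M (e0 ` topspace Y)"
    and metM: "metrizable_space M" and emb0: "embedding_map Y M e0"
    using AR_hullD[OF m] embedding_map_continuous by auto
  have K: "abs_extensor TYPE('u) K" and e1: "continuous_map X K e1" and nK: "homotopy_negligible K (e1 ` topspace X)"
    and metK: "metrizable_space K"
    using AR_hullD[OF k] embedding_map_continuous by auto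
  from embedding_map_inverse[OF ei] obtain i' where i': "continuous_map (subtopology Y (i ` topspace X)) X i'"
    "\<And>x. x \<in> topspace X \<Longrightarrow> i' (i x) = x" by metis
  obtain h where h: "continuous_map Y K h" "\<And>y. y \<in> i ` topspace X \<Longrightarrow> h y = (e1 \<circ> i') y"
    by (rule abs_extensor_extend[OF K subset_imp_lepoll[OF subset_UNIV] Y cli continuous_map_compose[OF i'(1) e1]])
      (rule that)
  have hi: "h (i x) = e1 x" if "x \<in> topspace X" for x using h(2)[of "i x"] i'(2) that by auto
  from hull_map_exists[OF k m ci] obtain r where r: "hull_map X (K, e1) Y (M, e0) i r" .
  then have rc: "continuous_map K M r" and re: "\<And>x. x \<in> topspace X \<Longrightarrow> r (e1 x) = e0 (i x)"
    and rY: "\<And>x. \<lbrakk>x \<in> topspace K; r x \<in> e0 ` topspace Y\<rbrakk> \<Longrightarrow> x \<in> e1 ` topspace X"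
    by (auto simp: hull_map_iff)
  let ?P = "prod_topology M K"
  define g where "g y = (e0 y, h y)" for y
  define q where "q \<kappa> = (r \<kappa>, \<kappa>)" for \<kappa>
  have P: "abs_extensor TYPE('u) ?P" by (rule abs_extensor_prod[OF M K])
  have metP: "metrizable_space ?P" by (rule abs_extensor_metrizable[OF P])
  have cardP: "topspace ?P \<lesssim> (UNIV :: 'u set)"
    using lepoll_times_infinite[OF inf, of "topspace M" "topspace K"] by (simp add: subset_imp_lepoll)
  from embedding_map_inverse[OF emb0] obtain j where j: "continuous_map (subtopology M (e0 ` topspace Y)) Y j"
    "\<And>y. y \<in> topspace Y \<Longrightarrow> j (e0 y) = y" by metis
  have gc: "continuous_map Y ?P g" unfolding g_def using e0 h(1) by (simp add: continuous_map_paired)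
  have ge: "embedding_map Y ?P g"
    unfolding embedding_map_def homeomorphic_map_maps homeomorphic_maps_def
  proof (intro exI[of _ "j \<circ> fst"] conjI ballI)
    show "continuous_map Y (subtopology ?P (g ` topspace Y)) g"
      using gc by (auto simp: continuous_map_in_subtopology)
    show "continuous_map (subtopology ?P (g ` topspace Y)) Y (j \<circ> fst)"
    proof (rule continuous_map_compose[OF _ j(1)])
      show "continuous_map (subtopology ?P (g ` topspace Y)) (subtopology M (e0 ` topspace Y)) fst"
        by (auto simp: continuous_map_in_subtopology g_def intro: continuous_map_from_subtopology[OF continuous_map_fst])
    qed
  qed (auto simp: g_def j(2))
  have gcl: "closedin ?P (g ` topspace Y)"
    unfolding closedin_sequentially[OF metP]
  proof (intro conjI allI impI)
    show "g ` topspace Y \<subseteq> topspace ?P" by (rule continuous_map_image_subset_topspace[OF gc])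
    fix s p assume *: "range s \<subseteq> g ` topspace Y \<and> limitin ?P s p sequentially"
    obtain a b where p: "p = (a, b)" by (cases p)
    have sn: "s n \<in> g ` topspace Y" for n using * by blast
    have la: "limitin M (\<lambda>n. fst (s n)) a sequentially" and lb: "limitin K (\<lambda>n. snd (s n)) b sequentially"
      using * by (auto simp: p limitin_Pair)
    have in0: "fst (s n) \<in> e0 ` topspace Y" for n using sn[of n] by (auto simp: g_def)
    have "a \<in> e0 ` topspace Y"
      by (rule limitin_closedin[OF la AR_hullD(5)[OF m, simplified]]) (use in0 in auto)
    then obtain y where y: "y \<in> topspace Y" "a = e0 y" by blast
    have "limitin (subtopology M (e0 ` topspace Y)) (\<lambda>n. fst (s n)) a sequentially"
      using la in0 y by (auto simp: limitin_subtopology)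
    from continuous_map_sequentiallyD[OF h(1) continuous_map_sequentiallyD[OF j(1) this]]
    have "limitin K (\<lambda>n. h (j (fst (s n)))) (h y) sequentially" using y j(2) by simp
    moreover have "h (j (fst (s n))) = snd (s n)" for n using sn[of n] by (auto simp: g_def j(2))
    ultimately have "b = h y" using lb limitin_unique_metrizable[OF metK] by simp
    with y show "p \<in> g ` topspace Y" by (auto simp: p g_def)
  qed
  have "homotopy_negligible ?P (g ` topspace Y)"
    by (rule homotopy_negligible_prod[OF nM gcl]) (auto simp: g_def)
  with ge gcl obtain M' :: "'u topology" and c where c: "homeomorphic_map ?P M' c" and n: "AR_hull Y (M', c \<circ> g)"
    using copy_hull[OF P cardP] unfolding closed_embedding_def by metis
  have cinj: "inj_on c (topspace ?P)" using c by (rule homeomorphic_imp_injective_map)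
  have qc: "continuous_map K ?P q" unfolding q_def using rc by (simp add: continuous_map_paired)
  define L where "L = c ` q ` topspace K"
  have qcl: "closedin ?P (q ` topspace K)"
  proof -
    have "q ` topspace K = {p \<in> topspace ?P. fst p = r (snd p)}"
      using rc by (auto simp: q_def continuous_map_def image_iff)
    moreover have "closedin ?P {p \<in> topspace ?P. fst p = r (snd p)}"
      using metM rc by (intro closedin_continuous_maps_eq[of M] metrizable_imp_Hausdorff_space continuous_map_fst)
        (use continuous_map_compose[OF continuous_map_snd rc] in \<open>auto simp: o_def\<close>)
    ultimately show ?thesis by simp
  qed
  have L: "closedin M' L"
    unfolding L_def using homeomorphic_map_closedness[OF c closedin_subset[OF qcl]] qcl by simp
  have hq: "homeomorphic_map K (subtopology M' L) (c \<circ> q)"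
  proof (rule homeomorphic_map_compose)
    show "homeomorphic_map K (subtopology ?P (q ` topspace K)) q"
      unfolding homeomorphic_map_maps homeomorphic_maps_def
      using qc by (intro exI[of _ snd]) (auto simp: continuous_map_in_subtopology q_def
        intro: continuous_map_from_subtopology[OF continuous_map_snd])
    show "homeomorphic_map (subtopology ?P (q ` topspace K)) (subtopology M' L) c"
    proof (rule homeomorphic_map_subtopologies[OF c])
      show "c ` (topspace ?P \<inter> q ` topspace K) = topspace M' \<inter> L"
        using closedin_subset[OF qcl] closedin_subset[OF L] by (simp add: L_def Int_absorb1)
    qed
  qed
  have ARL: "AR_space (subtopology M' L)"
    using abs_extensor_homeomorphic[OF K hq] by (simp add: AR_space_iff_abs_extensor)
  let ?A = "(c \<circ> g) ` i ` topspace X"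
  have qg: "q (e1 x) = g (i x)" if "x \<in> topspace X" for x using re hi that by (simp add: q_def g_def)
  then have imA: "(c \<circ> q) ` e1 ` topspace X = ?A" by (auto simp: image_comp)
  have negL: "homotopy_negligible (subtopology M' L) ?A"
    using homotopy_negligible_homeomorphic[OF nK hq] imA by simp
  have LA: "L \<inter> (c \<circ> g) ` topspace Y = ?A"
  proof
    show "L \<inter> (c \<circ> g) ` topspace Y \<subseteq> ?A"
    proof
      fix p assume "p \<in> L \<inter> (c \<circ> g) ` topspace Y"
      then obtain \<kappa> y where *: "p = c (q \<kappa>)" "\<kappa> \<in> topspace K" "p = c (g y)" "y \<in> topspace Y"
        unfolding L_def o_def by blast
      then have "q \<kappa> = g y"
        using cinj closedin_subset[OF qcl] closedin_subset[OF gcl] by (metis image_eqI inj_onD subsetD)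
      then have "r \<kappa> = e0 y" "\<kappa> = h y" by (auto simp: q_def g_def)
      with rY *(2,4) obtain x where "x \<in> topspace X" "\<kappa> = e1 x" by blast
      then show "p \<in> ?A" using *(1) imA by auto
    qed
    have "?A \<subseteq> L"
      using image_mono[OF continuous_map_image_subset_topspace[OF e1], of "c \<circ> q"]
      unfolding imA by (simp add: L_def image_comp)
    moreover have "?A \<subseteq> (c \<circ> g) ` topspace Y" using cli closedin_subset by blast
    ultimately show "?A \<subseteq> L \<inter> (c \<circ> g) ` topspace Y" by blast
  qed
  let ?l = "(subtopology M' L, (c \<circ> g) \<circ> i)" and ?n = "(M', c \<circ> g)"
  have "embedding_map X M' ((c \<circ> g) \<circ> i)"
    using ei AR_hullD(3)[OF n] embedding_map_compose by auto
  then have "embedding_map X (subtopology M' L) ((c \<circ> g) \<circ> i)"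
    using LA by (auto simp: embedding_map_in_subtopology)
  with ARL negL have l: "AR_hull X ?l" by (simp add: AR_hull_def image_comp)
  have LM: "L \<subseteq> topspace M'" by (rule closedin_subset[OF L])
  have hm: "hull_map X ?l Y ?n i id"
    unfolding hull_map_iff
  proof (intro conjI)
    show "continuous_map (fst ?l) (fst ?n) id" by (simp add: continuous_map_from_subtopology)
    have "?A = ((c \<circ> g) \<circ> i) ` topspace X" by auto
    then show "{x \<in> topspace (fst ?l). id x \<in> snd ?n ` topspace Y} = snd ?l ` topspace X"
      using LA LM by auto
  qed simp
  have "isomorphism_in fSh X Y (fsh_class X Y (?l, ?n, id))"
    using iso by (simp add: induced_fsh_class_eq[OF u l n ci hm])
  from fsh_isomorphismE[OF u l n hull_map_approaching[OF hm] this] obtain \<rho>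
    where \<rho>: "hull_approaching Y ?n X ?l \<rho>" "hull_homotopic X ?l X ?l (\<rho> \<circ> id) id"
      "hull_homotopic Y ?n Y ?n (id \<circ> \<rho>) id" .
  have im: "((c \<circ> g) \<circ> i) ` topspace X = ?A" by auto
  have 1: "approaching_map M' ((c \<circ> g) ` topspace Y) (subtopology M' L) ?A \<rho>"
    "approaching_homotopic (subtopology M' L) ?A (subtopology M' L) ?A \<rho> id"
    "approaching_homotopic M' ((c \<circ> g) ` topspace Y) M' ((c \<circ> g) ` topspace Y) \<rho> id"
    using \<rho> by (simp_all only: hull_approaching_def hull_homotopic_def im fst_conv snd_conv comp_id id_comp)
  have 2: "abs_extensor TYPE('u) M'" "homotopy_negligible M' ((c \<circ> g) ` topspace Y)"
    using AR_hullD[OF n] by simp_all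
  obtain \<Phi> where \<Phi>: "approaching_map (prod_topology M' unit_interval) ((c \<circ> g) ` topspace Y \<times> {0..1})
      M' ((c \<circ> g) ` topspace Y) \<Phi>"
    "\<And>x. x \<in> topspace M' - (c \<circ> g) ` topspace Y \<Longrightarrow> \<Phi> (x, 0) = x"
    "(\<lambda>x. \<Phi> (x, 1)) ` (topspace M' - (c \<circ> g) ` topspace Y) = L - ?A"
    "\<And>x t. \<lbrakk>x \<in> L - ?A; t \<in> {0..1}\<rbrakk> \<Longrightarrow> \<Phi> (x, t) = x"
    by (rule strong_deformation[OF u 2 L ARL[unfolded AR_space_iff_abs_extensor] LA negL 1]) (rule that)
  have "FDR_inclusion Y (i ` topspace X)"
    unfolding FDR_inclusion_def
    by (intro conjI exI[of _ M'] exI[of _ "c \<circ> g"] exI[of _ L] exI[of _ \<Phi>] cli n L ARL LA negL \<Phi>(1,3) ballI)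
      (use \<Phi>(2,4) in auto)
  with i show ?thesis by (simp add: FDR_embedding_def)
qed

section \<open>The mapping cylinder of an approaching map\<close>

lemma homotopic_withI_prod:
  assumes "continuous_map (prod_topology X unit_interval) Y k"
  shows "homotopic_with (\<lambda>_. True) X Y (\<lambda>x. k (x, 0)) (\<lambda>x. k (x, 1))"
  unfolding homotopic_with_def
proof (intro exI[of _ "\<lambda>z. k (snd z, fst z)"] conjI)
  have "continuous_map (prod_topology unit_interval X) (prod_topology X unit_interval) (\<lambda>z. (snd z, fst z))"
    by (simp add: continuous_map_paired continuous_map_fst continuous_map_snd)
  from continuous_map_compose[OF this assms]
  show "continuous_map (prod_topology unit_interval X) Y (\<lambda>z. k (snd z, fst z))" by (simp add: o_def)
qed auto

lemma abs_extensor_contractible: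
  fixes M :: "'a topology"
  assumes u: "(UNIV :: real set) \<lesssim> (UNIV :: 'u set)" and M: "abs_extensor TYPE('u) M"
    and card: "topspace M \<lesssim> (UNIV :: 'u set)" and p: "p \<in> topspace M"
  obtains c where "continuous_map (prod_topology M unit_interval) M c"
    "\<And>x. x \<in> topspace M \<Longrightarrow> c (x, 0) = x" "\<And>x. x \<in> topspace M \<Longrightarrow> c (x, 1) = p"
proof -
  let ?W = "prod_topology M unit_interval" and ?A0 = "topspace M \<times> {0::real}" and ?A1 = "topspace M \<times> {1::real}"
  have cl: "closedin ?W ?A0" "closedin ?W ?A1" by (auto intro!: closedin_prod_unit_interval)
  define k where "k z = (if snd z = 0 then fst z else p)" for z :: "'a \<times> real"
  have "continuous_map (subtopology ?W ?A0) M k"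
    by (rule continuous_map_eq[OF continuous_map_from_subtopology[OF continuous_map_fst]]) (auto simp: k_def)
  moreover have "continuous_map (subtopology ?W ?A1) M k"
    by (rule continuous_map_eq[where f = "\<lambda>_. p"]) (use p in \<open>auto simp: k_def\<close>)
  ultimately have "continuous_map (subtopology ?W (?A0 \<union> ?A1)) M k"
    using cl by (intro continuous_map_Un_closed)
  moreover have "topspace ?W \<lesssim> (UNIV :: 'u set)" using lepoll_prod_unit_interval[OF u card] by simp
  ultimately obtain c where c: "continuous_map ?W M c" "\<And>z. z \<in> ?A0 \<union> ?A1 \<Longrightarrow> c z = k z"
    using abs_extensor_extend[OF M _ metrizable_prod_unit_interval[OF abs_extensor_metrizable[OF M]] closedin_Un[OF cl]]
    by metis
  show thesis
    by (rule that[OF c(1)]) (use c(2) in \<open>auto simp: k_def\<close>)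
qed

lemma abs_extensor_equiconnected:
  fixes N :: "'a topology"
  assumes u: "(UNIV :: real set) \<lesssim> (UNIV :: 'u set)" and N: "abs_extensor TYPE('u) N"
    and card: "topspace N \<lesssim> (UNIV :: 'u set)"
  obtains K where "continuous_map (prod_topology (prod_topology N N) unit_interval) N K"
    "\<And>a b. \<lbrakk>a \<in> topspace N; b \<in> topspace N\<rbrakk> \<Longrightarrow> K ((a, b), 0) = a"
    "\<And>a b. \<lbrakk>a \<in> topspace N; b \<in> topspace N\<rbrakk> \<Longrightarrow> K ((a, b), 1) = b"
    "\<And>a t. \<lbrakk>a \<in> topspace N; t \<in> {0..1}\<rbrakk> \<Longrightarrow> K ((a, a), t) = a"
proof -
  let ?NN = "prod_topology N N"
  let ?W = "prod_topology ?NN unit_interval"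
  let ?D = "{z \<in> topspace ?NN. fst z = snd z}"
  let ?A0 = "topspace ?NN \<times> {0::real}" and ?A1 = "topspace ?NN \<times> {1::real}" and ?B = "?D \<times> {0..1::real}"
  have met: "metrizable_space N" by (rule abs_extensor_metrizable[OF N])
  then have metW: "metrizable_space ?W"
    by (intro metrizable_prod_unit_interval) (simp add: metrizable_space_prod_topology)
  have "closedin ?NN ?D"
    by (intro closedin_continuous_maps_eq[of N] metrizable_imp_Hausdorff_space met continuous_map_fst continuous_map_snd)
  then have cl: "closedin ?W ?A0" "closedin ?W ?A1" "closedin ?W ?B"
    by (auto intro!: closedin_prod_unit_interval simp del: topspace_prod_topology)
  define k where "k z = (if snd z = 1 then snd (fst z) else fst (fst z))" for z :: "('a \<times> 'a) \<times> real"
  have c: "continuous_map (subtopology ?W S) N (fst \<circ> fst)" "continuous_map (subtopology ?W S) N (snd \<circ> fst)" for S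
    using continuous_map_compose[OF continuous_map_fst continuous_map_fst]
      continuous_map_compose[OF continuous_map_fst continuous_map_snd]
    by (auto intro!: continuous_map_from_subtopology)
  have "continuous_map (subtopology ?W ?A0) N k" "continuous_map (subtopology ?W ?B) N k"
    by (rule continuous_map_eq[OF c(1)]; auto simp: k_def)+
  moreover have "continuous_map (subtopology ?W ?A1) N k"
    by (rule continuous_map_eq[OF c(2)]) (auto simp: k_def)
  ultimately have kc: "continuous_map (subtopology ?W (?A0 \<union> ?A1 \<union> ?B)) N k"
    using cl by (intro continuous_map_Un_closed closedin_Un)
  have kcl: "closedin ?W (?A0 \<union> ?A1 \<union> ?B)" using cl by (intro closedin_Un)
  have card_W: "topspace ?W \<lesssim> (UNIV :: 'u set)"
  proof -
    have "infinite (UNIV :: 'u set)"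
      using u infinite_UNIV_char_0 lepoll_trans infinite_le_lepoll by metis
    from lepoll_prod_unit_interval[OF u lepoll_times_infinite[OF this card card]] show ?thesis by simp
  qed
  obtain K where K: "continuous_map ?W N K" "\<And>z. z \<in> ?A0 \<union> ?A1 \<union> ?B \<Longrightarrow> K z = k z"
    by (rule abs_extensor_extend[OF N card_W metW kcl kc]) (rule that)
  show thesis
  proof (rule that[OF K(1)])
    fix a b assume ab: "a \<in> topspace N" "b \<in> topspace N"
    have "((a, b), 0) \<in> ?A0" "((a, b), 1) \<in> ?A1" using ab by auto
    then show "K ((a, b), 0) = a" "K ((a, b), 1) = b" by (simp_all add: K(2) k_def)
  next
    fix a and t :: real assume at: "a \<in> topspace N" "t \<in> {0..1}"
    then have "((a, a), t) \<in> ?B" by auto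
    then show "K ((a, a), t) = a" by (simp add: K(2) k_def)
  qed
qed

text \<open>
  \<open>P\<close> is the cylinder of \<open>\<phi>\<close> sheared along the second coordinate of \<open>M \<times> [0,1]\<close>: the point
  \<open>((m, r), (s, n))\<close> with \<open>s > 0\<close> and hence \<open>n = \<phi> (m, r)\<close> lies at height \<open>s\<close> over the point
  \<open>(m, r - s)\<close>, and at height \<open>0\<close> the whole of \<open>M \<times> [0,1] \<times> N\<close> is glued in. The shearing makes the
  path of a point towards height \<open>s\<close> constant in \<open>N\<close>, which is why \<open>P\<close> is an absolute extensor.
\<close>

locale cylinder =
  fixes T :: "'u itself" and M :: "'a topology" and X :: "'a set"
    and N :: "'b topology" and Y :: "'b set" and \<phi> :: "'a \<times> real \<Rightarrow> 'b"
  assumes u: "(UNIV :: real set) \<lesssim> (UNIV :: 'u set)"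
    and M: "abs_extensor TYPE('u) M" and cardM: "topspace M \<lesssim> (UNIV :: 'u set)" and X: "closedin M X"
    and N: "abs_extensor TYPE('u) N" and cardN: "topspace N \<lesssim> (UNIV :: 'u set)" and Y: "homotopy_negligible N Y"
    and \<phi>: "approaching_map (prod_topology M unit_interval) (X \<times> {0}) N Y \<phi>"
begin

definition MI where "MI = prod_topology M unit_interval"

definition cyl :: "(('a \<times> real) \<times> (real \<times> 'b)) set" where
  "cyl = {((m, r), (s, n)) |m r s n. s \<le> r \<and> (s > 0 \<longrightarrow> n = \<phi> (m, r))}"

definition P where "P = subtopology (prod_topology MI (prod_topology unit_interval N)) cyl"

definition Z where
  "Z = {((m, r), (s, n)) |m r s n. ((m, r), (s, n)) \<in> topspace P \<and> (s = 0 \<and> n \<in> Y \<or> s > 0 \<and> s = r \<and> m \<in> X)}"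

lemma metrizable_M: "metrizable_space M" by (rule abs_extensor_metrizable[OF M])

lemma metrizable_N: "metrizable_space N" by (rule abs_extensor_metrizable[OF N])

lemma metrizable_MI: "metrizable_space MI"
  unfolding MI_def by (rule metrizable_prod_unit_interval[OF metrizable_M])

lemma metrizable_P: "metrizable_space P"
  unfolding P_def using metrizable_MI metrizable_N metrizable_unit_interval
  by (intro metrizable_space_subtopology) (simp add: metrizable_space_prod_topology)

lemma closed_Y: "closedin N Y" using Y by (simp add: homotopy_negligible_def)

lemma topspace_P:
  "((m, r), (s, n)) \<in> topspace P \<longleftrightarrow> m \<in> topspace M \<and> r \<in> {0..1} \<and> s \<in> {0..1} \<and> n \<in> topspace N \<and>
    s \<le> r \<and> (s > 0 \<longrightarrow> n = \<phi> (m, r))"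
  by (auto simp: P_def MI_def cyl_def)

lemma P_cases:
  assumes "p \<in> topspace P"
  obtains m r s n where "p = ((m, r), (s, n))" "m \<in> topspace M" "r \<in> {0..1}" "s \<in> {0..1}" "n \<in> topspace N"
    "s \<le> r" "s > 0 \<Longrightarrow> n = \<phi> (m, r)"
  using assms topspace_P by (metis surj_pair)

lemma Z_iff: "((m, r), (s, n)) \<in> Z \<longleftrightarrow>
    ((m, r), (s, n)) \<in> topspace P \<and> (s = 0 \<and> n \<in> Y \<or> s > 0 \<and> s = r \<and> m \<in> X)"
  by (auto simp: Z_def)

lemma card_P: "topspace P \<lesssim> (UNIV :: 'u set)"
proof -
  have inf: "infinite (UNIV :: 'u set)"
    using u infinite_UNIV_char_0 lepoll_trans infinite_le_lepoll by metis
  have I: "{0..1::real} \<lesssim> (UNIV :: 'u set)"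
    using u subset_imp_lepoll[of "{0..1::real}" UNIV] lepoll_trans by auto
  have "topspace P \<subseteq> (topspace M \<times> {0..1}) \<times> ({0..1} \<times> topspace N)"
    by (auto simp: topspace_P)
  moreover have "(topspace M \<times> {0..1::real}) \<times> ({0..1::real} \<times> topspace N) \<lesssim> (UNIV :: 'u set)"
    by (intro lepoll_times_infinite inf cardM cardN I)
  ultimately show ?thesis using subset_imp_lepoll lepoll_trans by blast
qed

lemma limitin_MI:
  "limitin MI s (m, r) sequentially \<longleftrightarrow>
    limitin M (\<lambda>k. fst (s k)) m sequentially \<and> limitin unit_interval (\<lambda>k. snd (s k)) r sequentially"
  by (simp add: MI_def limitin_Pair)

lemma limitin_P_iff:
  assumes "range p \<subseteq> topspace P"
  shows "limitin P p ((m, r), (s, n)) sequentially \<longleftrightarrow> ((m, r), (s, n)) \<in> topspace P \<and>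
    limitin MI (\<lambda>k. fst (p k)) (m, r) sequentially \<and>
    (\<lambda>k. fst (snd (p k))) \<longlonglongrightarrow> s \<and> limitin N (\<lambda>k. snd (snd (p k))) n sequentially"
proof -
  have pk: "p k \<in> topspace P" for k using assms by blast
  have "p k \<in> cyl \<and> fst (snd (p k)) \<in> {0..1}" for k
    using pk[of k] by (auto simp: P_def)
  then show ?thesis
    using limitin_topspace[of P p "((m, r), (s, n))" sequentially]
    by (auto simp: P_def limitin_subtopology limitin_Pair)
qed

lemma \<phi>_limit:
  assumes "limitin MI q (m, r) sequentially" "(m, r) \<notin> X \<times> {0}"
  shows "limitin N (\<lambda>k. \<phi> (q k)) (\<phi> (m, r)) sequentially"
proof -
  have "closedin MI (X \<times> {0})" unfolding MI_def by (intro closedin_prod_unit_interval X) auto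
  then have "openin MI (topspace MI - X \<times> {0})" by blast
  moreover have "(m, r) \<in> topspace MI" using assms(1) limitin_topspace by metis
  ultimately have "limitin (subtopology MI (topspace MI - X \<times> {0})) q (m, r) sequentially"
    using assms limitinD[OF assms(1), of "topspace MI - X \<times> {0}"] by (simp add: limitin_subtopology)
  moreover have "continuous_map (subtopology MI (topspace MI - X \<times> {0})) N \<phi>"
    using \<phi> by (auto simp: approaching_map_def MI_def continuous_map_in_subtopology)
  ultimately show ?thesis by (rule continuous_map_sequentiallyD[rotated])
qed

lemma \<phi>_limit_X:
  assumes "limitin MI q (m, r) sequentially" "(m, r) \<in> X \<times> {0}" "range q \<subseteq> topspace MI - X \<times> {0}"
  obtains h y where "strict_mono (h :: nat \<Rightarrow> nat)" "y \<in> Y" "limitin N (\<lambda>k. \<phi> (q (h k))) y sequentially"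
  using approaching_map_sequence[OF \<phi>[folded MI_def] assms(3,1)] assms(2) by metis

lemma \<phi>_notin_Y: "m \<in> topspace M \<Longrightarrow> r \<in> {0..1} \<Longrightarrow> (m, r) \<notin> X \<times> {0} \<Longrightarrow> \<phi> (m, r) \<in> topspace N - Y"
  by (rule approaching_map_into[OF \<phi>]) auto

lemma abs_extensor_P: "abs_extensor TYPE('u) P"
  unfolding abs_extensor_def
proof (intro conjI allI impI metrizable_P)
  fix W :: "'u topology" and B f
  assume "metrizable_space W \<and> closedin W B \<and> continuous_map (subtopology W B) P f"
  then have W: "metrizable_space W" and B: "closedin W B" and f: "continuous_map (subtopology W B) P f" by auto
  have BW: "B \<subseteq> topspace W" by (rule closedin_subset[OF B])
  have fP: "f b \<in> topspace P" if "b \<in> B" for b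
    using f that BW by (auto simp: continuous_map_def)
  have comp: "continuous_map (subtopology W B) MI (fst \<circ> f)"
    "continuous_map (subtopology W B) (prod_topology unit_interval N) (snd \<circ> f)"
    using f by (auto simp: P_def continuous_map_in_subtopology continuous_map_pairwise)
  then have c4: "continuous_map (subtopology W B) M (fst \<circ> (fst \<circ> f))"
    "continuous_map (subtopology W B) unit_interval (snd \<circ> (fst \<circ> f))"
    "continuous_map (subtopology W B) unit_interval (fst \<circ> (snd \<circ> f))"
    "continuous_map (subtopology W B) N (snd \<circ> (snd \<circ> f))"
    by (simp_all only: MI_def continuous_map_pairwise)
  note cardW = subset_imp_lepoll[OF subset_UNIV, of "topspace W"]
  obtain m where m: "continuous_map W M m" "\<And>b. b \<in> B \<Longrightarrow> m b = (fst \<circ> (fst \<circ> f)) b"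
    by (rule abs_extensor_extend[OF M cardW W B c4(1)]) (rule that)
  obtain r where r: "continuous_map W unit_interval r" "\<And>b. b \<in> B \<Longrightarrow> r b = (snd \<circ> (fst \<circ> f)) b"
    by (rule abs_extensor_extend[OF abs_extensor_unit_interval cardW W B c4(2)]) (rule that)
  obtain s where s: "continuous_map W unit_interval s" "\<And>b. b \<in> B \<Longrightarrow> s b = (fst \<circ> (snd \<circ> f)) b"
    by (rule abs_extensor_extend[OF abs_extensor_unit_interval cardW W B c4(3)]) (rule that)
  obtain n where n: "continuous_map W N n" "\<And>b. b \<in> B \<Longrightarrow> n b = (snd \<circ> (snd \<circ> f)) b"
    by (rule abs_extensor_extend[OF N cardW W B c4(4)]) (rule that)
  have in_top: "m w \<in> topspace M" "r w \<in> {0..1}" "s w \<in> {0..1}" "n w \<in> topspace N" if "w \<in> topspace W" for w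
    using funcset_mem[OF continuous_map_funspace[OF m(1)] that] funcset_mem[OF continuous_map_funspace[OF r(1)] that]
      funcset_mem[OF continuous_map_funspace[OF s(1)] that] funcset_mem[OF continuous_map_funspace[OF n(1)] that]
    by simp_all
  have fB: "f b = ((m b, r b), (s b, n b))" if "b \<in> B" for b
    using that m r s n by (simp add: prod_eq_iff)
  have B1: "s b \<le> r b" "s b > 0 \<Longrightarrow> n b = \<phi> (m b, r b)" if "b \<in> B" for b
    using fP[OF that] by (auto simp: fB[OF that] topspace_P)
  define B0 where "B0 = {b \<in> B. s b = 0}"
  have cB0: "closedin W B0"
  proof -
    have "closedin W {x \<in> topspace W. s x \<in> {0}}"
      by (rule closedin_continuous_map_preimage[OF s(1)]) (auto intro!: closed_subset)
    from closedin_Int[OF B this] show ?thesis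
      using BW by (auto simp: B0_def Int_def subset_iff cong: conj_cong elim!: back_subst[of "closedin W"])
  qed
  obtain \<delta> where d: "continuous_map W unit_interval \<delta>" "\<And>w. w \<in> topspace W \<Longrightarrow> \<delta> w = 0 \<longleftrightarrow> w \<in> B0"
    using closed_zero_set[OF W cB0] by metis
  obtain N0 dN where met: "Metric_space N0 dN" and N_eq: "N = Metric_space.mtopology N0 dN"
    using metrizable_N by (auto simp: metrizable_space_def)
  interpret N: Metric_space N0 dN by (rule met)
  have topN: "topspace N = N0" by (simp add: N_eq)
  define V where "V = {w \<in> topspace W. r w > 0 \<and> dN (\<phi> (m w, r w)) (n w) < \<delta> w}"
  have lims: "limitin M (\<lambda>k. m (w k)) (m x) sequentially" "limitin unit_interval (\<lambda>k. r (w k)) (r x) sequentially"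
    "(\<lambda>k. r (w k)) \<longlonglongrightarrow> r x" "(\<lambda>k. s (w k)) \<longlonglongrightarrow> s x" "limitin N (\<lambda>k. n (w k)) (n x) sequentially"
    "(\<lambda>k. \<delta> (w k)) \<longlonglongrightarrow> \<delta> x" "limitin MI (\<lambda>k. (m (w k), r (w k))) (m x, r x) sequentially"
    if "limitin W w x sequentially" for w x
    using continuous_map_sequentiallyD[OF m(1) that] continuous_map_sequentiallyD[OF r(1) that]
      continuous_map_sequentiallyD[OF s(1) that] continuous_map_sequentiallyD[OF n(1) that]
      continuous_map_sequentiallyD[OF d(1) that]
    by (auto simp: limitin_MI limitin_unit_interval)
  have \<phi>N: "\<phi> (m w, r w) \<in> N0" if "w \<in> topspace W" "r w > 0" for w
    using \<phi>_notin_Y[of "m w" "r w"] in_top[OF that(1)] that(2) topN by auto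
  have V_open: "openin W V"
  proof -
    have "closedin W (topspace W - V)"
      unfolding closedin_sequentially[OF W]
    proof (intro conjI allI impI)
      fix w x assume *: "range w \<subseteq> topspace W - V \<and> limitin W w x sequentially"
      then have wk: "w k \<in> topspace W - V" for k by blast
      have x: "x \<in> topspace W" using * limitin_topspace by metis
      note l = lims[OF conjunct2[OF *]]
      show "x \<in> topspace W - V"
      proof (rule ccontr)
        assume "x \<notin> topspace W - V"
        with x have rx: "r x > 0" "dN (\<phi> (m x, r x)) (n x) < \<delta> x" by (auto simp: V_def)
        then have lp: "limitin N (\<lambda>k. \<phi> (m (w k), r (w k))) (\<phi> (m x, r x)) sequentially"
          by (intro \<phi>_limit l(7)) auto
        have ev1: "\<forall>\<^sub>F k in sequentially. r (w k) > 0" by (rule order_tendstoD(1)[OF l(3) rx(1)])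
        define e where "e = (\<delta> x - dN (\<phi> (m x, r x)) (n x)) / 3"
        have e: "e > 0" using rx by (simp add: e_def)
        have ev2: "\<forall>\<^sub>F k in sequentially. dN (\<phi> (m (w k), r (w k))) (\<phi> (m x, r x)) < e"
          using lp e unfolding N_eq N.limitin_metric by (auto elim: eventually_mono)
        have ev3: "\<forall>\<^sub>F k in sequentially. dN (n (w k)) (n x) < e"
          using l(5) e unfolding N_eq N.limitin_metric by (auto elim: eventually_mono)
        have ev4: "\<forall>\<^sub>F k in sequentially. \<delta> (w k) > \<delta> x - e" by (rule order_tendstoD(1)[OF l(6)]) (use e in simp)
        have "\<forall>\<^sub>F k in sequentially. False"
          using ev1 ev2 ev3 ev4
        proof eventually_elim
          case (elim k)
          have a: "\<phi> (m (w k), r (w k)) \<in> N0" "n (w k) \<in> N0" "\<phi> (m x, r x) \<in> N0" "n x \<in> N0"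
            using \<phi>N[of "w k"] \<phi>N[OF x rx(1)] in_top(4) wk[of k] x elim(1) topN by auto
          have "dN (\<phi> (m (w k), r (w k))) (n (w k)) \<le> dN (\<phi> (m (w k), r (w k))) (\<phi> (m x, r x)) + dN (\<phi> (m x, r x)) (n (w k))"
            using a by (intro N.triangle) auto
          also have "dN (\<phi> (m x, r x)) (n (w k)) \<le> dN (\<phi> (m x, r x)) (n x) + dN (n x) (n (w k))"
            using a by (intro N.triangle) auto
          finally have "dN (\<phi> (m (w k), r (w k))) (n (w k)) < \<delta> (w k)"
            using elim(2-4) N.commute[of "n x" "n (w k)"] by (simp add: e_def field_simps)
          with wk[of k] elim(1) show False by (auto simp: V_def)
        qed
        then show False by simp
      qed
    qed auto
    then have "openin W (topspace W - (topspace W - V))" by blast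
    moreover have "topspace W - (topspace W - V) = V" by (auto simp: V_def)
    ultimately show ?thesis by simp
  qed
  have BV: "B - B0 \<subseteq> V"
  proof
    fix b assume b: "b \<in> B - B0"
    then have bW: "b \<in> topspace W" using BW by blast
    have sb: "s b > 0" using b in_top(3)[OF bW] by (auto simp: B0_def)
    have rb: "r b > 0" using sb B1(1)[of b] b by simp
    have "\<delta> b > 0" using d(1) d(2)[OF bW] b bW by (auto simp: continuous_map_def Pi_iff less_le)
    moreover have "n b = \<phi> (m b, r b)" using B1(2)[OF _ sb] b by blast
    ultimately show "b \<in> V" using bW rb \<phi>N[OF bW rb] by (simp add: V_def)
  qed
  have VB0: "V \<inter> B0 = {}"
  proof -
    have "\<delta> w > 0" if "w \<in> V" for w
      using that le_less_trans[OF N.nonneg] by (auto simp: V_def)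
    then show ?thesis using d(2) by (force simp: V_def)
  qed
  let ?D = "subtopology W (topspace W - B0)"
  have "normal_space ?D"
    using W metrizable_space_subtopology metrizable_imp_normal_space by blast
  moreover have "closedin ?D (B - B0)"
    using B BW by (auto simp: closedin_subtopology)
  moreover have "closedin ?D (topspace W - B0 - V)"
    using V_open by (auto simp: closedin_subtopology intro!: exI[of _ "topspace W - V"])
  moreover have "disjnt (B - B0) (topspace W - B0 - V)" using BV by (auto simp: disjnt_def)
  ultimately obtain \<mu> where la: "continuous_map ?D unit_interval \<mu>" "\<mu> ` (B - B0) \<subseteq> {0}"
    "\<mu> ` (topspace W - B0 - V) \<subseteq> {1}"
    using Urysohn_lemma[of ?D "B - B0" "topspace W - B0 - V" 0 1] by auto
  have la0: "\<mu> b = 0" if "b \<in> B" "b \<notin> B0" for b using la(2) that by blast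
  have la1: "\<mu> w = 1" if "w \<in> topspace W" "w \<notin> B0" "w \<notin> V" for w using la(3) that by blast
  have la_lim: "(\<lambda>k. \<mu> (w k)) \<longlonglongrightarrow> \<mu> x" if "limitin W w x sequentially" "x \<notin> B0" for w x
  proof -
    have "x \<in> topspace W - B0" using that limitin_topspace by fastforce
    moreover from this have "\<forall>\<^sub>F k in sequentially. w k \<in> topspace W - B0"
      using limitinD[OF that(1), of "topspace W - B0"] cB0 by blast
    ultimately have "limitin ?D w x sequentially" using that(1) by (simp add: limitin_subtopology)
    from continuous_map_sequentiallyD[OF la(1) this] show ?thesis by (simp add: limitin_unit_interval)
  qed
  obtain K where K: "continuous_map (prod_topology (prod_topology N N) unit_interval) N K"
    "\<And>a b. \<lbrakk>a \<in> topspace N; b \<in> topspace N\<rbrakk> \<Longrightarrow> K ((a, b), 0) = a"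
    "\<And>a b. \<lbrakk>a \<in> topspace N; b \<in> topspace N\<rbrakk> \<Longrightarrow> K ((a, b), 1) = b"
    "\<And>a t. \<lbrakk>a \<in> topspace N; t \<in> {0..1}\<rbrakk> \<Longrightarrow> K ((a, a), t) = a"
    by (rule abs_extensor_equiconnected[OF u N cardN]) (rule that)
  define c where "c w = max 0 (min 1 (3 * \<mu> w - 1))" for w
  define n' where "n' w = (if w \<in> V then K ((\<phi> (m w, r w), n w), c w) else n w)" for w
  define s' where "s' w = min (r w) (s w * max 0 (min 1 (1 - 3 * \<mu> w)))" for w
  have c01: "c w \<in> {0..1}" for w by (simp add: c_def)
  have s'0: "s' w \<ge> 0" "s' w \<le> s w" if "w \<in> topspace W" for w
    using in_top[OF that] by (auto simp: s'_def intro!: mult_nonneg_nonneg min.coboundedI2 mult_left_le)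
  have VN: "\<phi> (m w, r w) \<in> topspace N" "n w \<in> topspace N" if "w \<in> V" for w
    using \<phi>N[of w] in_top(4)[of w] that topN by (auto simp: V_def)
  have KN: "K z \<in> topspace N" if "z \<in> topspace (prod_topology (prod_topology N N) unit_interval)" for z
    using continuous_map_image_subset_topspace[OF K(1)] that by blast
  have n'N: "n' w \<in> topspace N" if "w \<in> topspace W" for w
    using KN[of "((\<phi> (m w, r w), n w), c w)"] VN[of w] c01 in_top(4)[OF that] by (simp add: n'_def)
  have n'_cont: "continuous_map W N n'"
  proof (rule continuous_map_sequentiallyI[OF W])
    show "n' w \<in> topspace N" if "w \<in> topspace W" for w by (rule n'N[OF that])
    fix w x assume w: "range w \<subseteq> topspace W" and lim: "limitin W w x sequentially"
    have x: "x \<in> topspace W" using lim limitin_topspace by metis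
    note l = lims[OF lim]
    show "\<exists>h. strict_mono (h :: nat \<Rightarrow> nat) \<and> limitin N (n' \<circ> w \<circ> h) (n' x) sequentially"
    proof (cases "x \<in> B0")
      case True
      then have n'x: "n' x = n x" using VB0 by (auto simp: n'_def)
      show ?thesis
      proof (rule subsequence_cases[of "\<lambda>k. w k \<in> V"])
        fix h :: "nat \<Rightarrow> nat" assume h: "strict_mono h" "\<And>k. w (h k) \<in> V"
        have "range (\<lambda>k. c (w (h k))) \<subseteq> {0..1}" using c01 by blast
        from unit_interval_subsequence[OF this] obtain h' t where h': "strict_mono (h' :: nat \<Rightarrow> nat)"
          and t: "t \<in> {0..1}" "((\<lambda>k. c (w (h k))) \<circ> h') \<longlonglongrightarrow> t" .
        have hh: "strict_mono (h \<circ> h')" using h(1) h' strict_mono_o by blast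
        define q where "q k = w (h (h' k))" for k
        have qV: "q k \<in> V" for k using h(2) by (simp add: q_def)
        have "limitin W q x sequentially"
          using limitin_subsequence[OF hh lim] unfolding q_def by (simp add: o_def)
        note lq = lims[OF this]
        have "limitin N (\<lambda>k. \<phi> (m (q k), r (q k))) (n x) sequentially"
          unfolding N_eq N.limitin_metric
        proof (intro conjI allI impI)
          show "n x \<in> N0" using in_top(4)[OF x] topN by simp
          fix e :: real assume e: "e > 0"
          have "\<forall>\<^sub>F k in sequentially. n (q k) \<in> N0 \<and> dN (n (q k)) (n x) < e / 2"
            using lq(5) half_gt_zero[OF e] unfolding N_eq N.limitin_metric by blast
          moreover have "\<forall>\<^sub>F k in sequentially. \<delta> (q k) < e / 2"
            by (rule order_tendstoD(2)[OF lq(6)]) (use True d(2)[OF x] e in simp)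
          ultimately show "\<forall>\<^sub>F k in sequentially. \<phi> (m (q k), r (q k)) \<in> N0 \<and> dN (\<phi> (m (q k), r (q k))) (n x) < e"
          proof eventually_elim
            case (elim k)
            have a: "\<phi> (m (q k), r (q k)) \<in> N0" "n (q k) \<in> N0" "n x \<in> N0"
              using VN[OF qV[of k]] in_top(4)[OF x] topN by auto
            have "dN (\<phi> (m (q k), r (q k))) (n x) \<le> dN (\<phi> (m (q k), r (q k))) (n (q k)) + dN (n (q k)) (n x)"
              using a by (intro N.triangle) auto
            also have "dN (\<phi> (m (q k), r (q k))) (n (q k)) < \<delta> (q k)" using qV[of k] by (simp add: V_def)
            finally show ?case using elim a by simp
          qed
        qed
        then have "limitin (prod_topology (prod_topology N N) unit_interval)
            (\<lambda>k. ((\<phi> (m (q k), r (q k)), n (q k)), c (q k))) ((n x, n x), t) sequentially"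
          using lq(5) t c01 by (auto simp: limitin_Pair limitin_unit_interval q_def o_def)
        from continuous_map_sequentiallyD[OF K(1) this]
        have "limitin N (\<lambda>k. n' (q k)) (n x) sequentially"
          using K(4)[OF in_top(4)[OF x] t(1)] qV by (simp add: n'_def)
        then show ?thesis using hh by (auto simp: q_def o_def n'x)
      next
        fix h :: "nat \<Rightarrow> nat" assume h: "strict_mono h" "\<And>k. w (h k) \<notin> V"
        then show ?thesis
          using limitin_subsequence[OF h(1) l(5)] by (intro exI[of _ h]) (simp add: o_def n'_def n'x[unfolded n'_def])
      qed
    next
      case False
      note ll = la_lim[OF lim False]
      have lc: "(\<lambda>k. c (w k)) \<longlonglongrightarrow> c x" unfolding c_def by (intro tendsto_intros ll)
      have "limitin N (\<lambda>k. n' (w k)) (n' x) sequentially"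
      proof (cases "x \<in> V")
        case True
        have ev: "\<forall>\<^sub>F k in sequentially. w k \<in> V" by (rule limitinD[OF lim V_open True])
        have "limitin N (\<lambda>k. \<phi> (m (w k), r (w k))) (\<phi> (m x, r x)) sequentially"
          by (rule \<phi>_limit[OF l(7)]) (use True in \<open>auto simp: V_def\<close>)
        then have "limitin (prod_topology (prod_topology N N) unit_interval)
            (\<lambda>k. ((\<phi> (m (w k), r (w k)), n (w k)), c (w k))) ((\<phi> (m x, r x), n x), c x) sequentially"
          using l(5) lc c01 by (auto simp: limitin_Pair limitin_unit_interval)
        from continuous_map_sequentiallyD[OF K(1) this]
        have *: "limitin N (\<lambda>k. K ((\<phi> (m (w k), r (w k)), n (w k)), c (w k))) (n' x) sequentially"
          using True by (simp add: n'_def)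
        show ?thesis
          by (rule limitin_transform_eventually[OF _ *]) (use ev in eventually_elim, simp add: n'_def)
      next
        case V: False
        then have n'x: "n' x = n x" by (simp add: n'_def)
        have "\<mu> x = 1" by (rule la1[OF x False V])
        then have "\<forall>\<^sub>F k in sequentially. \<mu> (w k) > 2/3" using order_tendstoD(1)[OF ll, of "2/3"] by simp
        then have "\<forall>\<^sub>F k in sequentially. n (w k) = n' (w k)"
        proof eventually_elim
          case (elim k)
          then have "c (w k) = 1" by (simp add: c_def)
          then show ?case using VN[of "w k"] K(3) by (simp add: n'_def)
        qed
        then show ?thesis using limitin_transform_eventually l(5) by (fastforce simp: n'x)
      qed
      then show ?thesis by (intro exI[of _ id]) (simp add: strict_mono_id o_def)
    qed
  qed
  have s'_cont: "continuous_map W unit_interval s'"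
  proof (rule continuous_map_sequentiallyI[OF W])
    show s'I: "s' w \<in> topspace unit_interval" if "w \<in> topspace W" for w
      using s'0[OF that] in_top(3)[OF that] by simp
    fix w x assume w: "range w \<subseteq> topspace W" and lim: "limitin W w x sequentially"
    have x: "x \<in> topspace W" using lim limitin_topspace by metis
    have wk: "w k \<in> topspace W" for k using w by blast
    note l = lims[OF lim]
    have "(\<lambda>k. s' (w k)) \<longlonglongrightarrow> s' x"
    proof (cases "x \<in> B0")
      case True
      then have "s x = 0" by (simp add: B0_def)
      then have "(\<lambda>k. s (w k)) \<longlonglongrightarrow> 0" "s' x = 0" using l(4) s'0[OF x] by auto
      then show ?thesis
        using s'0[OF wk] by (auto intro!: tendsto_sandwich[of "\<lambda>_. 0" "\<lambda>k. s' (w k)" _ "\<lambda>k. s (w k)"])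
    next
      case False
      show ?thesis unfolding s'_def by (intro tendsto_intros l la_lim[OF lim False])
    qed
    then show "\<exists>h. strict_mono (h :: nat \<Rightarrow> nat) \<and> limitin unit_interval (s' \<circ> w \<circ> h) (s' x) sequentially"
      using s'I[OF wk] s'I[OF x] by (intro exI[of _ id]) (auto simp: strict_mono_id o_def limitin_unit_interval)
  qed
  have cyl': "((m w, r w), (s' w, n' w)) \<in> topspace P" if w: "w \<in> topspace W" for w
    unfolding topspace_P
  proof (intro conjI impI)
    assume pos: "0 < s' w"
    have "w \<notin> B0" using pos s'0(2)[OF w] by (auto simp: B0_def)
    moreover have "\<mu> w < 1/3"
    proof (rule ccontr)
      assume "\<not> ?thesis"
      then have "max 0 (min 1 (1 - 3 * \<mu> w)) = 0" by simp
      then have "s' w \<le> 0" by (simp add: s'_def)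
      with pos show False by simp
    qed
    ultimately have "w \<in> V" "c w = 0" using la1[OF w] by (auto simp: c_def)
    then show "n' w = \<phi> (m w, r w)" using VN[of w] K(2) by (simp add: n'_def)
  next
    show "s' w \<in> {0..1}" using s'0[OF w] in_top(3)[OF w] by simp
    show "s' w \<le> r w" by (simp add: s'_def)
  qed (use in_top[OF w] n'N[OF w] in auto)
  show "\<exists>g. continuous_map W P g \<and> (\<forall>x\<in>B. g x = f x)"
  proof (intro exI[of _ "\<lambda>w. ((m w, r w), (s' w, n' w))"] conjI ballI)
    show "continuous_map W P (\<lambda>w. ((m w, r w), (s' w, n' w)))"
      using m(1) r(1) s'_cont n'_cont cyl'
      by (auto simp: P_def MI_def continuous_map_in_subtopology continuous_map_paired)
    fix b assume b: "b \<in> B"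
    then have bW: "b \<in> topspace W" using BW by blast
    have "s' b = s b \<and> n' b = n b"
    proof (cases "b \<in> B0")
      case True
      then have "s b = 0" "b \<notin> V" using VB0 by (auto simp: B0_def)
      then show ?thesis using s'0[OF bW] by (simp add: n'_def)
    next
      case False
      with b have "\<mu> b = 0" "b \<in> V" "s b > 0" using la0 BV in_top(3)[OF bW] by (auto simp: B0_def)
      then show ?thesis using B1[OF b] VN[of b] K(2) by (simp add: s'_def n'_def c_def)
    qed
    then show "((m b, r b), (s' b, n' b)) = f b" using fB[OF b] by simp
  qed
qed


lemma Z_subset: "Z \<subseteq> topspace P" by (auto simp: Z_def)

lemma closedin_Z: "closedin P Z"
  unfolding closedin_sequentially[OF metrizable_P]
proof (intro conjI allI impI)
  fix p l assume p: "range p \<subseteq> Z \<and> limitin P p l sequentially"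
  then have pP: "range p \<subseteq> topspace P" using Z_subset by blast
  have lP: "l \<in> topspace P" using p limitin_topspace by metis
  then obtain m r s n where l: "l = ((m, r), (s, n))" by (metis surj_pair)
  obtain a b c d where pk: "\<And>k. p k = ((a k, b k), (c k, d k))"
    by (rule that[of "\<lambda>k. fst (fst (p k))" "\<lambda>k. snd (fst (p k))" "\<lambda>k. fst (snd (p k))" "\<lambda>k. snd (snd (p k))"]) simp
  have z: "((a k, b k), (c k, d k)) \<in> Z" for k using p by (auto simp: pk[symmetric])
  show "l \<in> Z"
  proof (rule subsequence_cases[of "\<lambda>k. c k = 0"])
    fix h :: "nat \<Rightarrow> nat" assume h: "strict_mono h" "\<And>k. c (h k) = 0"
    have "limitin P (p \<circ> h) l sequentially" by (rule limitin_subsequence[OF h(1) conjunct2[OF p]])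
    moreover have "range (p \<circ> h) \<subseteq> topspace P" using pP by auto
    ultimately have "(\<lambda>k. c (h k)) \<longlonglongrightarrow> s" "limitin N (\<lambda>k. d (h k)) n sequentially"
      by (auto simp: l limitin_P_iff pk o_def)
    moreover have "d (h k) \<in> Y" for k using z[of "h k"] h(2) by (auto simp: Z_iff)
    ultimately have "s = 0" "n \<in> Y"
      using h(2) limitin_closedin[OF _ closed_Y, of "\<lambda>k. d (h k)" n sequentially]
      by (auto simp: LIMSEQ_const_iff)
    with lP show ?thesis by (simp add: l Z_iff)
  next
    fix h :: "nat \<Rightarrow> nat" assume h: "strict_mono h" "\<And>k. c (h k) \<noteq> 0"
    have "limitin P (p \<circ> h) l sequentially" by (rule limitin_subsequence[OF h(1) conjunct2[OF p]])
    moreover have "range (p \<circ> h) \<subseteq> topspace P" using pP by auto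
    ultimately have L: "limitin MI (\<lambda>k. (a (h k), b (h k))) (m, r) sequentially"
      "(\<lambda>k. c (h k)) \<longlonglongrightarrow> s" "limitin N (\<lambda>k. d (h k)) n sequentially"
      by (auto simp: l limitin_P_iff pk o_def)
    then have L': "limitin M (\<lambda>k. a (h k)) m sequentially" "(\<lambda>k. b (h k)) \<longlonglongrightarrow> r"
      by (auto simp: limitin_MI limitin_unit_interval)
    have zk: "c (h k) > 0" "c (h k) = b (h k)" "a (h k) \<in> X" "d (h k) = \<phi> (a (h k), b (h k))" "b (h k) \<in> {0..1}"
      "a (h k) \<in> topspace M" for k
      using z[of "h k"] h(2)[of k] by (auto simp: Z_iff topspace_P)
    have "m \<in> X" by (rule limitin_closedin[OF L'(1) X]) (use zk in auto)
    have "s = r" using L(2) L'(2) zk(2) by (auto intro: LIMSEQ_unique)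
    show ?thesis
    proof (cases "s = 0")
      case False
      with lP \<open>m \<in> X\<close> \<open>s = r\<close> show ?thesis by (auto simp: l Z_iff topspace_P)
    next
      case True
      with \<open>s = r\<close> \<open>m \<in> X\<close> have mX: "(m, r) \<in> X \<times> {0}" by simp
      have notX: "range (\<lambda>k. (a (h k), b (h k))) \<subseteq> topspace MI - X \<times> {0}"
      proof -
        have "(a (h k), b (h k)) \<in> topspace MI - X \<times> {0}" for k
          using zk(1)[of k] zk(2)[of k] zk(5)[of k] zk(6)[of k] by (auto simp: MI_def)
        then show ?thesis by (intro image_subsetI)
      qed
      obtain h' y where h': "strict_mono (h' :: nat \<Rightarrow> nat)" and y: "y \<in> Y"
        "limitin N (\<lambda>k. \<phi> (a (h (h' k)), b (h (h' k)))) y sequentially"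
        by (rule \<phi>_limit_X[OF L(1) mX notX])
      have "limitin N (\<lambda>k. d (h (h' k))) n sequentially"
        using limitin_subsequence[OF h' L(3)] by (simp add: o_def)
      then have "n = y" using y(2) zk(4) limitin_unique_metrizable[OF metrizable_N] by simp
      with lP True y(1) show ?thesis by (simp add: l Z_iff)
    qed
  qed
qed (rule Z_subset)

lemma homotopy_negligible_Z: "homotopy_negligible P Z"
  unfolding homotopy_negligible_def
proof (intro conjI closedin_Z)
  from Y obtain H where H: "continuous_map (prod_topology N unit_interval) N H"
    "\<And>x. x \<in> topspace N \<Longrightarrow> H (x, 0) = x"
    "\<And>x t. x \<in> topspace N \<Longrightarrow> t \<in> {0<..1} \<Longrightarrow> H (x, t) \<in> topspace N - Y"
    unfolding homotopy_negligible_def by metis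
  define G where "G z = (fst (fst z), (max 0 (fst (snd (fst z)) - snd z),
    H (snd (snd (fst z)), max 0 (snd z - fst (snd (fst z))))))" for z :: "(('a \<times> real) \<times> (real \<times> 'b)) \<times> real"
  let ?PI = "prod_topology P unit_interval"
  have GP: "G (p, t) \<in> topspace P \<and> (0 < t \<longrightarrow> G (p, t) \<notin> Z)" if p: "p \<in> topspace P" and t: "t \<in> {0..1}" for p t
  proof -
    from P_cases[OF p] obtain m r s n where *: "p = ((m, r), (s, n))" "m \<in> topspace M" "r \<in> {0..1}" "s \<in> {0..1}"
      "n \<in> topspace N" "s \<le> r" "s > 0 \<Longrightarrow> n = \<phi> (m, r)" by metis
    show ?thesis
    proof (cases "s < t")
      case True
      then have "H (n, t - s) \<in> topspace N - Y" using * t by (intro H(3)) auto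
      with True * show ?thesis by (simp add: G_def topspace_P Z_iff)
    next
      case False
      have "n \<notin> Y" if "s > 0" using \<phi>_notin_Y[of m r] * that by auto
      with False * t H(2)[of n] show ?thesis by (auto simp: G_def topspace_P Z_iff max_def)
    qed
  qed
  show "\<exists>H. continuous_map ?PI P H \<and> (\<forall>x\<in>topspace P. H (x, 0) = x) \<and>
      (\<forall>x\<in>topspace P. \<forall>t\<in>{0<..1}. H (x, t) \<in> topspace P - Z)"
  proof (intro exI[of _ G] conjI ballI)
    have P1: "continuous_map ?PI MI (\<lambda>z. fst (fst z))" and P2: "continuous_map ?PI unit_interval (\<lambda>z. fst (snd (fst z)))"
      and P3: "continuous_map ?PI N (\<lambda>z. snd (snd (fst z)))" and P4: "continuous_map ?PI unit_interval snd"
    proof -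
      have "continuous_map ?PI (prod_topology MI (prod_topology unit_interval N)) fst"
        using continuous_map_fst continuous_map_into_fulltopology unfolding P_def by blast
      then have "continuous_map ?PI MI (fst \<circ> fst)" and 2: "continuous_map ?PI (prod_topology unit_interval N) (snd \<circ> fst)"
        by (simp_all only: continuous_map_pairwise)
      moreover from 2 have "continuous_map ?PI unit_interval (fst \<circ> (snd \<circ> fst))" "continuous_map ?PI N (snd \<circ> (snd \<circ> fst))"
        by (simp_all only: continuous_map_pairwise)
      ultimately show "continuous_map ?PI MI (\<lambda>z. fst (fst z))" "continuous_map ?PI unit_interval (\<lambda>z. fst (snd (fst z)))"
        "continuous_map ?PI N (\<lambda>z. snd (snd (fst z)))" by (simp_all add: o_def)
    qed (rule continuous_map_snd)
    have e: "continuous_map ?PI euclideanreal (\<lambda>z. fst (snd (fst z)))" "continuous_map ?PI euclideanreal snd"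
      using P2 P4 continuous_map_into_fulltopology by blast+
    have in01: "fst (snd (fst z)) \<in> {0..1} \<and> snd z \<in> {0..1}" if "z \<in> topspace ?PI" for z
      using P2 P4 that by (auto simp: continuous_map_def Pi_iff)
    have m1: "continuous_map ?PI unit_interval (\<lambda>z. max 0 (fst (snd (fst z)) - snd z))"
      unfolding continuous_map_in_subtopology
    proof (intro conjI funcsetI)
      show "continuous_map ?PI euclideanreal (\<lambda>z. max 0 (fst (snd (fst z)) - snd z))"
        by (intro continuous_map_real_max continuous_map_diff e continuous_map_canonical_const)
      show "max 0 (fst (snd (fst z)) - snd z) \<in> {0..1}" if "z \<in> topspace ?PI" for z
        using in01[OF that] by auto
    qed
    have "continuous_map ?PI unit_interval (\<lambda>z. max 0 (snd z - fst (snd (fst z))))"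
      unfolding continuous_map_in_subtopology
    proof (intro conjI funcsetI)
      show "continuous_map ?PI euclideanreal (\<lambda>z. max 0 (snd z - fst (snd (fst z))))"
        by (intro continuous_map_real_max continuous_map_diff e continuous_map_canonical_const)
      show "max 0 (snd z - fst (snd (fst z))) \<in> {0..1}" if "z \<in> topspace ?PI" for z
        using in01[OF that] by auto
    qed
    with P3 have "continuous_map ?PI (prod_topology N unit_interval) (\<lambda>z. (snd (snd (fst z)), max 0 (snd z - fst (snd (fst z)))))"
      by (simp add: continuous_map_paired)
    from continuous_map_compose[OF this H(1)]
    have "continuous_map ?PI N (\<lambda>z. H (snd (snd (fst z)), max 0 (snd z - fst (snd (fst z)))))"
      by (simp add: o_def)
    with m1 have "continuous_map ?PI (prod_topology MI (prod_topology unit_interval N)) G"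
      using P1 unfolding G_def by (simp add: continuous_map_paired)
    moreover have "G \<in> topspace ?PI \<rightarrow> cyl"
    proof
      fix z assume "z \<in> topspace ?PI"
      then have "G (fst z, snd z) \<in> topspace P" using GP[of "fst z" "snd z"] by (auto simp: mem_Times_iff)
      then show "G z \<in> cyl" by (simp add: P_def)
    qed
    ultimately have "continuous_map ?PI (subtopology (prod_topology MI (prod_topology unit_interval N)) cyl) G"
      by (simp only: continuous_map_in_subtopology)
    then show "continuous_map ?PI P G" by (simp only: P_def)
  next
    fix p assume p: "p \<in> topspace P"
    from P_cases[OF p] obtain m r s n where "p = ((m, r), (s, n))" "s \<in> {0..1}" "n \<in> topspace N" by metis
    then show "G (p, 0) = p" using H(2)[of n] by (simp add: G_def)
    show "G (p, t) \<in> topspace P - Z" if "t \<in> {0<..1}" for t using GP[OF p, of t] that by auto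
  qed
qed

definition flow :: "(('a \<times> real) \<times> (real \<times> 'b)) \<times> real \<Rightarrow> ('a \<times> real) \<times> (real \<times> 'b)" where
  "flow = (\<lambda>(((m, r), (s, n)), t).
    ((m, r - t * s), ((1 - t) * s, if s > 0 then \<phi> (m, r - t * s) else n)))"

lemma approaching_flow: "approaching_map (prod_topology P unit_interval) (Z \<times> {0..1}) P Z flow"
proof (rule approaching_mapI[OF metrizable_prod_unit_interval[OF metrizable_P]])
  have *: "flow (p, t) \<in> topspace P - Z" if p: "p \<in> topspace P - Z" and t: "t \<in> {0..1}" for p t
  proof -
    from P_cases[of p] p obtain m r s n where *: "p = ((m, r), (s, n))" "m \<in> topspace M" "r \<in> {0..1}" "s \<in> {0..1}"
      "n \<in> topspace N" "s \<le> r" "s > 0 \<Longrightarrow> n = \<phi> (m, r)" by (metis DiffD1)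
    show ?thesis
    proof (cases "s = 0")
      case True
      with p * show ?thesis by (simp add: flow_def)
    next
      case False
      with * have s: "s > 0" by auto
      have ts: "t * s \<le> s" "0 \<le> t * s" using s t by (auto simp: mult_left_le_one_le)
      have r: "r - t * s \<in> {0..1}" "(1 - t) * s \<in> {0..1}" "(1 - t) * s \<le> r - t * s"
        using ts * by (auto simp: algebra_simps)
      have out: "(m, r - t * s) \<notin> X \<times> {0}"
      proof
        assume "(m, r - t * s) \<in> X \<times> {0}"
        then have "m \<in> X" "r = t * s" by auto
        then have "m \<in> X" "s = r" using ts \<open>s \<le> r\<close> by auto
        with p * s show False by (auto simp: Z_iff)
      qed
      have "\<not> (0 < (1 - t) * s \<and> (1 - t) * s = r - t * s \<and> m \<in> X)"
        using p * s by (auto simp: Z_iff algebra_simps)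
      then show ?thesis
        using \<phi>_notin_Y[OF *(2) r(1) out] * r s by (auto simp: flow_def topspace_P Z_iff)
    qed
  qed
  then show "flow z \<in> topspace P - Z" if "z \<in> topspace (prod_topology P unit_interval) - Z \<times> {0..1}" for z
    using that by (cases z) auto
  fix p z assume p: "range p \<subseteq> topspace (prod_topology P unit_interval) - Z \<times> {0..1}"
    and lim: "limitin (prod_topology P unit_interval) p z sequentially"
  have zP: "z \<in> topspace (prod_topology P unit_interval)" using lim limitin_topspace by metis
  obtain m r s n t where z: "z = (((m, r), (s, n)), t)" by (metis surj_pair)
  obtain a b c d e where pk: "\<And>k. p k = (((a k, b k), (c k, d k)), e k)"
    by (rule that[of "\<lambda>k. fst (fst (fst (p k)))" "\<lambda>k. snd (fst (fst (p k)))" "\<lambda>k. fst (snd (fst (p k)))"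
      "\<lambda>k. snd (snd (fst (p k)))" "\<lambda>k. snd (p k)"]) simp
  have pin: "((a k, b k), (c k, d k)) \<in> topspace P - Z \<and> e k \<in> {0..1}" for k
  proof -
    have "p k \<in> topspace (prod_topology P unit_interval) - Z \<times> {0..1}" by (rule subsetD[OF p rangeI])
    then show ?thesis by (auto simp: pk)
  qed
  have abcd: "a k \<in> topspace M" "b k \<in> {0..1}" "c k \<in> {0..1}" "d k \<in> topspace N" "c k \<le> b k" "e k \<in> {0..1}"
    "c k > 0 \<Longrightarrow> d k = \<phi> (a k, b k)" for k
    using pin[of k] by (auto simp: topspace_P)
  have zin: "m \<in> topspace M" "r \<in> {0..1}" "s \<in> {0..1}" "n \<in> topspace N" "s \<le> r" "t \<in> {0..1}"
    "s > 0 \<Longrightarrow> n = \<phi> (m, r)" using zP by (auto simp: z topspace_P)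
  have limP: "limitin P (\<lambda>k. ((a k, b k), (c k, d k))) ((m, r), (s, n)) sequentially" and te: "e \<longlonglongrightarrow> t"
    using lim by (auto simp: z pk limitin_Pair limitin_subtopology)
  have "range (\<lambda>k. ((a k, b k), (c k, d k))) \<subseteq> topspace P" using pin by blast
  from limP[unfolded limitin_P_iff[OF this]]
  have l: "limitin M a m sequentially" "b \<longlonglongrightarrow> r" "c \<longlonglongrightarrow> s" "limitin N d n sequentially"
    "limitin MI (\<lambda>k. (a k, b k)) (m, r) sequentially"
    by (auto simp: limitin_MI limitin_unit_interval)
  show "\<exists>h y. strict_mono (h :: nat \<Rightarrow> nat) \<and> limitin P (\<lambda>k. flow (p (h k))) y sequentially \<and>
      (if z \<in> Z \<times> {0..1} then y \<in> Z else y = flow z)"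
  proof (rule subsequence_cases[of "\<lambda>k. c k = 0"])
    fix h :: "nat \<Rightarrow> nat" assume h: "strict_mono h" "\<And>k. c (h k) = 0"
    have "(\<lambda>k. c (h k)) \<longlonglongrightarrow> s" using LIMSEQ_subseq_LIMSEQ[OF l(3) h(1)] by (simp add: o_def)
    then have "s = 0" using h(2) by (simp add: LIMSEQ_const_iff)
    have "flow (p (h k)) = ((a (h k), b (h k)), (c (h k), d (h k)))" for k
      by (simp add: pk flow_def h(2))
    moreover have "limitin P (\<lambda>k. ((a (h k), b (h k)), (c (h k), d (h k)))) ((m, r), (s, n)) sequentially"
      using limitin_subsequence[OF h(1) limP] by (simp add: o_def)
    ultimately show ?thesis
      using h(1) zin(6) \<open>s = 0\<close> by (intro exI[of _ h] exI[of _ "((m, r), (s, n))"]) (auto simp: z flow_def)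
  next
    fix h :: "nat \<Rightarrow> nat" assume h: "strict_mono h" "\<And>k. c (h k) \<noteq> 0"
    have c0: "c (h k) > 0" for k using h(2)[of k] abcd(3)[of "h k"] by auto
    define q where "q k = (a (h k), b (h k) - e (h k) * c (h k))" for k
    have lq: "limitin M (\<lambda>k. a (h k)) m sequentially" "(\<lambda>k. b (h k)) \<longlonglongrightarrow> r" "(\<lambda>k. c (h k)) \<longlonglongrightarrow> s"
      "(\<lambda>k. e (h k)) \<longlonglongrightarrow> t" "limitin N (\<lambda>k. d (h k)) n sequentially"
      "limitin MI (\<lambda>k. (a (h k), b (h k))) (m, r) sequentially"
      using limitin_subsequence[OF h(1) l(1)] limitin_subsequence[OF h(1) l(4)] limitin_subsequence[OF h(1) l(5)]
        LIMSEQ_subseq_LIMSEQ[OF l(2) h(1)] LIMSEQ_subseq_LIMSEQ[OF l(3) h(1)] LIMSEQ_subseq_LIMSEQ[OF te h(1)]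
      by (simp_all add: o_def)
    have fl: "flow (p (h k)) = (q k, ((1 - e (h k)) * c (h k), \<phi> (q k)))" for k
      using c0[of k] by (simp add: pk flow_def q_def)
    have flP: "flow (p (h k)) \<in> topspace P - Z" for k
      using *[of "((a (h k), b (h k)), (c (h k), d (h k)))" "e (h k)"] pin[of "h k"] by (simp add: pk)
    have qMI: "q k \<in> topspace MI - X \<times> {0}" for k
    proof -
      have "((a (h k), b (h k) - e (h k) * c (h k)), ((1 - e (h k)) * c (h k), \<phi> (q k))) \<in> topspace P"
        using flP[of k] by (simp add: fl q_def)
      then have "q k \<in> topspace MI" by (auto simp: topspace_P q_def MI_def)
      moreover have "q k \<notin> X \<times> {0}"
      proof
        assume "q k \<in> X \<times> {0}"
        then have aX: "a (h k) \<in> X" and bq: "b (h k) = e (h k) * c (h k)" by (auto simp: q_def)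
        have "e (h k) * c (h k) \<le> c (h k)" using abcd(6)[of "h k"] c0[of k] by (simp add: mult_left_le_one_le)
        with bq abcd(5)[of "h k"] have "c (h k) = b (h k)" by simp
        with aX c0[of k] pin[of "h k"] show False by (auto simp: Z_iff)
      qed
      ultimately show ?thesis by simp
    qed
    have "b (h k) - e (h k) * c (h k) \<in> {0..1}" for k using qMI[of k] by (auto simp: q_def MI_def)
    moreover have "(\<lambda>k. b (h k) - e (h k) * c (h k)) \<longlonglongrightarrow> r - t * s" by (intro tendsto_intros lq)
    moreover have ts: "t * s \<le> s" "0 \<le> t * s" using zin by (auto simp: mult_left_le_one_le)
    moreover have r01: "r - t * s \<in> {0..1}" using ts zin by auto
    ultimately have limq: "limitin MI q (m, r - t * s) sequentially"
      using lq(1) by (simp add: limitin_MI limitin_unit_interval q_def)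
    have lime: "(\<lambda>k. (1 - e (h k)) * c (h k)) \<longlonglongrightarrow> (1 - t) * s" by (intro tendsto_intros lq)
    have qrange: "range q \<subseteq> topspace MI - X \<times> {0}" by (intro image_subsetI qMI)
    have le: "(1 - t) * s \<le> r - t * s" "(1 - t) * s \<in> {0..1}" using zin ts by (auto simp: algebra_simps)
    show ?thesis
    proof (cases "(m, r - t * s) \<in> X \<times> {0}")
      case True
      then have "m \<in> X" "r = t * s" by auto
      then have rs: "s = r" "(1 - t) * s = 0" using ts zin by (auto simp: algebra_simps)
      obtain h' y where h': "strict_mono (h' :: nat \<Rightarrow> nat)" and y: "y \<in> Y"
        "limitin N (\<lambda>k. \<phi> (q (h' k))) y sequentially"
        by (rule \<phi>_limit_X[OF limq True qrange])
      have yN: "y \<in> topspace N" using y(2) limitin_topspace by metis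
      have inP: "((m, r - t * s), ((1 - t) * s, y)) \<in> topspace P" "((m, r - t * s), ((1 - t) * s, y)) \<in> Z"
        using zin rs r01 yN y(1) by (auto simp: topspace_P Z_iff)
      have rng: "range (\<lambda>k. flow (p (h (h' k)))) \<subseteq> topspace P" using flP by blast
      have "limitin P (\<lambda>k. flow (p (h (h' k)))) ((m, r - t * s), ((1 - t) * s, y)) sequentially"
        unfolding limitin_P_iff[OF rng]
        using inP(1) limitin_subsequence[OF h' limq] LIMSEQ_subseq_LIMSEQ[OF lime h'] y(2)
        by (simp add: fl o_def)
      moreover have "((m, r), (s, n)) \<in> Z"
      proof (cases "s = 0")
        case False
        then show ?thesis using zP rs \<open>m \<in> X\<close> zin by (auto simp: z Z_iff)
      next
        case s0: True
        with rs \<open>m \<in> X\<close> have mr: "(m, r) \<in> X \<times> {0}" by simp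
        have "(a (h k), b (h k)) \<in> topspace MI - X \<times> {0}" for k
          using abcd[of "h k"] c0[of k] by (auto simp: MI_def)
        then have "range (\<lambda>k. (a (h k), b (h k))) \<subseteq> topspace MI - X \<times> {0}" by (intro image_subsetI)
        from \<phi>_limit_X[OF lq(6) mr this] obtain g y' where g: "strict_mono (g :: nat \<Rightarrow> nat)" and y': "y' \<in> Y"
          "limitin N (\<lambda>k. \<phi> (a (h (g k)), b (h (g k)))) y' sequentially" by metis
        have "limitin N (\<lambda>k. d (h (g k))) n sequentially" using limitin_subsequence[OF g lq(5)] by (simp add: o_def)
        then have "n = y'" using y'(2) abcd(7)[OF c0] limitin_unique_metrizable[OF metrizable_N] by simp
        with y'(1) s0 zP show ?thesis by (auto simp: z Z_iff)
      qed
      ultimately show ?thesis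
        using inP(2) zin(6) h(1) h' by (intro exI[of _ "h \<circ> h'"] exI[of _ "((m, r - t * s), ((1 - t) * s, y))"])
          (auto simp: z strict_mono_o)
    next
      case False
      have lphi: "limitin N (\<lambda>k. \<phi> (q k)) (\<phi> (m, r - t * s)) sequentially" by (rule \<phi>_limit[OF limq False])
      have inP: "((m, r - t * s), ((1 - t) * s, \<phi> (m, r - t * s))) \<in> topspace P"
        using zin r01 le \<phi>_notin_Y[OF zin(1) r01 False] by (auto simp: topspace_P)
      have rng: "range (\<lambda>k. flow (p (h k))) \<subseteq> topspace P" using flP by blast
      have L: "limitin P (\<lambda>k. flow (p (h k))) ((m, r - t * s), ((1 - t) * s, \<phi> (m, r - t * s))) sequentially"
        unfolding limitin_P_iff[OF rng] using inP limq lime lphi by (simp add: fl)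
      have "if z \<in> Z \<times> {0..1} then ((m, r - t * s), ((1 - t) * s, \<phi> (m, r - t * s))) \<in> Z
          else ((m, r - t * s), ((1 - t) * s, \<phi> (m, r - t * s))) = flow z"
      proof (cases "s = 0")
        case True
        then have mr: "(m, r) \<notin> X \<times> {0}" using False by simp
        have "limitin N (\<lambda>k. \<phi> (a (h k), b (h k))) (\<phi> (m, r)) sequentially" by (rule \<phi>_limit[OF lq(6) mr])
        then have "n = \<phi> (m, r)"
          using lq(5) abcd(7)[OF c0] limitin_unique_metrizable[OF metrizable_N] by simp
        moreover from this have "n \<notin> Y" using \<phi>_notin_Y[OF zin(1,2) mr] by simp
        ultimately show ?thesis using True by (simp add: z Z_iff flow_def)
      next
        case s: False
        with zin have s: "s > 0" by auto
        show ?thesis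
        proof (cases "((m, r), (s, n)) \<in> Z")
          case True
          with s have "s = r" "m \<in> X" by (auto simp: Z_iff)
          with False have "r - t * s \<noteq> 0" by auto
          moreover have "(1 - t) * s = r - t * s" using \<open>s = r\<close> by (simp add: algebra_simps)
          ultimately have "0 < (1 - t) * s" using r01 by auto
          then show ?thesis using True inP \<open>s = r\<close> \<open>m \<in> X\<close> zin(6) by (auto simp: z Z_iff algebra_simps)
        next
          case False
          with s show ?thesis by (simp add: z flow_def)
        qed
      qed
      then show ?thesis
        using h(1) L by (intro exI[of _ h] exI[of _ "((m, r - t * s), ((1 - t) * s, \<phi> (m, r - t * s)))"]) simp
    qed
  qed
qed

definition proj where "proj p = snd (snd (flow (p, 1)))"

definition start where "start x = ((fst x, 1), (1 - snd x, \<phi> (fst x, 1)))" for x :: "'a \<times> real"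

definition base where "base = (SOME m. m \<in> topspace M)"

definition finish where "finish n = ((base, 0 :: real), (0 :: real, n))" for n :: 'b

lemma base: "base \<in> topspace M"
  using abs_extensor_nonempty[OF M] by (auto simp: base_def some_in_eq)

lemma continuous_map_into_P:
  assumes "continuous_map S M f1" "continuous_map S unit_interval f2" "continuous_map S unit_interval f3"
    "continuous_map S N f4"
    "\<And>x. x \<in> topspace S \<Longrightarrow> f3 x \<le> f2 x" "\<And>x. x \<in> topspace S \<Longrightarrow> f3 x > 0 \<Longrightarrow> f4 x = \<phi> (f1 x, f2 x)"
  shows "continuous_map S P (\<lambda>x. ((f1 x, f2 x), (f3 x, f4 x)))"
  unfolding P_def continuous_map_in_subtopology
proof
  show "continuous_map S (prod_topology MI (prod_topology unit_interval N)) (\<lambda>x. ((f1 x, f2 x), (f3 x, f4 x)))"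
    using assms(1-4) by (simp add: MI_def continuous_map_paired)
  show "(\<lambda>x. ((f1 x, f2 x), (f3 x, f4 x))) \<in> topspace S \<rightarrow> cyl"
    using assms(5,6) by (auto simp: cyl_def)
qed

lemma continuous_P_components:
  "continuous_map P M (\<lambda>p. fst (fst p))" "continuous_map P unit_interval (\<lambda>p. snd (fst p))"
  "continuous_map P unit_interval (\<lambda>p. fst (snd p))" "continuous_map P N (\<lambda>p. snd (snd p))"
proof -
  have "continuous_map P (prod_topology MI (prod_topology unit_interval N)) id"
    unfolding P_def by (simp add: continuous_map_from_subtopology)
  then have 1: "continuous_map P MI (fst \<circ> id)" and 2: "continuous_map P (prod_topology unit_interval N) (snd \<circ> id)"
    by (simp_all only: continuous_map_pairwise)
  from 1 have "continuous_map P M (fst \<circ> (fst \<circ> id))" "continuous_map P unit_interval (snd \<circ> (fst \<circ> id))"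
    by (simp_all only: MI_def continuous_map_pairwise)
  moreover from 2 have "continuous_map P unit_interval (fst \<circ> (snd \<circ> id))" "continuous_map P N (snd \<circ> (snd \<circ> id))"
    by (simp_all only: continuous_map_pairwise)
  ultimately show "continuous_map P M (\<lambda>p. fst (fst p))" "continuous_map P unit_interval (\<lambda>p. snd (fst p))"
    "continuous_map P unit_interval (\<lambda>p. fst (snd p))" "continuous_map P N (\<lambda>p. snd (snd p))"
    by (simp_all add: o_def)
qed

lemma continuous_finish: "continuous_map N P finish"
  unfolding finish_def by (rule continuous_map_into_P) (use base in \<open>auto simp: continuous_map_id[unfolded id_def]\<close>)

lemma finish_in_Z: "n \<in> topspace N \<Longrightarrow> finish n \<in> Z \<longleftrightarrow> n \<in> Y"
  using base by (auto simp: finish_def Z_iff topspace_P)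

lemma proj_finish: "proj (finish n) = n"
  by (simp add: proj_def finish_def flow_def)

lemma closed_embedding_finish: "closed_embedding N P finish"
  unfolding closed_embedding_def
proof
  show "embedding_map N P finish"
    by (rule section_imp_embedding_map, unfold section_map_def retraction_maps_def,
      intro exI[of _ "\<lambda>p. snd (snd p)"] conjI ballI continuous_P_components continuous_finish)
      (simp add: finish_def)
  have *: "closedin P {p \<in> topspace P. fst (fst p) = base}"
    using base by (intro closedin_continuous_maps_eq[of M] metrizable_imp_Hausdorff_space metrizable_M continuous_P_components) simp
  have "closedin P {p \<in> topspace P. snd (fst p) = 0}" "closedin P {p \<in> topspace P. fst (snd p) = 0}"
    by (intro closedin_continuous_maps_eq[of unit_interval] metrizable_imp_Hausdorff_space metrizable_unit_interval
      continuous_P_components; simp)+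
  from closedin_Int[OF * closedin_Int[OF this]]
  show "closedin P (finish ` topspace N)"
  proof (rule back_subst[of "closedin P"])
    show "{p \<in> topspace P. fst (fst p) = base} \<inter> ({p \<in> topspace P. snd (fst p) = 0} \<inter> {p \<in> topspace P. fst (snd p) = 0})
        = finish ` topspace N" (is "?L = ?R")
    proof
      show "?R \<subseteq> ?L" using base by (auto simp: finish_def topspace_P)
      show "?L \<subseteq> ?R"
      proof
        fix p assume p: "p \<in> ?L"
        then have "p \<in> topspace P" by simp
        then obtain m r s n where "p = ((m, r), (s, n))" "n \<in> topspace N" by (rule P_cases)
        with p show "p \<in> ?R" by (auto simp: finish_def)
      qed
    qed
  qed
qed

lemma proj_finish_homotopic: "approaching_homotopic P Z P Z (finish \<circ> proj) id"
proof -
  obtain c where c: "continuous_map (prod_topology M unit_interval) M c"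
    "\<And>x. x \<in> topspace M \<Longrightarrow> c (x, 0) = x" "\<And>x. x \<in> topspace M \<Longrightarrow> c (x, 1) = base"
    by (rule abs_extensor_contractible[OF u M cardM base]) (rule that)
  let ?PI = "prod_topology P unit_interval"
  define L where "L = {p \<in> topspace P. fst (snd p) = 0}"
  have L: "closedin P L"
    unfolding L_def by (intro closedin_continuous_maps_eq[of unit_interval] metrizable_imp_Hausdorff_space
      metrizable_unit_interval continuous_P_components) simp
  define f1 where "f1 p = flow (p, 1)" for p
  have f1: "approaching_map P Z P Z f1"
    unfolding f1_def by (rule approaching_map_slice[OF approaching_flow]) simp
  have f1L: "f1 p \<in> L" if "p \<in> topspace P - Z" for p
    using approaching_map_into[OF f1 that] by (cases p) (auto simp: L_def f1_def flow_def split: prod.splits)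
  have f1': "approaching_map P Z (subtopology P L) Z f1" by (rule approaching_map_into_subspace[OF f1 L f1L])
  have h1: "approaching_homotopic P Z P Z id f1"
  proof (rule approaching_homotopicI[OF approaching_flow])
    fix p assume "p \<in> topspace P - Z"
    then obtain m r s n where "p = ((m, r), (s, n))" "s > 0 \<Longrightarrow> n = \<phi> (m, r)" by (metis P_cases DiffD1)
    then show "flow (p, 0) = id p" by (simp add: flow_def)
  qed (simp add: f1_def)
  define \<Psi> where "\<Psi> z = ((c (fst (fst (fst z)), snd z), (1 - snd z) * snd (fst (fst z))), (0 :: real, snd (snd (fst z))))"
    for z :: "(('a \<times> real) \<times> (real \<times> 'b)) \<times> real"
  have cf: "continuous_map ?PI A (\<lambda>z. f (fst z))" if "continuous_map P A f" for A and f :: "_ \<Rightarrow> 'c"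
    using continuous_map_compose[OF continuous_map_fst that] by (simp add: o_def)
  have cf': "continuous_map ?PI A (\<lambda>z. f (fst z))" if "continuous_map P A f" for A and f :: "_ \<Rightarrow> real"
    using continuous_map_compose[OF continuous_map_fst that] by (simp add: o_def)
  have \<Psi>c: "continuous_map ?PI P \<Psi>"
    unfolding \<Psi>_def
  proof (rule continuous_map_into_P)
    have "continuous_map ?PI (prod_topology M unit_interval) (\<lambda>z. (fst (fst (fst z)), snd z))"
      using continuous_map_compose[OF continuous_map_fst continuous_P_components(1)]
      by (simp add: continuous_map_paired continuous_map_snd o_def)
    from continuous_map_compose[OF this c(1)] show "continuous_map ?PI M (\<lambda>z. c (fst (fst (fst z)), snd z))"
      by (simp add: o_def)
    have 1: "continuous_map ?PI unit_interval (\<lambda>z. snd (fst (fst z)))" "continuous_map ?PI unit_interval snd"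
      using cf'[OF continuous_P_components(2)] continuous_map_snd by auto
    then have "continuous_map ?PI euclideanreal (\<lambda>z. (1 - snd z) * snd (fst (fst z)))"
      by (intro continuous_map_real_mult continuous_map_diff) (auto simp: continuous_map_in_subtopology)
    moreover have "(1 - snd z) * snd (fst (fst z)) \<in> {0..1}" if "z \<in> topspace ?PI" for z
    proof -
      have "snd z \<in> {0..1}" "snd (fst (fst z)) \<in> {0..1}" using 1 that by (auto simp: continuous_map_def Pi_iff)
      then show ?thesis by (auto intro!: mult_le_one)
    qed
    ultimately show b: "continuous_map ?PI unit_interval (\<lambda>z. (1 - snd z) * snd (fst (fst z)))"
      by (auto simp: continuous_map_in_subtopology)
    show "0 \<le> (1 - snd z) * snd (fst (fst z))" if "z \<in> topspace ?PI" for z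
      using b that by (auto simp: continuous_map_def Pi_iff)
    show "continuous_map ?PI N (\<lambda>z. snd (snd (fst z)))"
      using continuous_map_compose[OF continuous_map_fst continuous_P_components(4)] by (simp add: o_def)
  qed auto
  have \<Psi>Z: "\<Psi> (p, t) \<in> Z \<longleftrightarrow> p \<in> Z" if "p \<in> L" "t \<in> {0..1}" for p t
  proof -
    have "(p, t) \<in> topspace ?PI" using that by (auto simp: L_def)
    then have "\<Psi> (p, t) \<in> topspace P" using \<Psi>c by (auto simp: continuous_map_def Pi_iff)
    with that show ?thesis by (cases p) (auto simp: \<Psi>_def Z_iff L_def)
  qed
  have "approaching_map (prod_topology (subtopology P L) unit_interval) (Z \<times> {0..1}) P Z \<Psi>"
  proof (rule approaching_map_continuous)
    have "prod_topology (subtopology P L) unit_interval = subtopology ?PI (L \<times> UNIV)"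
      by (simp add: subtopology_Times)
    then show "continuous_map (prod_topology (subtopology P L) unit_interval) P \<Psi>"
      using \<Psi>c by (simp add: continuous_map_from_subtopology)
  qed (use \<Psi>Z in auto)
  then have "approaching_homotopic (subtopology P L) Z P Z id (finish \<circ> (\<lambda>p. snd (snd p)))"
  proof (rule approaching_homotopicI)
    fix p assume "p \<in> topspace (subtopology P L) - Z"
    then obtain m r n where p: "p = ((m, r), (0, n))" "m \<in> topspace M"
      by (cases p) (auto simp: L_def topspace_P)
    show "\<Psi> (p, 0) = id p" using p c(2) by (simp add: \<Psi>_def)
    show "\<Psi> (p, 1) = (finish \<circ> (\<lambda>p. snd (snd p))) p" using p c(3) by (simp add: \<Psi>_def finish_def)
  qed
  from approaching_homotopic_comp_right[OF metrizable_P this f1']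
  have "approaching_homotopic P Z P Z f1 (finish \<circ> proj)"
    by (rule approaching_homotopic_cong) (auto simp: f1_def proj_def)
  from approaching_homotopic_sym[OF metrizable_P approaching_homotopic_trans[OF metrizable_P h1 this]]
  show ?thesis .
qed

lemma approaching_proj: "approaching_map P Z N Y proj"
proof -
  let ?L = "{p \<in> topspace P. fst (snd p) = 0}"
  have L: "closedin P ?L"
    by (intro closedin_continuous_maps_eq[of unit_interval] metrizable_imp_Hausdorff_space
      metrizable_unit_interval continuous_P_components) simp
  have f1: "approaching_map P Z P Z (\<lambda>p. flow (p, 1))"
    by (rule approaching_map_slice[OF approaching_flow]) simp
  have "approaching_map P Z (subtopology P ?L) Z (\<lambda>p. flow (p, 1))"
  proof (rule approaching_map_into_subspace[OF f1 L])
    show "flow (p, 1) \<in> ?L" if "p \<in> topspace P - Z" for p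
      using approaching_map_into[OF f1 that] by (cases p) (auto simp: flow_def split: prod.splits)
  qed
  moreover have "approaching_map (subtopology P ?L) Z N Y (\<lambda>p. snd (snd p))"
  proof (rule approaching_map_continuous)
    show "continuous_map (subtopology P ?L) N (\<lambda>p. snd (snd p))"
      by (rule continuous_map_from_subtopology[OF continuous_P_components(4)])
  qed (auto simp: Z_iff)
  ultimately have "approaching_map P Z N Y ((\<lambda>p. snd (snd p)) \<circ> (\<lambda>p. flow (p, 1)))"
    by (rule approaching_map_compose)
  then show ?thesis by (simp add: proj_def[abs_def] o_def)
qed

lemma continuous_start: "continuous_map MI P start"
  unfolding start_def
proof (rule continuous_map_into_P)
  show "continuous_map MI M fst" unfolding MI_def by (rule continuous_map_fst)
  then have "continuous_map MI (subtopology MI (topspace MI - X \<times> {0})) (\<lambda>x. (fst x, 1))"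
    by (auto simp: MI_def continuous_map_in_subtopology continuous_map_paired)
  moreover have "continuous_map (subtopology MI (topspace MI - X \<times> {0})) N \<phi>"
    using \<phi> by (auto simp: approaching_map_def MI_def continuous_map_in_subtopology)
  ultimately show "continuous_map MI N (\<lambda>x. \<phi> (fst x, 1))"
    using continuous_map_compose by (fastforce simp: o_def)
  have "continuous_map MI euclideanreal snd"
    unfolding MI_def using continuous_map_snd continuous_map_into_fulltopology by blast
  then show "continuous_map MI unit_interval (\<lambda>x. 1 - snd x)"
    by (auto simp: continuous_map_in_subtopology MI_def intro!: continuous_map_diff)
qed (auto simp: MI_def)

lemma start_in_Z: "x \<in> topspace MI \<Longrightarrow> start x \<in> Z \<longleftrightarrow> x \<in> X \<times> {0}"
proof -
  assume x: "x \<in> topspace MI"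
  then have "start x \<in> topspace P" using continuous_start by (auto simp: continuous_map_def)
  moreover have "\<phi> (fst x, 1) \<notin> Y" using \<phi>_notin_Y[of "fst x" 1] x by (auto simp: MI_def)
  ultimately show ?thesis using x by (auto simp: start_def Z_iff MI_def mem_Times_iff)
qed

lemma proj_start: "x \<in> topspace MI \<Longrightarrow> proj (start x) = \<phi> x"
  by (cases x) (auto simp: proj_def start_def flow_def MI_def)

end

section \<open>Fine shape classes as left fractions\<close>

lemma homeomorphic_maps_image_iff:
  assumes h: "homeomorphic_maps P P' c c'" and Z: "Z \<subseteq> topspace P"
  shows "x \<in> topspace P \<Longrightarrow> c x \<in> c ` Z \<longleftrightarrow> x \<in> Z" "y \<in> topspace P' \<Longrightarrow> y \<in> c ` Z \<longleftrightarrow> c' y \<in> Z"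
proof -
  have c'c: "c' (c x) = x" if "x \<in> topspace P" for x using h that by (auto simp: homeomorphic_maps_def)
  have cc': "c (c' y) = y" if "y \<in> topspace P'" for y using h that by (auto simp: homeomorphic_maps_def)
  show 1: "c x \<in> c ` Z \<longleftrightarrow> x \<in> Z" if "x \<in> topspace P" for x
    using c'c that Z by (metis image_iff subsetD)
  show "y \<in> c ` Z \<longleftrightarrow> c' y \<in> Z" if y: "y \<in> topspace P'"
  proof -
    have "c' y \<in> topspace P"
      using h y by (auto simp: homeomorphic_maps_def dest: continuous_map_funspace)
    from 1[OF this] show ?thesis by (simp add: cc'[OF y])
  qed
qed

lemma approaching_map_homeomorphic:
  assumes h: "homeomorphic_maps P P' c c'" and Z: "Z \<subseteq> topspace P"
  shows "approaching_map P Z P' (c ` Z) c" "approaching_map P' (c ` Z) P Z c'"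
proof -
  have cc: "continuous_map P P' c" "continuous_map P' P c'" using h by (auto simp: homeomorphic_maps_def)
  show "approaching_map P Z P' (c ` Z) c"
    by (rule approaching_map_continuous[OF cc(1)]) (simp_all add: homeomorphic_maps_image_iff(1)[OF h Z])
  show "approaching_map P' (c ` Z) P Z c'"
    by (rule approaching_map_continuous[OF cc(2)]) (use homeomorphic_maps_image_iff(2)[OF h Z] in blast)+
qed

locale hull_cylinder = cylinder T M X N "d ` topspace B" \<phi>
  for T :: "'u itself" and M :: "'a topology" and X :: "'a set" and N :: "'u topology"
    and d :: "'u \<Rightarrow> 'u" and B :: "'u topology" and \<phi> :: "'a \<times> real \<Rightarrow> 'u" +
  fixes P' :: "'u topology" and c c'
  assumes hull: "AR_hull B (N, d)" and copy: "homeomorphic_maps P P' c c'"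
begin

definition S where "S = subtopology P' (c ` Z)"

lemma copy_map: "homeomorphic_map P P' c"
  using copy homeomorphic_maps_map by blast

lemma Z_P': "c ` Z \<subseteq> topspace P'"
  using copy Z_subset by (auto simp: homeomorphic_maps_def continuous_map_def)

lemma topspace_S: "topspace S = c ` Z"
  using Z_P' by (auto simp: S_def)

lemma AR_hull_S: "AR_hull S (P', id)"
proof -
  have "embedding_map S P' id"
    unfolding embedding_map_def topspace_S by (simp add: S_def)
  then show ?thesis
    using homotopy_negligible_homeomorphic[OF homotopy_negligible_Z copy_map]
      abs_extensor_homeomorphic[OF abs_extensor_P copy_map]
    by (simp add: AR_hull_def topspace_S AR_space_iff_abs_extensor)
qed

lemma metrizable_S: "metrizable_space S"
  unfolding S_def using AR_hullD(2)[OF AR_hull_S] metrizable_space_subtopology by auto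

lemma continuous_map_into_S:
  assumes "continuous_map A P f" "\<And>x. x \<in> topspace A \<Longrightarrow> f x \<in> Z"
  shows "continuous_map A S (\<lambda>x. c (f x))"
proof -
  have "continuous_map A P' (c \<circ> f)"
    using copy assms(1) continuous_map_compose by (auto simp: homeomorphic_maps_def)
  with assms(2) show ?thesis by (auto simp: S_def continuous_map_in_subtopology o_def)
qed

definition j where "j = c \<circ> (finish \<circ> d)"

lemma d_N: "x \<in> topspace B \<Longrightarrow> d x \<in> topspace N"
  using AR_hullD(6)[OF hull] by auto

lemma j_in: "x \<in> topspace B \<Longrightarrow> finish (d x) \<in> Z"
  using finish_in_Z d_N by blast

lemma closed_embedding_j: "closed_embedding B S j"
proof -
  have 1: "closed_embedding B N d"
    using AR_hullD(3,5)[OF hull] by (simp add: closed_embedding_def)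
  have e: "embedding_map B P (finish \<circ> d)"
    using 1 closed_embedding_finish embedding_map_compose by (auto simp: closed_embedding_def)
  have cl: "closedin P (finish ` (d ` topspace B))"
  proof -
    have "homeomorphic_map N (subtopology P (finish ` topspace N)) finish" "closedin P (finish ` topspace N)"
      using closed_embedding_finish by (auto simp: closed_embedding_def embedding_map_def)
    moreover have "closedin N (d ` topspace B)" using 1 by (simp add: closed_embedding_def)
    ultimately show ?thesis
      using homeomorphic_map_closedness[OF _ closedin_subset] closedin_trans_full by blast
  qed
  have "closed_embedding B P' (c \<circ> (finish \<circ> d))"
    by (rule closed_embedding_homeomorphic[OF _ copy_map]) (use e cl in \<open>simp add: closed_embedding_def image_comp\<close>)
  moreover have "j ` topspace B \<subseteq> c ` Z" using j_in by (auto simp: j_def)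
  ultimately show ?thesis
    unfolding j_def[symmetric] closed_embedding_def S_def
    by (auto simp: embedding_map_in_subtopology intro: closedin_subset_topspace)
qed

lemma continuous_j: "continuous_map B S j"
  using closed_embedding_j embedding_map_continuous by (auto simp: closed_embedding_def)

lemma hull_map_j: "hull_map B (N, d) S (P', id) j (c \<circ> finish)"
  unfolding hull_map_iff
proof (intro conjI ballI)
  show "continuous_map (fst (N, d)) (fst (P', id)) (c \<circ> finish)"
    using copy continuous_finish continuous_map_compose by (auto simp: homeomorphic_maps_def)
  have "c (finish n) \<in> c ` Z \<longleftrightarrow> finish n \<in> Z" if "n \<in> topspace N" for n
    using homeomorphic_maps_image_iff(1)[OF copy Z_subset] funcset_mem[OF continuous_map_funspace[OF continuous_finish] that]
    by blast
  then show "{x \<in> topspace (fst (N, d)). (c \<circ> finish) x \<in> snd (P', id) ` topspace S} = snd (N, d) ` topspace B"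
    using finish_in_Z d_N by (auto simp: topspace_S)
qed (simp add: j_def)

definition inv_j where "inv_j = proj \<circ> c'"

lemma inv_j: "hull_approaching S (P', id) B (N, d) inv_j"
  unfolding hull_approaching_def inv_j_def
  using approaching_map_compose[OF approaching_map_homeomorphic(2)[OF copy Z_subset] approaching_proj]
  by (simp add: topspace_S)

lemma j_inv: "hull_homotopic S (P', id) S (P', id) ((c \<circ> finish) \<circ> inv_j) id"
proof -
  note c' = approaching_map_homeomorphic[OF copy Z_subset]
  have met: "metrizable_space P'" using AR_hullD(2)[OF AR_hull_S] by simp
  have "approaching_homotopic P' (c ` Z) P' (c ` Z) (c \<circ> ((finish \<circ> proj) \<circ> c')) (c \<circ> (id \<circ> c'))"
    by (intro approaching_homotopic_comp_left[OF _ c'(1)] approaching_homotopic_comp_right[OF met _ c'(2)]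
      proj_finish_homotopic)
  then have "approaching_homotopic P' (c ` Z) P' (c ` Z) ((c \<circ> finish) \<circ> inv_j) id"
    by (rule approaching_homotopic_cong) (use copy in \<open>auto simp: inv_j_def homeomorphic_maps_def\<close>)
  then show ?thesis by (simp add: hull_homotopic_def topspace_S)
qed

lemma isomorphism_j: "isomorphism_in fSh B S (induced_fsh_class B S j)"
proof -
  have "inv_j ((c \<circ> finish) n) = n" if "n \<in> topspace N" for n
  proof -
    have "finish n \<in> topspace P" using continuous_finish that by (auto simp: continuous_map_def)
    then show ?thesis using copy proj_finish by (simp add: inv_j_def homeomorphic_maps_def)
  qed
  then have "hull_homotopic B (N, d) B (N, d) id (inv_j \<circ> (c \<circ> finish))"
    using hull_approaching_id[OF u hull] unfolding hull_homotopic_def hull_approaching_def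
    by (intro approaching_homotopic_refl) auto
  from hull_homotopic_sym[OF hull this] show ?thesis
    unfolding induced_fsh_class_eq[OF u hull AR_hull_S continuous_j hull_map_j]
    by (intro fsh_isomorphismI[OF u hull AR_hull_S hull_map_approaching[OF hull_map_j] inv_j _ j_inv])
qed

end

lemma fsh_left_fraction:
  fixes A B :: "'u topology"
  assumes u: "(UNIV :: real set) \<lesssim> (UNIV :: 'u set)"
    and A: "metrizable_space A" and B: "metrizable_space B" and \<alpha>: "\<alpha> \<in> Hom fSh A B"
  obtains S j v where "metrizable_space S" "closed_embedding B S j"
    "isomorphism_in fSh B S (induced_fsh_class B S j)" "continuous_map A S v"
    "induced_fsh_class A S v = Compose fSh A B S (induced_fsh_class B S j) \<alpha>"
proof -
  obtain M e where m: "AR_hull A (M, e)" using AR_hull_exists[OF u A] by (metis surj_pair)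
  obtain N d where n: "AR_hull B (N, d)" using AR_hull_exists[OF u B] by (metis surj_pair)
  note M = AR_hullD[OF m, simplified] and N = AR_hullD[OF n, simplified]
  let ?MI = "prod_topology M unit_interval" and ?e = "\<lambda>x. (e x, 0 :: real)"
  have card: "topspace M \<lesssim> (UNIV :: 'u set)" "topspace N \<lesssim> (UNIV :: 'u set)"
    by (auto intro: subset_imp_lepoll)
  have "closed_embedding A ?MI ?e"
  proof -
    have "embedding_map M ?MI (\<lambda>x. (x, 0))"
      by (rule section_imp_embedding_map, unfold section_map_def retraction_maps_def,
        intro exI[of _ fst] conjI ballI continuous_map_fst) (auto simp: continuous_map_paired continuous_map_id[unfolded id_def])
    then have "embedding_map A ?MI ?e" using embedding_map_compose[OF M(3)] by (fastforce simp: o_def)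
    moreover have "?e ` topspace A = e ` topspace A \<times> {0}" by auto
    ultimately show ?thesis using M(5) by (auto simp: closed_embedding_def intro: closedin_prod_unit_interval)
  qed
  moreover have eimg: "?e ` topspace A = e ` topspace A \<times> {0}" by auto
  moreover have aeMI: "abs_extensor TYPE('u) ?MI" by (rule abs_extensor_prod[OF M(1) abs_extensor_unit_interval])
  moreover have "topspace ?MI \<lesssim> (UNIV :: 'u set)" using lepoll_prod_unit_interval[OF u card(1)] by simp
  ultimately obtain M' :: "'u topology" and b where b: "homeomorphic_map ?MI M' b" and m': "AR_hull A (M', b \<circ> ?e)"
    using copy_hull[of ?MI A ?e] homotopy_negligible_zero[OF M(5)] by (metis (no_types))
  from b obtain b' where bb: "homeomorphic_maps ?MI M' b b'" using homeomorphic_map_maps by blast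
  have sub: "e ` topspace A \<times> {0} \<subseteq> topspace ?MI" using M(6) by auto
  have bimg: "(b \<circ> ?e) ` topspace A = b ` (e ` topspace A \<times> {0})" using eimg by (metis image_comp)
  from fsh_Hom_representative[OF u \<alpha> m' n] obtain \<psi> where \<psi>: "hull_approaching A (M', b \<circ> ?e) B (N, d) \<psi>"
    and \<alpha>': "\<alpha> = fsh_class A B ((M', b \<circ> ?e), (N, d), \<psi>)" .
  note bap = approaching_map_homeomorphic[OF bb sub]
  define \<phi> where "\<phi> = \<psi> \<circ> b"
  have \<phi>: "approaching_map ?MI (e ` topspace A \<times> {0}) N (d ` topspace B) \<phi>"
    unfolding \<phi>_def using approaching_map_compose[OF bap(1) \<psi>[unfolded hull_approaching_def fst_conv snd_conv bimg]] .
  interpret C: cylinder "TYPE('u)" M "e ` topspace A" N "d ` topspace B" \<phi>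
    by unfold_locales (use u M N card \<phi> in auto)
  from copy_AR[OF C.abs_extensor_P C.card_P] obtain P' :: "'u topology" and c where "homeomorphic_map C.P P' c" by metis
  then obtain c' where c: "homeomorphic_maps C.P P' c c'" using homeomorphic_map_maps by blast
  interpret H: hull_cylinder "TYPE('u)" M "e ` topspace A" N d B \<phi> P' c c'
    by unfold_locales (use n c in auto)
  define v where "v x = c (C.start (?e x))" for x
  have ec: "continuous_map A ?MI ?e"
    using embedding_map_continuous[OF M(3)] by (simp add: continuous_map_paired)
  have eMI: "?e x \<in> topspace C.MI" if "x \<in> topspace A" for x
    using ec that unfolding C.MI_def continuous_map_def by blast
  have vc: "continuous_map A H.S v"
    unfolding v_def
  proof (rule H.continuous_map_into_S)
    show "continuous_map A C.P (\<lambda>x. C.start (?e x))"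
      using continuous_map_compose[OF ec[folded C.MI_def] C.continuous_start] by (simp add: o_def)
    show "C.start (?e x) \<in> C.Z" if "x \<in> topspace A" for x
      using C.start_in_Z[OF eMI[OF that]] that by auto
  qed
  have b': "continuous_map M' ?MI b'" "\<And>x. x \<in> topspace ?MI \<Longrightarrow> b' (b x) = x" "\<And>x. x \<in> topspace M' \<Longrightarrow> b (b' x) = x"
    using bb by (auto simp: homeomorphic_maps_def)
  have b'MI: "b' x \<in> topspace ?MI" if "x \<in> topspace M'" for x using b'(1) that unfolding continuous_map_def by blast
  have hmv: "hull_map A (M', b \<circ> ?e) H.S (P', id) v (c \<circ> (C.start \<circ> b'))"
    unfolding hull_map_iff
  proof (intro conjI ballI)
    show "continuous_map (fst (M', b \<circ> ?e)) (fst (P', id)) (c \<circ> (C.start \<circ> b'))"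
      using c b'(1) C.continuous_start unfolding C.MI_def homeomorphic_maps_def
      by (auto intro!: continuous_map_compose)
    show "(c \<circ> (C.start \<circ> b')) (snd (M', b \<circ> ?e) x) = snd (P', id) (v x)" if "x \<in> topspace A" for x
      using b'(2)[OF eMI[OF that, unfolded C.MI_def]] by (simp add: v_def)
    have 1: "c (C.start (b' x)) \<in> c ` C.Z \<longleftrightarrow> x \<in> b ` (e ` topspace A \<times> {0})" if x: "x \<in> topspace M'" for x
    proof -
      have "C.start (b' x) \<in> topspace C.P"
        using funcset_mem[OF continuous_map_funspace[OF C.continuous_start[unfolded C.MI_def]] b'MI[OF x]] .
      then have "c (C.start (b' x)) \<in> c ` C.Z \<longleftrightarrow> C.start (b' x) \<in> C.Z"
        by (rule homeomorphic_maps_image_iff(1)[OF c C.Z_subset])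
      also have "\<dots> \<longleftrightarrow> b' x \<in> e ` topspace A \<times> {0}"
        by (rule C.start_in_Z[unfolded C.MI_def, OF b'MI[OF x]])
      also have "\<dots> \<longleftrightarrow> x \<in> b ` (e ` topspace A \<times> {0})"
        using homeomorphic_maps_image_iff(2)[OF bb sub x] by simp
      finally show ?thesis .
    qed
    have 2: "b ` (e ` topspace A \<times> {0}) \<subseteq> topspace M'"
      using AR_hullD(6)[OF m'] unfolding snd_conv fst_conv bimg .
    show "{x \<in> topspace (fst (M', b \<circ> ?e)). (c \<circ> (C.start \<circ> b')) x \<in> snd (P', id) ` topspace H.S} =
        snd (M', b \<circ> ?e) ` topspace A"
      unfolding fst_conv snd_conv bimg H.topspace_S image_id comp_apply id_apply
    proof
      show "{x \<in> topspace M'. c (C.start (b' x)) \<in> c ` C.Z} \<subseteq> b ` (e ` topspace A \<times> {0})"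
        using 1 by auto
      show "b ` (e ` topspace A \<times> {0}) \<subseteq> {x \<in> topspace M'. c (C.start (b' x)) \<in> c ` C.Z}"
        by (rule subsetI) (simp only: mem_Collect_eq 1 subsetD[OF 2] simp_thms)
    qed
  qed
  note ap = hull_map_approaching[OF hmv] hull_map_approaching[OF H.hull_map_j]
  have "hull_homotopic A (M', b \<circ> ?e) H.S (P', id) (((c \<circ> C.finish) \<circ> H.inv_j) \<circ> (c \<circ> (C.start \<circ> b'))) (id \<circ> (c \<circ> (C.start \<circ> b')))"
    by (rule hull_homotopic_comp_right[OF m' H.j_inv ap(1)])
  then have "hull_homotopic A (M', b \<circ> ?e) H.S (P', id) ((c \<circ> C.finish) \<circ> \<psi>) (c \<circ> (C.start \<circ> b'))"
    unfolding hull_homotopic_def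
  proof (rule approaching_homotopic_cong)
    fix x assume "x \<in> topspace (fst (M', b \<circ> ?e)) - snd (M', b \<circ> ?e) ` topspace A"
    then have x: "x \<in> topspace M'" by simp
    have "C.start (b' x) \<in> topspace C.P"
      using C.continuous_start b'MI[OF x] unfolding C.MI_def continuous_map_def by blast
    then have "c' (c (C.start (b' x))) = C.start (b' x)" using c by (simp add: homeomorphic_maps_def)
    moreover have "C.proj (C.start (b' x)) = \<psi> x"
      using C.proj_start[unfolded C.MI_def, OF b'MI[OF x]] b'(3)[OF x] by (simp add: \<phi>_def)
    ultimately show "((c \<circ> C.finish) \<circ> \<psi>) x = (((c \<circ> C.finish) \<circ> H.inv_j) \<circ> (c \<circ> (C.start \<circ> b'))) x"
      by (simp add: H.inv_j_def)
  qed simp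
  then have "fsh_class A H.S ((M', b \<circ> ?e), (P', id), c \<circ> (C.start \<circ> b')) =
      fsh_class A H.S ((M', b \<circ> ?e), (P', id), (c \<circ> C.finish) \<circ> \<psi>)"
    using fsh_class_eq_iff[OF u m' H.AR_hull_S hull_approaching_compose[OF \<psi> ap(2)] ap(1)] by simp
  then have "induced_fsh_class A H.S v = Compose fSh A B H.S (induced_fsh_class B H.S H.j) \<alpha>"
    unfolding \<alpha>' induced_fsh_class_eq[OF u m' H.AR_hull_S vc hmv]
      induced_fsh_class_eq[OF u n H.AR_hull_S H.continuous_j H.hull_map_j]
      fsh_Compose_class[OF u m' n H.AR_hull_S \<psi> ap(2)] .
  with H.metrizable_S H.closed_embedding_j H.isomorphism_j vc show thesis by (rule that)
qed

lemma fsh_equal_imp_coequalized: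
  fixes A B :: "'u topology"
  assumes u: "(UNIV :: real set) \<lesssim> (UNIV :: 'u set)"
    and A: "metrizable_space A" and B: "metrizable_space B"
    and f0: "continuous_map A B f0" and f1: "continuous_map A B f1"
    and eq: "induced_fsh_class A B f0 = induced_fsh_class A B f1"
  obtains S j where "metrizable_space S" "closed_embedding B S j"
    "isomorphism_in fSh B S (induced_fsh_class B S j)" "homotopic_with (\<lambda>_. True) A S (j \<circ> f0) (j \<circ> f1)"
proof -
  obtain M e where m: "AR_hull A (M, e)" using AR_hull_exists[OF u A] by (metis surj_pair)
  obtain N d where n: "AR_hull B (N, d)" using AR_hull_exists[OF u B] by (metis surj_pair)
  note M = AR_hullD[OF m, simplified] and N = AR_hullD[OF n, simplified]
  have e: "continuous_map A M e" and d: "continuous_map B N d"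
    using M(3) N(3) embedding_map_continuous by auto
  obtain g0 where g0: "hull_map A (M, e) B (N, d) f0 g0" using hull_map_exists[OF m n f0] .
  obtain g1 where g1: "hull_map A (M, e) B (N, d) f1 g1" using hull_map_exists[OF m n f1] .
  have "hull_homotopic A (M, e) B (N, d) g0 g1"
    using eq fsh_class_eq_iff[OF u m n hull_map_approaching[OF g0] hull_map_approaching[OF g1]]
    unfolding induced_fsh_class_eq[OF u m n f0 g0] induced_fsh_class_eq[OF u m n f1 g1] by simp
  then have "approaching_homotopic M (e ` topspace A) N (d ` topspace B) g0 g1" by (simp add: hull_homotopic_def)
  then obtain \<Psi> where \<Psi>: "approaching_map (prod_topology M unit_interval) (e ` topspace A \<times> {0..1}) N (d ` topspace B) \<Psi>"
    "\<And>x. x \<in> topspace M - e ` topspace A \<Longrightarrow> \<Psi> (x, 0) = g0 x"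
    "\<And>x. x \<in> topspace M - e ` topspace A \<Longrightarrow> \<Psi> (x, 1) = g1 x"
    by (rule approaching_homotopicE) blast
  from M(4) obtain H where H: "continuous_map (prod_topology M unit_interval) M H"
    "\<And>x. x \<in> topspace M \<Longrightarrow> H (x, 0) = x"
    "\<And>x t. x \<in> topspace M \<Longrightarrow> t \<in> {0<..1} \<Longrightarrow> H (x, t) \<in> topspace M - e ` topspace A"
    unfolding homotopy_negligible_def by metis
  let ?MI = "prod_topology M unit_interval" and ?AI = "e ` topspace A \<times> {0..1::real}"
  define \<theta> where "\<theta> z = (H (fst (fst z), snd z), snd (fst z))" for z :: "('u \<times> real) \<times> real"
  have \<theta>c: "continuous_map (prod_topology ?MI unit_interval) ?MI \<theta>"
  proof -
    have p: "continuous_map (prod_topology ?MI unit_interval) M (\<lambda>z. fst (fst z))"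
      "continuous_map (prod_topology ?MI unit_interval) unit_interval (\<lambda>z. snd (fst z))"
      using continuous_map_compose[OF continuous_map_fst continuous_map_fst]
        continuous_map_compose[OF continuous_map_fst continuous_map_snd] by (auto simp: o_def)
    then have "continuous_map (prod_topology ?MI unit_interval) ?MI (\<lambda>z. (fst (fst z), snd z))"
      by (simp add: continuous_map_paired continuous_map_snd)
    from continuous_map_compose[OF this H(1)] p(2) show ?thesis
      unfolding \<theta>_def by (simp add: continuous_map_paired o_def)
  qed
  have "approaching_map (prod_topology ?MI unit_interval) (?AI \<times> {0}) ?MI ?AI \<theta>"
  proof (rule approaching_map_continuous[OF \<theta>c])
    fix z assume "z \<in> topspace (prod_topology ?MI unit_interval) - ?AI \<times> {0}"
    then obtain x t r where z: "z = ((x, t), r)" "x \<in> topspace M" "t \<in> {0..1}" "r \<in> {0..1}" "r > 0 \<or> x \<notin> e ` topspace A"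
      by force
    show "\<theta> z \<notin> ?AI"
    proof (cases "r > 0")
      case True
      with z H(3)[of x r] show ?thesis by (auto simp: \<theta>_def)
    next
      case False
      with z H(2)[of x] show ?thesis by (auto simp: \<theta>_def)
    qed
  next
    fix z assume "z \<in> topspace (prod_topology ?MI unit_interval) \<inter> ?AI \<times> {0}"
    then show "\<theta> z \<in> ?AI" using H(2) by (auto simp: \<theta>_def)
  qed
  from approaching_map_compose[OF this \<Psi>(1)]
  have \<phi>: "approaching_map (prod_topology ?MI unit_interval) (?AI \<times> {0}) N (d ` topspace B) (\<Psi> \<circ> \<theta>)" .
  have card: "topspace N \<lesssim> (UNIV :: 'u set)" "topspace M \<lesssim> (UNIV :: 'u set)"
    by (auto intro: subset_imp_lepoll)
  have cardMI: "topspace ?MI \<lesssim> (UNIV :: 'u set)" using lepoll_prod_unit_interval[OF u card(2)] by simp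
  have aeMI: "abs_extensor TYPE('u) ?MI" by (rule abs_extensor_prod[OF M(1) abs_extensor_unit_interval])
  have clAI: "closedin ?MI ?AI" using M(5) by (intro closedin_prod_unit_interval) auto
  interpret C: cylinder "TYPE('u)" ?MI ?AI N "d ` topspace B" "\<Psi> \<circ> \<theta>"
    by unfold_locales (use u aeMI cardMI clAI N(1,4) card(1) \<phi> in auto)
  from copy_AR[OF C.abs_extensor_P C.card_P] obtain P' :: "'u topology" and c where "homeomorphic_map C.P P' c" by metis
  then obtain c' where c: "homeomorphic_maps C.P P' c c'" using homeomorphic_map_maps by blast
  interpret H: hull_cylinder "TYPE('u)" ?MI ?AI N d B "\<Psi> \<circ> \<theta>" P' c c'
    by unfold_locales (use n c in auto)
  have eM: "e x \<in> topspace M" if "x \<in> topspace A" for x using M(6) that by auto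
  let ?AxI = "prod_topology A unit_interval"
  have fe: "continuous_map ?AxI M (\<lambda>z. e (fst z))"
    using continuous_map_compose[OF continuous_map_fst e] by (simp add: o_def)
  have path: "homotopic_with (\<lambda>_. True) A H.S (\<lambda>x. c (((e x, \<epsilon>), 1), (1, (\<Psi> \<circ> \<theta>) ((e x, \<epsilon>), 1)))) (H.j \<circ> f)"
    if \<epsilon>: "\<epsilon> \<in> {0, 1}" and f: "continuous_map A B f" and g: "hull_map A (M, e) B (N, d) f g"
      and \<Psi>g: "\<And>x. x \<in> topspace M - e ` topspace A \<Longrightarrow> \<Psi> (x, \<epsilon>) = g x" for \<epsilon> :: real and f g
  proof -
    have \<epsilon>I: "\<epsilon> \<in> {0..1}" using \<epsilon> by auto
    have gc: "continuous_map M N g" and ge: "\<And>x. x \<in> topspace A \<Longrightarrow> g (e x) = d (f x)"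
      using g by (auto simp: hull_map_iff)
    have fB: "f x \<in> topspace B" if "x \<in> topspace A" for x using f that by (auto simp: continuous_map_def)
    have \<phi>g: "(\<Psi> \<circ> \<theta>) ((e x, \<epsilon>), r) = g (H (e x, r))" if "x \<in> topspace A" "r \<in> {0<..1}" for x r
      using \<Psi>g[OF H(3)[OF eM[OF that(1)] that(2)]] by (simp add: \<theta>_def)
    define k where "k z = (((e (fst z), \<epsilon>), snd z), (snd z, g (H (e (fst z), snd z))))" for z :: "'u \<times> real"
    have "continuous_map ?AxI C.P k"
      unfolding k_def
    proof (rule C.continuous_map_into_P)
      show "continuous_map ?AxI ?MI (\<lambda>z. (e (fst z), \<epsilon>))" using fe \<epsilon>I by (simp add: continuous_map_paired)
      have "continuous_map ?AxI ?MI (\<lambda>z. (e (fst z), snd z))"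
        using fe by (simp add: continuous_map_paired continuous_map_snd)
      from continuous_map_compose[OF continuous_map_compose[OF this H(1)] gc]
      show "continuous_map ?AxI N (\<lambda>z. g (H (e (fst z), snd z)))" by (simp add: o_def)
      show "g (H (e (fst z), snd z)) = (\<Psi> \<circ> \<theta>) ((e (fst z), \<epsilon>), snd z)"
        if "z \<in> topspace ?AxI" "0 < snd z" for z
        using \<phi>g[of "fst z" "snd z"] that by auto
    qed (auto simp: continuous_map_snd)
    moreover from this have "k z \<in> C.Z" if z: "z \<in> topspace ?AxI" for z
    proof -
      have "k z \<in> topspace C.P" using \<open>continuous_map ?AxI C.P k\<close> z unfolding continuous_map_def by blast
      moreover have "g (H (e (fst z), snd z)) \<in> d ` topspace B" if "snd z = 0"
        using that z H(2)[OF eM] ge fB by auto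
      ultimately show ?thesis using z \<epsilon>I unfolding k_def C.Z_iff by (auto simp: less_le)
    qed
    ultimately have "continuous_map ?AxI H.S (\<lambda>z. c (k z))" by (rule H.continuous_map_into_S)
    from homotopic_withI_prod[OF this]
    have 1: "homotopic_with (\<lambda>_. True) A H.S (\<lambda>x. c (k (x, 0))) (\<lambda>x. c (k (x, 1)))" .
    obtain \<gamma> where \<gamma>: "continuous_map (prod_topology ?MI unit_interval) ?MI \<gamma>"
      "\<And>x. x \<in> topspace ?MI \<Longrightarrow> \<gamma> (x, 0) = x" "\<And>x. x \<in> topspace ?MI \<Longrightarrow> \<gamma> (x, 1) = C.base"
      by (rule abs_extensor_contractible[OF u aeMI cardMI C.base]) (rule that)
    define l where "l z = ((\<gamma> ((e (fst z), \<epsilon>), snd z), 0 :: real), (0 :: real, d (f (fst z))))" for z :: "'u \<times> real"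
    have lP: "continuous_map ?AxI C.P l"
      unfolding l_def
    proof (rule C.continuous_map_into_P)
      have "continuous_map ?AxI (prod_topology ?MI unit_interval) (\<lambda>z. ((e (fst z), \<epsilon>), snd z))"
        using fe \<epsilon>I by (simp add: continuous_map_paired continuous_map_snd)
      from continuous_map_compose[OF this \<gamma>(1)] show "continuous_map ?AxI ?MI (\<lambda>z. \<gamma> ((e (fst z), \<epsilon>), snd z))"
        by (simp add: o_def)
      show "continuous_map ?AxI N (\<lambda>z. d (f (fst z)))"
        using continuous_map_compose[OF continuous_map_compose[OF continuous_map_fst f] d] by (simp add: o_def)
    qed auto
    moreover have "l z \<in> C.Z" if z: "z \<in> topspace ?AxI" for z
    proof -
      have "l z \<in> topspace C.P" using lP z unfolding continuous_map_def by blast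
      moreover have "d (f (fst z)) \<in> d ` topspace B" using z fB by auto
      moreover obtain a b where "\<gamma> ((e (fst z), \<epsilon>), snd z) = (a, b)" by (metis surj_pair)
      ultimately show ?thesis unfolding l_def C.Z_iff by auto
    qed
    ultimately have "continuous_map ?AxI H.S (\<lambda>z. c (l z))" by (rule H.continuous_map_into_S)
    from homotopic_withI_prod[OF this]
    have 2: "homotopic_with (\<lambda>_. True) A H.S (\<lambda>x. c (l (x, 0))) (\<lambda>x. c (l (x, 1)))" .
    have kl: "c (k (x, 0)) = c (l (x, 0))" if x: "x \<in> topspace A" for x
      using \<gamma>(2)[of "(e x, \<epsilon>)"] H(2)[OF eM[OF x]] eM[OF x] ge[OF x] \<epsilon>I by (simp add: k_def l_def)
    have "homotopic_with (\<lambda>_. True) A H.S (\<lambda>x. c (k (x, 0))) (\<lambda>x. c (l (x, 1)))"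
      by (rule homotopic_with_eq[OF 2]) (auto simp: kl)
    from homotopic_with_trans[OF homotopic_with_symD[OF 1] this] show ?thesis
    proof (rule homotopic_with_eq)
      fix x assume x: "x \<in> topspace A"
      show "c (((e x, \<epsilon>), 1), (1, (\<Psi> \<circ> \<theta>) ((e x, \<epsilon>), 1))) = c (k (x, 1))"
        using \<phi>g[OF x, of 1] by (simp add: k_def)
      show "(H.j \<circ> f) x = c (l (x, 1))"
        using \<gamma>(3)[of "(e x, \<epsilon>)"] eM[OF x] \<epsilon>I by (simp add: l_def H.j_def C.finish_def)
    qed simp
  qed
  define k where "k z = (((e (fst z), snd z), 1 :: real), (1 :: real, (\<Psi> \<circ> \<theta>) ((e (fst z), snd z), 1)))" for z :: "'u \<times> real"
  have c1: "continuous_map ?AxI (prod_topology ?MI unit_interval) (\<lambda>z. ((e (fst z), snd z), 1))"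
    using fe by (simp add: continuous_map_paired continuous_map_snd)
  have "continuous_map ?AxI C.P k"
    unfolding k_def
  proof (rule C.continuous_map_into_P)
    show "continuous_map ?AxI ?MI (\<lambda>z. (e (fst z), snd z))"
      using fe by (simp add: continuous_map_paired continuous_map_snd)
    let ?D = "subtopology (prod_topology ?MI unit_interval) (topspace (prod_topology ?MI unit_interval) - ?AI \<times> {0})"
    have "continuous_map ?AxI ?D (\<lambda>z. ((e (fst z), snd z), 1))"
      unfolding continuous_map_in_subtopology
    proof (intro conjI c1 funcsetI DiffI)
      fix z assume "z \<in> topspace ?AxI"
      then show "((e (fst z), snd z), 1) \<in> topspace (prod_topology ?MI unit_interval)"
        by (rule funcset_mem[OF continuous_map_funspace[OF c1]])
    qed simp
    moreover have "continuous_map ?D N (\<Psi> \<circ> \<theta>)"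
      using \<phi> by (auto simp: approaching_map_def continuous_map_in_subtopology)
    ultimately show "continuous_map ?AxI N (\<lambda>z. (\<Psi> \<circ> \<theta>) ((e (fst z), snd z), 1))"
      using continuous_map_compose by (fastforce simp: o_def)
  qed auto
  moreover from this have "k z \<in> C.Z" if z: "z \<in> topspace ?AxI" for z
  proof -
    have "k z \<in> topspace C.P" using \<open>continuous_map ?AxI C.P k\<close> z unfolding continuous_map_def by blast
    then show ?thesis using z unfolding k_def C.Z_iff by auto
  qed
  ultimately have "continuous_map ?AxI H.S (\<lambda>z. c (k z))" by (rule H.continuous_map_into_S)
  from homotopic_withI_prod[OF this]
  have mid: "homotopic_with (\<lambda>_. True) A H.S (\<lambda>x. c (((e x, 0), 1), (1, (\<Psi> \<circ> \<theta>) ((e x, 0), 1))))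
      (\<lambda>x. c (((e x, 1), 1), (1, (\<Psi> \<circ> \<theta>) ((e x, 1), 1))))"
    by (simp add: k_def)
  have "homotopic_with (\<lambda>_. True) A H.S (H.j \<circ> f0) (H.j \<circ> f1)"
    using homotopic_with_trans[OF homotopic_with_symD[OF path[OF _ f0 g0 \<Psi>(2)]]
      homotopic_with_trans[OF mid path[OF _ f1 g1 \<Psi>(3)]]] by simp
  with H.metrizable_S H.closed_embedding_j H.isomorphism_j show thesis by (rule that)
qed

section \<open>Localization by left fractions\<close>

lemma (in category) isomorphism_in_compose:
  assumes "X \<in> Obj C" "Y \<in> Obj C" "Z \<in> Obj C" "isomorphism_in C X Y f" "isomorphism_in C Y Z g"
  shows "isomorphism_in C X Z (Compose C X Y Z g f)"
proof -
  from assms obtain f' g' where f: "f \<in> Hom C X Y" "f' \<in> Hom C Y X" "Compose C X Y X f' f = Ident C X"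
    "Compose C Y X Y f f' = Ident C Y"
    and g: "g \<in> Hom C Y Z" "g' \<in> Hom C Z Y" "Compose C Y Z Y g' g = Ident C Y" "Compose C Z Y Z g g' = Ident C Z"
    unfolding isomorphism_in_def by blast
  note o = assms(1-3)
  have gf: "Compose C X Y Z g f \<in> Hom C X Z" "Compose C Z Y X f' g' \<in> Hom C Z X"
    using Compose_in_Hom o f g by blast+
  have "Compose C X Z X (Compose C Z Y X f' g') (Compose C X Y Z g f) =
      Compose C X Y X f' (Compose C X Z Y g' (Compose C X Y Z g f))"
    using Compose_assoc[of X Z Y X] o gf(1) f(2) g(2) by simp
  also have "Compose C X Z Y g' (Compose C X Y Z g f) = f"
    using Compose_assoc[of X Y Z Y f g g'] Compose_Ident_left[of X Y f] o f g by simp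
  finally have 1: "Compose C X Z X (Compose C Z Y X f' g') (Compose C X Y Z g f) = Ident C X" using f by simp
  have "Compose C Z X Z (Compose C X Y Z g f) (Compose C Z Y X f' g') =
      Compose C Z Y Z g (Compose C Z X Y f (Compose C Z Y X f' g'))"
    using Compose_assoc[of Z X Y Z] o gf(2) f(1) g(1) by simp
  also have "Compose C Z X Y f (Compose C Z Y X f' g') = g'"
    using Compose_assoc[of Z Y X Y g' f' f] Compose_Ident_left[of Z Y g'] o f g by simp
  finally have 2: "Compose C Z X Z (Compose C X Y Z g f) (Compose C Z Y X f' g') = Ident C Z" using g by simp
  show ?thesis unfolding isomorphism_in_def using gf 1 2 by blast
qed

lemma (in category) isomorphism_in_cancel:
  assumes o: "W \<in> Obj C" "X \<in> Obj C" "Y \<in> Obj C" and f: "isomorphism_in C X Y f"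
    and a: "a \<in> Hom C W X" and b: "b \<in> Hom C W X" and eq: "Compose C W X Y f a = Compose C W X Y f b"
  shows "a = b"
proof -
  from f obtain g where g: "f \<in> Hom C X Y" "g \<in> Hom C Y X" "Compose C X Y X g f = Ident C X"
    unfolding isomorphism_in_def by blast
  have "Compose C W Y X g (Compose C W X Y f a) = a" if "a \<in> Hom C W X" for a
    using Compose_assoc[of W X Y X a f g] Compose_Ident_left[of W X a] o g that by simp
  with a b eq show ?thesis by metis
qed

lemma (in category) isomorphism_in_solve:
  assumes o: "W \<in> Obj C" "X \<in> Obj C" "Y \<in> Obj C" and f: "isomorphism_in C X Y f" and b: "b \<in> Hom C W Y"
  obtains a where "a \<in> Hom C W X" "Compose C W X Y f a = b"
proof -
  from f obtain g where g: "f \<in> Hom C X Y" "g \<in> Hom C Y X" "Compose C Y X Y f g = Ident C Y"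
    unfolding isomorphism_in_def by blast
  have "Compose C W X Y f (Compose C W Y X g b) = b"
    using Compose_assoc[of W Y X Y b g f] Compose_Ident_left[of W Y b] o g b by simp
  with Compose_in_Hom[OF o(1,3,2) b g(2)] show thesis by (rule that)
qed

text \<open>
  A fraction \<open>(u, i)\<close> is evaluated to the solution \<open>\<alpha>\<close> of \<open>Q(i) \<alpha> = Q(u)\<close>. The last two
  assumptions say that \<open>Q\<close> is full and faithful up to fractions; they entail the left
  invertibility conditions.
\<close>

locale fraction_functor = C: category C + D: category D
  for C :: "('o, 'm) cat" and D :: "('o, 'n) cat" +
  fixes \<Sigma> :: "'o \<Rightarrow> 'o \<Rightarrow> 'm set" and Q :: "'o \<Rightarrow> 'o \<Rightarrow> 'm \<Rightarrow> 'n"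
  assumes Obj_eq: "Obj D = Obj C"
    and Q_Hom: "\<lbrakk>X \<in> Obj C; Y \<in> Obj C; f \<in> Hom C X Y\<rbrakk> \<Longrightarrow> Q X Y f \<in> Hom D X Y"
    and Q_Compose: "\<lbrakk>X \<in> Obj C; Y \<in> Obj C; Z \<in> Obj C; f \<in> Hom C X Y; g \<in> Hom C Y Z\<rbrakk> \<Longrightarrow>
      Q X Z (Compose C X Y Z g f) = Compose D X Y Z (Q Y Z g) (Q X Y f)"
    and Q_Ident: "X \<in> Obj C \<Longrightarrow> Q X X (Ident C X) = Ident D X"
    and \<Sigma>_Hom: "\<lbrakk>X \<in> Obj C; Y \<in> Obj C; i \<in> \<Sigma> X Y\<rbrakk> \<Longrightarrow> i \<in> Hom C X Y"
    and \<Sigma>_Ident: "X \<in> Obj C \<Longrightarrow> Ident C X \<in> \<Sigma> X X"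
    and \<Sigma>_Compose: "\<lbrakk>X \<in> Obj C; Y \<in> Obj C; Z \<in> Obj C; i \<in> \<Sigma> X Y; j \<in> \<Sigma> Y Z\<rbrakk> \<Longrightarrow> Compose C X Y Z j i \<in> \<Sigma> X Z"
    and \<Sigma>_iso: "\<lbrakk>X \<in> Obj C; Y \<in> Obj C; i \<in> \<Sigma> X Y\<rbrakk> \<Longrightarrow> isomorphism_in D X Y (Q X Y i)"
    and fraction: "\<lbrakk>X \<in> Obj C; Y \<in> Obj C; \<alpha> \<in> Hom D X Y\<rbrakk> \<Longrightarrow>
      \<exists>Z\<in>Obj C. \<exists>j\<in>\<Sigma> Y Z. \<exists>v\<in>Hom C X Z. Q X Z v = Compose D X Y Z (Q Y Z j) \<alpha>"
    and coequalized: "\<lbrakk>X \<in> Obj C; Y \<in> Obj C; f \<in> Hom C X Y; g \<in> Hom C X Y; Q X Y f = Q X Y g\<rbrakk> \<Longrightarrow>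
      \<exists>Z\<in>Obj C. \<exists>j\<in>\<Sigma> Y Z. Compose C X Y Z j f = Compose C X Y Z j g"
begin

lemma Obj_D: "X \<in> Obj C \<Longrightarrow> X \<in> Obj D" by (simp add: Obj_eq)

lemma square:
  assumes o: "A \<in> Obj C" "X \<in> Obj C" "Y \<in> Obj C" and i: "i \<in> \<Sigma> A X" and f: "f \<in> Hom C A Y"
  obtains Z j v where "Z \<in> Obj C" "j \<in> \<Sigma> Y Z" "v \<in> Hom C X Z" "Compose C A Y Z j f = Compose C A X Z v i"
proof -
  have iH: "i \<in> Hom C A X" by (rule \<Sigma>_Hom[OF o(1,2) i])
  from \<Sigma>_iso[OF o(1,2) i] obtain g where g: "g \<in> Hom D X A" "Compose D A X A g (Q A X i) = Ident D A"
    unfolding isomorphism_in_def by blast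
  have QfH: "Q A Y f \<in> Hom D A Y" and QiH: "Q A X i \<in> Hom D A X" using Q_Hom o f iH by auto
  define \<alpha> where "\<alpha> = Compose D X A Y (Q A Y f) g"
  have \<alpha>: "\<alpha> \<in> Hom D X Y" unfolding \<alpha>_def using D.Compose_in_Hom[of X A Y] o Obj_D g QfH by blast
  have \<alpha>i: "Compose D A X Y \<alpha> (Q A X i) = Q A Y f"
    using D.Compose_assoc[of A X A Y "Q A X i" g "Q A Y f"] D.Compose_Ident_right[of A Y "Q A Y f"] o Obj_D g QfH QiH
    by (simp add: \<alpha>_def)
  from fraction[OF o(2,3) \<alpha>] obtain Z j v where Z: "Z \<in> Obj C" and j: "j \<in> \<Sigma> Y Z" and v: "v \<in> Hom C X Z"
    and eq: "Q X Z v = Compose D X Y Z (Q Y Z j) \<alpha>" by blast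
  have jH: "j \<in> Hom C Y Z" by (rule \<Sigma>_Hom[OF o(3) Z j])
  have QjH: "Q Y Z j \<in> Hom D Y Z" using Q_Hom o Z jH by auto
  have "Q A Z (Compose C A Y Z j f) = Compose D A Y Z (Q Y Z j) (Compose D A X Y \<alpha> (Q A X i))"
    using Q_Compose[OF o(1,3) Z f jH] \<alpha>i by simp
  also have "\<dots> = Compose D A X Z (Q X Z v) (Q A X i)"
    unfolding eq using D.Compose_assoc[of A X Y Z] o Z Obj_D QiH \<alpha> QjH by blast
  also have "\<dots> = Q A Z (Compose C A X Z v i)" using Q_Compose[OF o(1,2) Z iH v] by simp
  finally have "Q A Z (Compose C A Y Z j f) = Q A Z (Compose C A X Z v i)" .
  from coequalized[OF o(1) Z _ _ this] obtain W k where W: "W \<in> Obj C" and k: "k \<in> \<Sigma> Z W"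
    and e: "Compose C A Z W k (Compose C A Y Z j f) = Compose C A Z W k (Compose C A X Z v i)"
    using C.Compose_in_Hom o Z jH f v iH by blast
  have kH: "k \<in> Hom C Z W" by (rule \<Sigma>_Hom[OF Z W k])
  show thesis
  proof (rule that[OF W])
    show "Compose C Y Z W k j \<in> \<Sigma> Y W" by (rule \<Sigma>_Compose[OF o(3) Z W j k])
    show "Compose C X Z W k v \<in> Hom C X W" by (rule C.Compose_in_Hom[OF o(2) Z W v kH])
    show "Compose C A Y W (Compose C Y Z W k j) f = Compose C A X W (Compose C X Z W k v) i"
      using e C.Compose_assoc[OF o(1,3) Z W f jH kH] C.Compose_assoc[OF o(1,2) Z W iH v kH] by simp
  qed
qed

lemma left_invertibility: "left_invertibility C \<Sigma>"
  unfolding left_invertibility_def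
proof (intro conjI ballI impI)
  fix A X Y i f assume "A \<in> Obj C" "X \<in> Obj C" "Y \<in> Obj C" "i \<in> \<Sigma> A X" "f \<in> Hom C A Y"
  from square[OF this] show "\<exists>Z\<in>Obj C. \<exists>j\<in>\<Sigma> Y Z. \<exists>v\<in>Hom C X Z. Compose C A Y Z j f = Compose C A X Z v i"
    by metis
next
  fix A X Y i f g
  assume o: "A \<in> Obj C" "X \<in> Obj C" "Y \<in> Obj C" and i: "i \<in> \<Sigma> A X" and fg: "f \<in> Hom C X Y" "g \<in> Hom C X Y"
    and eq: "Compose C A X Y f i = Compose C A X Y g i"
  have iH: "i \<in> Hom C A X" by (rule \<Sigma>_Hom[OF o(1,2) i])
  from \<Sigma>_iso[OF o(1,2) i] obtain h where h: "h \<in> Hom D X A" "Compose D X A X (Q A X i) h = Ident D X"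
    unfolding isomorphism_in_def by blast
  have "Q X Y f = Compose D X A Y (Compose D A X Y (Q X Y f) (Q A X i)) h" if "f \<in> Hom C X Y" for f
    using D.Compose_assoc[of X A X Y h "Q A X i" "Q X Y f"] D.Compose_Ident_right[of X Y "Q X Y f"]
      o Obj_D h Q_Hom[OF o(1,2) iH] Q_Hom[OF o(2,3) that] by simp
  from this[OF fg(1)] this[OF fg(2)] have "Q X Y f = Q X Y g"
    using Q_Compose[OF o iH fg(1)] Q_Compose[OF o iH fg(2)] eq by simp
  from coequalized[OF o(2,3) fg this]
  show "\<exists>Z\<in>Obj C. \<exists>j\<in>\<Sigma> Y Z. Compose C X Y Z j f = Compose C X Y Z j g" .
qed (use \<Sigma>_Hom \<Sigma>_Ident \<Sigma>_Compose in auto)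

definition represents :: "'o \<Rightarrow> 'o \<Rightarrow> 'o \<times> 'm \<times> 'm \<Rightarrow> 'n \<Rightarrow> bool" where
  "represents X Y = (\<lambda>(P, u, i) \<alpha>. (P, u, i) \<in> cospans C \<Sigma> X Y \<and> \<alpha> \<in> Hom D X Y \<and>
    Compose D X Y P (Q Y P i) \<alpha> = Q X P u)"

lemma represents_iff: "represents X Y (P, u, i) \<alpha> \<longleftrightarrow> P \<in> Obj C \<and> u \<in> Hom C X P \<and> i \<in> \<Sigma> Y P \<and>
    \<alpha> \<in> Hom D X Y \<and> Compose D X Y P (Q Y P i) \<alpha> = Q X P u"
  by (auto simp: represents_def cospans_def)

lemma represents_exists:
  assumes "X \<in> Obj C" "Y \<in> Obj C" "p \<in> cospans C \<Sigma> X Y"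
  obtains \<alpha> where "represents X Y p \<alpha>"
proof -
  obtain P v i where p: "p = (P, v, i)" by (cases p)
  with assms have *: "P \<in> Obj C" "v \<in> Hom C X P" "i \<in> \<Sigma> Y P" by (auto simp: cospans_def)
  from D.isomorphism_in_solve[OF _ _ _ \<Sigma>_iso[OF assms(2) *(1,3)] Q_Hom[OF assms(1) *(1,2)]]
  obtain \<alpha> where "\<alpha> \<in> Hom D X Y" "Compose D X Y P (Q Y P i) \<alpha> = Q X P v"
    using assms * Obj_D by metis
  with * that show thesis by (simp add: p represents_iff)
qed

lemma represents_unique:
  assumes "X \<in> Obj C" "Y \<in> Obj C" "represents X Y p \<alpha>" "represents X Y p \<beta>"
  shows "\<alpha> = \<beta>"
proof -
  obtain P v i where p: "p = (P, v, i)" by (cases p)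
  show ?thesis
    using assms D.isomorphism_in_cancel[OF _ _ _ \<Sigma>_iso[of Y P i], of X \<alpha> \<beta>] Obj_D
    by (auto simp: p represents_iff)
qed

lemma cospan_rel_imp_same:
  assumes o: "X \<in> Obj C" "Y \<in> Obj C" and r: "(p, q) \<in> cospan_rel C \<Sigma> X Y"
    and p: "represents X Y p \<alpha>" and q: "represents X Y q \<beta>"
  shows "\<alpha> = \<beta>"
proof -
  obtain P v i P' v' i' where pq: "p = (P, v, i)" "q = (P', v', i')" by (cases p; cases q) blast
  from r obtain R f g where R: "R \<in> Obj C" and fg: "f \<in> Hom C P R" "g \<in> Hom C P' R"
    and eq: "Compose C X P R f v = Compose C X P' R g v'" "Compose C Y P R f i = Compose C Y P' R g i'"
      "Compose C Y P' R g i' \<in> \<Sigma> Y R"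
    by (auto simp: cospan_rel_def pq)
  have *: "Compose D X Y R (Q Y R (Compose C Y P R f i)) \<alpha> = Q X R (Compose C X P R f v)"
    if P: "P \<in> Obj C" and f: "f \<in> Hom C P R" and rep: "represents X Y (P, v, i) \<alpha>" for P v i f \<alpha>
  proof -
    have a: "v \<in> Hom C X P" "i \<in> Hom C Y P" "\<alpha> \<in> Hom D X Y" "Compose D X Y P (Q Y P i) \<alpha> = Q X P v"
      using rep \<Sigma>_Hom[OF o(2) P] by (auto simp: represents_iff)
    have "Compose D X Y R (Compose D Y P R (Q P R f) (Q Y P i)) \<alpha> = Compose D X P R (Q P R f) (Q X P v)"
      using D.Compose_assoc[of X Y P R \<alpha> "Q Y P i" "Q P R f"] o P R Obj_D a Q_Hom f by simp
    then show ?thesis using Q_Compose o P R a f by simp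
  qed
  have PP: "P \<in> Obj C" "P' \<in> Obj C" using p q by (auto simp: pq represents_iff)
  from *[OF PP(1) fg(1)] *[OF PP(2) fg(2)] p q eq(1,2)
  have "Compose D X Y R (Q Y R (Compose C Y P' R g i')) \<alpha> = Compose D X Y R (Q Y R (Compose C Y P' R g i')) \<beta>"
    unfolding pq by metis
  moreover have "\<alpha> \<in> Hom D X Y" "\<beta> \<in> Hom D X Y" using p q by (auto simp: pq represents_iff)
  ultimately show ?thesis
    using D.isomorphism_in_cancel[OF _ _ _ \<Sigma>_iso[OF o(2) R eq(3)], of X \<alpha> \<beta>] o R Obj_D by blast
qed

lemma same_imp_cospan_rel:
  assumes o: "X \<in> Obj C" "Y \<in> Obj C" and p: "represents X Y p \<alpha>" and q: "represents X Y q \<alpha>"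
  shows "(p, q) \<in> cospan_rel C \<Sigma> X Y"
proof -
  obtain P v i P' v' i' where pq: "p = (P, v, i)" "q = (P', v', i')" by (cases p; cases q) blast
  have P: "P \<in> Obj C" "v \<in> Hom C X P" "i \<in> \<Sigma> Y P" and \<alpha>: "\<alpha> \<in> Hom D X Y" "Compose D X Y P (Q Y P i) \<alpha> = Q X P v"
    and P': "P' \<in> Obj C" "v' \<in> Hom C X P'" "i' \<in> \<Sigma> Y P'" and \<alpha>': "Compose D X Y P' (Q Y P' i') \<alpha> = Q X P' v'"
    using p q by (auto simp: pq represents_iff)
  have iH: "i \<in> Hom C Y P" "i' \<in> Hom C Y P'" using \<Sigma>_Hom o P P' by auto
  from square[OF o(2) P(1) P'(1) P(3) iH(2)] obtain R k w where R: "R \<in> Obj C" and k: "k \<in> \<Sigma> P' R"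
    and w: "w \<in> Hom C P R" and eq: "Compose C Y P' R k i' = Compose C Y P R w i" .
  have kH: "k \<in> Hom C P' R" by (rule \<Sigma>_Hom[OF P'(1) R k])
  have "Q X R (Compose C X P R w v) = Compose D X Y R (Compose D Y P R (Q P R w) (Q Y P i)) \<alpha>"
    using D.Compose_assoc[of X Y P R \<alpha> "Q Y P i" "Q P R w"] o P R Obj_D \<alpha> Q_Hom w iH Q_Compose by simp
  also have "Compose D Y P R (Q P R w) (Q Y P i) = Compose D Y P' R (Q P' R k) (Q Y P' i')"
    using Q_Compose[OF o(2) P(1) R iH(1) w] Q_Compose[OF o(2) P'(1) R iH(2) kH] eq by simp
  also have "Compose D X Y R (Compose D Y P' R (Q P' R k) (Q Y P' i')) \<alpha> = Q X R (Compose C X P' R k v')"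
    using D.Compose_assoc[of X Y P' R \<alpha> "Q Y P' i'" "Q P' R k"] o P' R Obj_D \<alpha> \<alpha>' Q_Hom kH iH Q_Compose by simp
  finally have "Q X R (Compose C X P R w v) = Q X R (Compose C X P' R k v')" .
  moreover have wv: "Compose C X P R w v \<in> Hom C X R" "Compose C X P' R k v' \<in> Hom C X R"
    using C.Compose_in_Hom o P P' R w kH by blast+
  ultimately obtain S l where S: "S \<in> Obj C" and l: "l \<in> \<Sigma> R S"
    and e: "Compose C X R S l (Compose C X P R w v) = Compose C X R S l (Compose C X P' R k v')"
    using coequalized[OF o(1) R] by blast
  have lH: "l \<in> Hom C R S" by (rule \<Sigma>_Hom[OF R S l])
  have "Compose C P R S l w \<in> Hom C P S" "Compose C P' R S l k \<in> Hom C P' S"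
    using C.Compose_in_Hom P P' R S w kH lH by blast+
  moreover have "Compose C X P S (Compose C P R S l w) v = Compose C X P' S (Compose C P' R S l k) v'"
    using e C.Compose_assoc[OF o(1) P(1) R S P(2) w lH] C.Compose_assoc[OF o(1) P'(1) R S P'(2) kH lH] by simp
  moreover have "Compose C Y P S (Compose C P R S l w) i = Compose C Y P' S (Compose C P' R S l k) i'"
    using eq C.Compose_assoc[OF o(2) P(1) R S iH(1) w lH] C.Compose_assoc[OF o(2) P'(1) R S iH(2) kH lH] by simp
  moreover have "Compose C Y P' S (Compose C P' R S l k) i' \<in> \<Sigma> Y S"
    by (intro \<Sigma>_Compose[OF o(2) P'(1) S P'(3)] \<Sigma>_Compose[OF P'(1) R S k l])
  ultimately show ?thesis
    using P P' S unfolding pq cospan_rel_def cospans_def by blast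
qed

lemma cospan_rel_iff:
  assumes o: "X \<in> Obj C" "Y \<in> Obj C"
  shows "(p, q) \<in> cospan_rel C \<Sigma> X Y \<longleftrightarrow> (\<exists>\<alpha>. represents X Y p \<alpha> \<and> represents X Y q \<alpha>)"
proof
  assume r: "(p, q) \<in> cospan_rel C \<Sigma> X Y"
  then have "p \<in> cospans C \<Sigma> X Y" "q \<in> cospans C \<Sigma> X Y" by (auto simp: cospan_rel_def)
  then obtain \<alpha> \<beta> where "represents X Y p \<alpha>" "represents X Y q \<beta>" using represents_exists o by metis
  with cospan_rel_imp_same[OF o r] show "\<exists>\<alpha>. represents X Y p \<alpha> \<and> represents X Y q \<alpha>" by metis
qed (use same_imp_cospan_rel[OF o] in blast)

lemma represents_composite:
  assumes o: "X \<in> Obj C" "Y \<in> Obj C" "Z \<in> Obj C" and p: "represents X Y p \<alpha>" and q: "represents Y Z q \<beta>"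
    and c: "composite_cospan C \<Sigma> X Y Z p q c"
  shows "represents X Z c (Compose D X Y Z \<beta> \<alpha>)"
proof -
  obtain P v i P' v' i' R s l where pq: "p = (P, v, i)" "q = (P', v', i')" "c = (R, s, l)"
    by (cases p; cases q; cases c) blast
  have P: "P \<in> Obj C" "v \<in> Hom C X P" "i \<in> \<Sigma> Y P" and \<alpha>: "\<alpha> \<in> Hom D X Y" "Compose D X Y P (Q Y P i) \<alpha> = Q X P v"
    and P': "P' \<in> Obj C" "v' \<in> Hom C Y P'" "i' \<in> \<Sigma> Z P'" and \<beta>: "\<beta> \<in> Hom D Y Z" "Compose D Y Z P' (Q Z P' i') \<beta> = Q Y P' v'"
    using p q by (auto simp: pq represents_iff)
  from c obtain w k where R: "R \<in> Obj C" and w: "w \<in> Hom C P R" and k: "k \<in> \<Sigma> P' R"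
    and eq: "Compose C Y P R w i = Compose C Y P' R k v'" and s: "s = Compose C X P R w v" and l: "l = Compose C Z P' R k i'"
    by (auto simp: pq)
  have H: "i \<in> Hom C Y P" "i' \<in> Hom C Z P'" "k \<in> Hom C P' R" using \<Sigma>_Hom o P P' R k by auto
  note OD = o[THEN Obj_D] P(1)[THEN Obj_D] P'(1)[THEN Obj_D] R[THEN Obj_D]
  have QH: "Q Y P i \<in> Hom D Y P" "Q Z P' i' \<in> Hom D Z P'" "Q P' R k \<in> Hom D P' R" "Q P R w \<in> Hom D P R"
    "Q Y P' v' \<in> Hom D Y P'" "Q X P v \<in> Hom D X P" using Q_Hom o P P' R H w by auto
  have \<beta>\<alpha>: "Compose D X Y Z \<beta> \<alpha> \<in> Hom D X Z" using D.Compose_in_Hom OD \<alpha> \<beta> by blast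
  have "Compose D X Z R (Q Z R l) (Compose D X Y Z \<beta> \<alpha>)
      = Compose D X Z R (Compose D Z P' R (Q P' R k) (Q Z P' i')) (Compose D X Y Z \<beta> \<alpha>)"
    using Q_Compose[OF o(3) P'(1) R H(2,3)] by (simp add: l)
  also have "\<dots> = Compose D X P' R (Q P' R k) (Compose D X Z P' (Q Z P' i') (Compose D X Y Z \<beta> \<alpha>))"
    using D.Compose_assoc[OF OD(1,3,5,6) \<beta>\<alpha> QH(2,3)] by simp
  also have "Compose D X Z P' (Q Z P' i') (Compose D X Y Z \<beta> \<alpha>) = Compose D X Y P' (Q Y P' v') \<alpha>"
    using D.Compose_assoc[OF OD(1,2,3,5) \<alpha>(1) \<beta>(1) QH(2)] \<beta>(2) by simp
  also have "Compose D X P' R (Q P' R k) (Compose D X Y P' (Q Y P' v') \<alpha>)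
      = Compose D X Y R (Compose D Y P' R (Q P' R k) (Q Y P' v')) \<alpha>"
    using D.Compose_assoc[OF OD(1,2,5,6) \<alpha>(1) QH(5,3)] by simp
  also have "Compose D Y P' R (Q P' R k) (Q Y P' v') = Compose D Y P R (Q P R w) (Q Y P i)"
    using Q_Compose[OF o(2) P'(1) R P'(2) H(3)] Q_Compose[OF o(2) P(1) R H(1) w] eq by simp
  also have "Compose D X Y R (Compose D Y P R (Q P R w) (Q Y P i)) \<alpha> = Compose D X P R (Q P R w) (Q X P v)"
    using D.Compose_assoc[OF OD(1,2,4,6) \<alpha>(1) QH(1,4)] \<alpha>(2) by simp
  also have "\<dots> = Q X R s" using Q_Compose[OF o(1) P(1) R P(2) w] by (simp add: s)
  finally show ?thesis
    using R \<beta>\<alpha> C.Compose_in_Hom[OF o(1) P(1) R P(2) w] \<Sigma>_Compose[OF o(3) P'(1) R P'(3) k]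
    by (simp add: pq represents_iff s l)
qed

lemma composite_exists:
  assumes o: "X \<in> Obj C" "Y \<in> Obj C" "Z \<in> Obj C" and p: "p \<in> cospans C \<Sigma> X Y" and q: "q \<in> cospans C \<Sigma> Y Z"
  obtains c where "composite_cospan C \<Sigma> X Y Z p q c"
proof -
  obtain P v i P' v' i' where pq: "p = (P, v, i)" "q = (P', v', i')" by (cases p; cases q) blast
  have P: "P \<in> Obj C" "i \<in> \<Sigma> Y P" and P': "P' \<in> Obj C" "v' \<in> Hom C Y P'" using p q by (auto simp: pq cospans_def)
  from square[OF o(2) P(1) P'(1) P(2) P'(2)] obtain R k w where R: "R \<in> Obj C" "k \<in> \<Sigma> P' R" "w \<in> Hom C P R"
    "Compose C Y P' R k v' = Compose C Y P R w i" .
  then have "composite_cospan C \<Sigma> X Y Z p q (R, Compose C X P R w v, Compose C Z P' R k i')"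
    unfolding pq composite_cospan.simps by metis
  then show thesis by (rule that)
qed

definition fraction_class :: "'o \<Rightarrow> 'o \<Rightarrow> 'n \<Rightarrow> ('o \<times> 'm \<times> 'm) set" where
  "fraction_class X Y \<alpha> = {p. represents X Y p \<alpha>}"

lemma fraction_class_nonempty:
  assumes "X \<in> Obj C" "Y \<in> Obj C" "\<alpha> \<in> Hom D X Y"
  obtains p where "represents X Y p \<alpha>"
proof -
  from fraction[OF assms] obtain Z j v where "Z \<in> Obj C" "j \<in> \<Sigma> Y Z" "v \<in> Hom C X Z"
    "Q X Z v = Compose D X Y Z (Q Y Z j) \<alpha>" by blast
  with assms have "represents X Y (Z, v, j) \<alpha>" by (simp add: represents_iff)
  then show thesis by (rule that)
qed

lemma cospan_class_eq:
  assumes "X \<in> Obj C" "Y \<in> Obj C" "represents X Y p \<alpha>"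
  shows "cospan_rel C \<Sigma> X Y `` {p} = fraction_class X Y \<alpha>"
  using assms cospan_rel_iff[OF assms(1,2)] represents_unique[OF assms(1,2)]
  unfolding fraction_class_def by blast

lemma Hom_left_fractions:
  assumes "X \<in> Obj C" "Y \<in> Obj C"
  shows "Hom (left_fractions C \<Sigma>) X Y = fraction_class X Y ` Hom D X Y"
proof
  show "Hom (left_fractions C \<Sigma>) X Y \<subseteq> fraction_class X Y ` Hom D X Y"
  proof
    fix a assume "a \<in> Hom (left_fractions C \<Sigma>) X Y"
    then obtain p where p: "p \<in> cospans C \<Sigma> X Y" "a = cospan_rel C \<Sigma> X Y `` {p}"
      by (auto simp: left_fractions_def quotient_def)
    from represents_exists[OF assms p(1)] obtain \<alpha> where \<alpha>: "represents X Y p \<alpha>" .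
    then have "\<alpha> \<in> Hom D X Y" by (cases p) (simp add: represents_iff)
    with cospan_class_eq[OF assms \<alpha>] p(2) show "a \<in> fraction_class X Y ` Hom D X Y" by blast
  qed
  show "fraction_class X Y ` Hom D X Y \<subseteq> Hom (left_fractions C \<Sigma>) X Y"
  proof
    fix a assume "a \<in> fraction_class X Y ` Hom D X Y"
    then obtain \<alpha> where \<alpha>: "\<alpha> \<in> Hom D X Y" "a = fraction_class X Y \<alpha>" by blast
    from fraction_class_nonempty[OF assms \<alpha>(1)] obtain p where p: "represents X Y p \<alpha>" .
    then have "p \<in> cospans C \<Sigma> X Y" by (cases p) (simp add: represents_def)
    then have "cospan_rel C \<Sigma> X Y `` {p} \<in> Hom (left_fractions C \<Sigma>) X Y"
      by (auto simp: left_fractions_def intro: quotientI)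
    then show "a \<in> Hom (left_fractions C \<Sigma>) X Y" by (simp add: cospan_class_eq[OF assms p] \<alpha>(2))
  qed
qed

lemma Compose_left_fractions:
  assumes o: "X \<in> Obj C" "Y \<in> Obj C" "Z \<in> Obj C" and \<alpha>: "\<alpha> \<in> Hom D X Y" and \<beta>: "\<beta> \<in> Hom D Y Z"
  shows "Compose (left_fractions C \<Sigma>) X Y Z (fraction_class Y Z \<beta>) (fraction_class X Y \<alpha>) =
    fraction_class X Z (Compose D X Y Z \<beta> \<alpha>)" (is "?L = ?R")
proof
  show "?L \<subseteq> ?R"
  proof
    fix r assume "r \<in> ?L"
    then obtain p q c where pqc: "represents X Y p \<alpha>" "represents Y Z q \<beta>" "composite_cospan C \<Sigma> X Y Z p q c"
      "(c, r) \<in> cospan_rel C \<Sigma> X Z"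
      unfolding left_fractions_def fraction_class_def cat.simps by blast
    from cospan_class_eq[OF o(1,3) represents_composite[OF o pqc(1-3)]] pqc(4) show "r \<in> ?R" by blast
  qed
  show "?R \<subseteq> ?L"
  proof
    fix r assume r: "r \<in> ?R"
    obtain p where p: "represents X Y p \<alpha>" by (rule fraction_class_nonempty[OF o(1,2) \<alpha>])
    obtain q where q: "represents Y Z q \<beta>" by (rule fraction_class_nonempty[OF o(2,3) \<beta>])
    have "p \<in> cospans C \<Sigma> X Y" "q \<in> cospans C \<Sigma> Y Z"
      using p q by (cases p, simp add: represents_def, cases q, simp add: represents_def)
    from composite_exists[OF o this] obtain c where c: "composite_cospan C \<Sigma> X Y Z p q c" .
    have "(c, r) \<in> cospan_rel C \<Sigma> X Z"
      using cospan_class_eq[OF o(1,3) represents_composite[OF o p q c]] r by blast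
    with p q c show "r \<in> ?L" unfolding left_fractions_def fraction_class_def cat.simps by blast
  qed
qed

lemma Ident_left_fractions:
  assumes X: "X \<in> Obj C"
  shows "Ident (left_fractions C \<Sigma>) X = fraction_class X X (Ident D X)"
proof -
  have "represents X X (X, Ident C X, Ident C X) (Ident D X)"
    using X Obj_D[OF X] C.Ident_in_Hom \<Sigma>_Ident D.Ident_in_Hom D.Compose_Ident_left[of X X "Ident D X"]
    by (simp add: represents_iff Q_Ident)
  from cospan_class_eq[OF X X this] show ?thesis by (simp add: left_fractions_def)
qed

lemma Obj_left_fractions: "Obj (left_fractions C \<Sigma>) = Obj C" by (simp add: left_fractions_def)

lemma category_left_fractions: "category (left_fractions C \<Sigma>)"
proof (unfold_locales, unfold Obj_left_fractions)
  fix X assume "X \<in> Obj C"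
  then show "Ident (left_fractions C \<Sigma>) X \<in> Hom (left_fractions C \<Sigma>) X X"
    using D.Ident_in_Hom Obj_D by (simp add: Hom_left_fractions Ident_left_fractions)
next
  fix X Y Z f g assume o: "X \<in> Obj C" "Y \<in> Obj C" "Z \<in> Obj C"
    and "f \<in> Hom (left_fractions C \<Sigma>) X Y" "g \<in> Hom (left_fractions C \<Sigma>) Y Z"
  then obtain \<alpha> \<beta> where "f = fraction_class X Y \<alpha>" "\<alpha> \<in> Hom D X Y" "g = fraction_class Y Z \<beta>" "\<beta> \<in> Hom D Y Z"
    by (auto simp: Hom_left_fractions)
  then show "Compose (left_fractions C \<Sigma>) X Y Z g f \<in> Hom (left_fractions C \<Sigma>) X Z"
    using o D.Compose_in_Hom[of X Y Z \<alpha> \<beta>] Obj_D by (simp add: Hom_left_fractions Compose_left_fractions)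
next
  fix X Y f assume o: "X \<in> Obj C" "Y \<in> Obj C" and "f \<in> Hom (left_fractions C \<Sigma>) X Y"
  then obtain \<alpha> where f: "f = fraction_class X Y \<alpha>" "\<alpha> \<in> Hom D X Y" by (auto simp: Hom_left_fractions)
  show "Compose (left_fractions C \<Sigma>) X X Y f (Ident (left_fractions C \<Sigma>) X) = f"
    using o f D.Ident_in_Hom[of X] D.Compose_Ident_right[of X Y \<alpha>] Obj_D
    by (simp add: Ident_left_fractions Compose_left_fractions)
  show "Compose (left_fractions C \<Sigma>) X Y Y (Ident (left_fractions C \<Sigma>) Y) f = f"
    using o f D.Ident_in_Hom[of Y] D.Compose_Ident_left[of X Y \<alpha>] Obj_D
    by (simp add: Ident_left_fractions Compose_left_fractions)
next
  fix W X Y Z f g h assume o: "W \<in> Obj C" "X \<in> Obj C" "Y \<in> Obj C" "Z \<in> Obj C"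
    and "f \<in> Hom (left_fractions C \<Sigma>) W X" "g \<in> Hom (left_fractions C \<Sigma>) X Y" "h \<in> Hom (left_fractions C \<Sigma>) Y Z"
  then obtain \<alpha> \<beta> \<gamma> where fg: "f = fraction_class W X \<alpha>" "\<alpha> \<in> Hom D W X" "g = fraction_class X Y \<beta>" "\<beta> \<in> Hom D X Y"
    "h = fraction_class Y Z \<gamma>" "\<gamma> \<in> Hom D Y Z"
    by (auto simp: Hom_left_fractions)
  have "Compose D W X Y \<beta> \<alpha> \<in> Hom D W Y" "Compose D X Y Z \<gamma> \<beta> \<in> Hom D X Z"
    using D.Compose_in_Hom o Obj_D fg by blast+
  then show "Compose (left_fractions C \<Sigma>) W Y Z h (Compose (left_fractions C \<Sigma>) W X Y g f) =
      Compose (left_fractions C \<Sigma>) W X Z (Compose (left_fractions C \<Sigma>) X Y Z h g) f"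
    using o fg D.Compose_assoc[of W X Y Z \<alpha> \<beta> \<gamma>] Obj_D by (simp add: Compose_left_fractions)
qed

lemma left_fractions_well_defined: "left_fractions_well_defined C \<Sigma>"
  unfolding left_fractions_well_defined_def
proof (intro conjI ballI allI impI category_left_fractions)
  fix X Y assume o: "X \<in> Obj C" "Y \<in> Obj C"
  show "equiv (cospans C \<Sigma> X Y) (cospan_rel C \<Sigma> X Y)"
  proof (rule equivI)
    show "cospan_rel C \<Sigma> X Y \<subseteq> cospans C \<Sigma> X Y \<times> cospans C \<Sigma> X Y" by (auto simp: cospan_rel_def)
    show "refl_on (cospans C \<Sigma> X Y) (cospan_rel C \<Sigma> X Y)"
      by (rule refl_onI) (use represents_exists[OF o] cospan_rel_iff[OF o] in metis)
    show "sym (cospan_rel C \<Sigma> X Y)" by (rule symI) (use cospan_rel_iff[OF o] in blast)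
    show "trans (cospan_rel C \<Sigma> X Y)"
      by (rule transI) (use cospan_rel_iff[OF o] represents_unique[OF o] in metis)
  qed
next
  fix X Y Z p q assume "X \<in> Obj C" "Y \<in> Obj C" "Z \<in> Obj C" "p \<in> cospans C \<Sigma> X Y" "q \<in> cospans C \<Sigma> Y Z"
  from composite_exists[OF this] show "\<exists>c. composite_cospan C \<Sigma> X Y Z p q c" by metis
next
  fix X Y Z p p' q q' c c' assume o: "X \<in> Obj C" "Y \<in> Obj C" "Z \<in> Obj C"
    and *: "(p, p') \<in> cospan_rel C \<Sigma> X Y \<and> (q, q') \<in> cospan_rel C \<Sigma> Y Z \<and>
      composite_cospan C \<Sigma> X Y Z p q c \<and> composite_cospan C \<Sigma> X Y Z p' q' c'"
  then obtain \<alpha> \<beta> where "represents X Y p \<alpha>" "represents X Y p' \<alpha>" "represents Y Z q \<beta>" "represents Y Z q' \<beta>"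
    using cospan_rel_iff[OF o(1,2)] cospan_rel_iff[OF o(2,3)] by blast
  then show "(c, c') \<in> cospan_rel C \<Sigma> X Z"
    using represents_composite[OF o] * cospan_rel_iff[OF o(1,3)] by blast
qed

lemma isomorphic_left_fractions: "isomorphic_categories (left_fractions C \<Sigma>) D"
proof -
  define G where "G X Y a = (THE \<alpha>. \<exists>p\<in>a. represents X Y p \<alpha>)" for X Y a
  have G: "G X Y (fraction_class X Y \<alpha>) = \<alpha>" if o: "X \<in> Obj C" "Y \<in> Obj C" and \<alpha>: "\<alpha> \<in> Hom D X Y" for X Y \<alpha>
    unfolding G_def
  proof (rule the_equality)
    show "\<exists>p\<in>fraction_class X Y \<alpha>. represents X Y p \<alpha>"
      using fraction_class_nonempty[OF o \<alpha>] unfolding fraction_class_def by blast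
    show "\<beta> = \<alpha>" if "\<exists>p\<in>fraction_class X Y \<alpha>. represents X Y p \<beta>" for \<beta>
      using that represents_unique[OF o] by (auto simp: fraction_class_def)
  qed
  show ?thesis
    unfolding isomorphic_categories_def Obj_left_fractions
  proof (intro exI[of _ id] exI[of _ G] conjI ballI)
    show "bij_betw id (Obj C) (Obj D)" by (simp add: Obj_eq)
    fix X Y assume o: "X \<in> Obj C" "Y \<in> Obj C"
    show "bij_betw (G X Y) (Hom (left_fractions C \<Sigma>) X Y) (Hom D (id X) (id Y))"
      unfolding bij_betw_def Hom_left_fractions[OF o] inj_on_def using G[OF o] by (auto simp: image_iff)
  next
    fix X assume "X \<in> Obj C"
    then show "G X X (Ident (left_fractions C \<Sigma>) X) = Ident D (id X)"
      using G[of X X "Ident D X"] D.Ident_in_Hom Obj_D by (simp add: Ident_left_fractions)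
  next
    fix X Y Z f g assume o: "X \<in> Obj C" "Y \<in> Obj C" "Z \<in> Obj C"
      and "f \<in> Hom (left_fractions C \<Sigma>) X Y" "g \<in> Hom (left_fractions C \<Sigma>) Y Z"
    then obtain \<alpha> \<beta> where fg: "f = fraction_class X Y \<alpha>" "\<alpha> \<in> Hom D X Y" "g = fraction_class Y Z \<beta>" "\<beta> \<in> Hom D Y Z"
      by (auto simp: Hom_left_fractions)
    then show "G X Z (Compose (left_fractions C \<Sigma>) X Y Z g f) =
        Compose D (id X) (id Y) (id Z) (G Y Z g) (G X Y f)"
      using o G D.Compose_in_Hom[of X Y Z \<alpha> \<beta>] Obj_D by (simp add: Compose_left_fractions)
  qed
qed

end

lemma FDR_iff:
  fixes X Y :: "'u topology"
  assumes u: "(UNIV :: real set) \<lesssim> (UNIV :: 'u set)" and X: "metrizable_space X" and Y: "metrizable_space Y"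
    and i: "closed_embedding X Y i"
  shows "FDR_embedding X Y i \<longleftrightarrow> isomorphism_in fSh X Y (fsh_functor X Y (homotopy_class X Y i))"
proof -
  have "continuous_map X Y i" using i embedding_map_continuous by (auto simp: closed_embedding_def)
  then show ?thesis
    using FDR_embedding_isomorphism[OF u, of X Y i] closed_embedding_FDR[OF u X Y i]
      fsh_functor_class[OF u X Y, of i] by metis
qed

lemma closed_embedding_compose:
  assumes f: "closed_embedding X Y f" and g: "closed_embedding Y Z g"
  shows "closed_embedding X Z (g \<circ> f)"
proof -
  have "homeomorphic_map Y (subtopology Z (g ` topspace Y)) g" "closedin Z (g ` topspace Y)"
    "closedin Y (f ` topspace X)"
    using f g by (auto simp: closed_embedding_def embedding_map_def)
  then have "closedin Z (g ` f ` topspace X)"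
    using homeomorphic_map_closedness[OF _ closedin_subset] closedin_trans_full by blast
  then show ?thesis
    using f g embedding_map_compose by (auto simp: closed_embedding_def image_comp)
qed

lemma fraction_functor_fSh:
  assumes u: "(UNIV :: real set) \<lesssim> (UNIV :: 'u set)"
  shows "fraction_functor (hM :: ('u topology, ('u \<Rightarrow> 'u) set) cat) fSh FDR fsh_functor"
proof -
  interpret C: category "hM :: ('u topology, ('u \<Rightarrow> 'u) set) cat" by (rule category_hM)
  note functor_class = fsh_functor_class[OF u]
  interpret D: category "fSh :: ('u topology, 'u fsh_rep set) cat" by (rule category_fSh[OF u])
  have emb_cont: "continuous_map X Y i" if "closed_embedding X Y i" for X Y :: "'u topology" and i
    using that embedding_map_continuous by (auto simp: closed_embedding_def)
  have comp: "fsh_functor X Z (Compose hM X Y Z g f) = Compose fSh X Y Z (fsh_functor Y Z g) (fsh_functor X Y f)"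
    if o: "metrizable_space X" "metrizable_space Y" "metrizable_space Z" and "f \<in> Hom hM X Y" "g \<in> Hom hM Y Z"
    for X Y Z :: "'u topology" and f g
  proof -
    from that obtain f0 g0 where "f = homotopy_class X Y f0" "continuous_map X Y f0"
      "g = homotopy_class Y Z g0" "continuous_map Y Z g0" by (auto simp: Hom_hM)
    then show ?thesis
      using o induced_fsh_class_compose[OF u o, of f0 g0] continuous_map_compose[of X Y f0 Z g0]
      by (simp add: hM_Compose_class fsh_functor_class[OF u])
  qed
  have iso: "isomorphism_in fSh X Y (fsh_functor X Y i)" if "metrizable_space X" "metrizable_space Y" "i \<in> FDR X Y"
    for X Y :: "'u topology" and i
    using that FDR_iff[OF u] by (auto simp: FDR_def FDR_embedding_def)
  have FDR_I: "homotopy_class X Y i \<in> FDR X Y"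
    if "metrizable_space X" "metrizable_space Y" "closed_embedding X Y i"
      "isomorphism_in fSh X Y (fsh_functor X Y (homotopy_class X Y i))" for X Y :: "'u topology" and i
    using that FDR_iff[OF u] by (auto simp: FDR_def)
  show ?thesis
  proof (unfold_locales, goal_cases)
    case 1 then show ?case by (simp add: Obj_hM Obj_fSh)
  next
    case (2 X Y f) then show ?case
      using induced_fsh_class_in_Hom[OF u, of X Y] by (auto simp: Obj_hM Hom_hM fsh_functor_class[OF u])
  next
    case (3 X Y Z f g) then show ?case using comp by (simp add: Obj_hM)
  next
    case (4 X) then show ?case by (simp add: Obj_hM Ident_hM Ident_fSh fsh_functor_class[OF u])
  next
    case (5 X Y i) then show ?case
      using emb_cont by (auto simp: FDR_def FDR_embedding_def Hom_hM)
  next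
    case (6 X)
    then have X: "metrizable_space X" by (simp add: Obj_hM)
    have "isomorphism_in fSh X X (Ident fSh X)"
      unfolding isomorphism_in_def using D.Ident_in_Hom[of X] D.Compose_Ident_left[of X X "Ident fSh X"] X
      by (auto simp: Obj_fSh)
    moreover have "closed_embedding X X id" by (simp add: closed_embedding_def embedding_map_def)
    ultimately show ?case using FDR_I[OF X X] by (simp add: Ident_hM Ident_fSh fsh_functor_class[OF u X X])
  next
    case (7 X Y Z i j)
    then have o: "metrizable_space X" "metrizable_space Y" "metrizable_space Z" by (auto simp: Obj_hM)
    from 7 obtain i0 j0 where ij: "i = homotopy_class X Y i0" "closed_embedding X Y i0"
      "j = homotopy_class Y Z j0" "closed_embedding Y Z j0"
      by (auto simp: FDR_def FDR_embedding_def)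
    then have c: "Compose hM X Y Z j i = homotopy_class X Z (j0 \<circ> i0)" by (simp add: hM_Compose_class emb_cont)
    have "isomorphism_in fSh X Z (Compose fSh X Y Z (fsh_functor Y Z j) (fsh_functor X Y i))"
      using D.isomorphism_in_compose iso 7 o by (simp add: Obj_fSh)
    moreover have h: "i \<in> Hom hM X Y" "j \<in> Hom hM Y Z" using ij emb_cont by (auto simp: Hom_hM)
    ultimately have "isomorphism_in fSh X Z (fsh_functor X Z (homotopy_class X Z (j0 \<circ> i0)))"
      using comp[OF o h] unfolding c by simp
    then show ?case unfolding c using FDR_I[OF o(1,3) closed_embedding_compose[OF ij(2,4)]] by blast
  next
    case (8 X Y i) then show ?case using iso by (simp add: Obj_hM)
  next
    case (9 X Y \<alpha>)
    then have o: "metrizable_space X" "metrizable_space Y" by (auto simp: Obj_hM)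
    from fsh_left_fraction[OF u o 9(3)] obtain S j v where S: "metrizable_space S" "closed_embedding Y S j"
      "isomorphism_in fSh Y S (induced_fsh_class Y S j)" "continuous_map X S v"
      "induced_fsh_class X S v = Compose fSh X Y S (induced_fsh_class Y S j) \<alpha>" .
    have "homotopy_class Y S j \<in> FDR Y S"
      using FDR_I[OF o(2) S(1,2)] S(3) fsh_functor_class[OF u o(2) S(1) emb_cont[OF S(2)]] by simp
    moreover have "homotopy_class X S v \<in> Hom hM X S" using S(4) by (auto simp: Hom_hM)
    moreover have "fsh_functor X S (homotopy_class X S v) = Compose fSh X Y S (fsh_functor Y S (homotopy_class Y S j)) \<alpha>"
      using S(5) fsh_functor_class[OF u o(2) S(1) emb_cont[OF S(2)]] fsh_functor_class[OF u o(1) S(1,4)] by simp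
    ultimately show ?case using S(1) unfolding Obj_hM by blast
  next
    case (10 X Y f g)
    then have o: "metrizable_space X" "metrizable_space Y" by (auto simp: Obj_hM)
    from 10 obtain f0 g0 where fg: "f = homotopy_class X Y f0" "continuous_map X Y f0"
      "g = homotopy_class X Y g0" "continuous_map X Y g0" by (auto simp: Hom_hM)
    with 10 o have "induced_fsh_class X Y f0 = induced_fsh_class X Y g0" by (simp add: fsh_functor_class[OF u])
    from fsh_equal_imp_coequalized[OF u o fg(2,4) this] obtain S j where S: "metrizable_space S" "closed_embedding Y S j"
      "isomorphism_in fSh Y S (induced_fsh_class Y S j)" "homotopic_with (\<lambda>_. True) X S (j \<circ> f0) (j \<circ> g0)" .
    note j = emb_cont[OF S(2)]
    have "homotopy_class Y S j \<in> FDR Y S"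
      using FDR_I[OF o(2) S(1,2)] S(3) fsh_functor_class[OF u o(2) S(1) j] by simp
    moreover have "Compose hM X Y S (homotopy_class Y S j) f = Compose hM X Y S (homotopy_class Y S j) g"
      using homotopy_class_eq_iff[OF continuous_map_compose[OF fg(2) j]] S(4) by (simp add: fg hM_Compose_class j)
    ultimately show ?case using S(1) unfolding Obj_hM by blast
  qed
qed

theorem theorem1p4:
  assumes "(UNIV :: real set) \<lesssim> (UNIV :: 'u set)"
  shows "category (hM :: ('u topology, ('u \<Rightarrow> 'u) set) cat) \<and>
    category (fSh :: ('u topology, 'u fsh_rep set) cat) \<and>
    left_invertibility (hM :: ('u topology, ('u \<Rightarrow> 'u) set) cat) FDR \<and>
    (\<forall>(X :: 'u topology) Y f. metrizable_space X \<and> metrizable_space Y \<and> closed_embedding X Y f \<and>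
      isomorphism_in hM X Y (homotopy_class X Y f) \<longrightarrow> homotopy_class X Y f \<in> FDR X Y) \<and>
    left_fractions_well_defined (hM :: ('u topology, ('u \<Rightarrow> 'u) set) cat) FDR \<and>
    isomorphic_categories
      (left_fractions (hM :: ('u topology, ('u \<Rightarrow> 'u) set) cat) FDR)
      (fSh :: ('u topology, 'u fsh_rep set) cat)"
proof -
  interpret F: fraction_functor "hM :: ('u topology, ('u \<Rightarrow> 'u) set) cat" fSh FDR fsh_functor
    by (rule fraction_functor_fSh[OF assms])
  have "homotopy_class X Y f \<in> FDR X Y"
    if o: "metrizable_space X" "metrizable_space Y" and f: "closed_embedding X Y f"
      and iso: "isomorphism_in hM X Y (homotopy_class X Y f)" for X Y :: "'u topology" and f
  proof -
    have XY: "X \<in> Obj hM" "Y \<in> Obj hM" using o by (auto simp: Obj_hM)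
    from iso obtain g where g: "homotopy_class X Y f \<in> Hom hM X Y" "g \<in> Hom hM Y X"
      "Compose hM X Y X g (homotopy_class X Y f) = Ident hM X" "Compose hM Y X Y (homotopy_class X Y f) g = Ident hM Y"
      unfolding isomorphism_in_def by blast
    have "isomorphism_in fSh X Y (fsh_functor X Y (homotopy_class X Y f))"
      unfolding isomorphism_in_def
      using F.Q_Hom[OF XY g(1)] F.Q_Hom[OF XY(2,1) g(2)] F.Q_Compose[OF XY XY(1) g(1,2)]
        F.Q_Compose[OF XY(2,1,2) g(2,1)] F.Q_Ident XY g(3,4) by metis
    then show ?thesis using FDR_iff[OF assms o f] by (auto simp: FDR_def)
  qed
  then show ?thesis
    using F.C.category_axioms F.D.category_axioms F.left_invertibility F.left_fractions_well_defined
      F.isomorphic_left_fractions by blast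
qed

end
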